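(* Let $\boldsymbol{a}=(a_\ell)_{\ell\in\mathbb{Z}}$ be a complex valued sequence satisfying Assumptions (A1) and (A2) of the context, with associated data $K$, $\underline{\kappa}_k$, $\alpha_k$, $\beta_k$, $\mu_k$ ($k\in\{1,\dots,K\}$), polynomials $P_{k,m}$, and functions $H^{\beta}_{2\mu}$ as defined in the context. Then there exist an integer $L\in\mathbb{N}^*$ and a constant $c_0>0$ such that for any $n\in\mathbb{N}^*$ and any $\ell\in\mathbb{Z}$ with $|\ell|>L\,n$, there holds $$ \left|\boldsymbol{a}^{\star n}_\ell\right|\le \exp(-c_0\,n-c_0\,|\ell|). $$ Moreover, for any integer $M\in\mathbb{N}$, there exist positive constants $C_M$ and $c_M$ (depending on $M$ and $\boldsymbol{a}$) such that for any $n\in\mathbb{N}^*$ and any $\ell\in\mathbb{Z}$ with $|\ell|\le L\,n$, there holds $$ \left|\boldsymbol{a}^{\star n}_\ell-\sum_{k=1}^K\frac{\underline{\kappa}_k^{-\ell}F_{\boldsymbol{a}}(\underline{\kappa}_k)^n}{n^{1/(2\mu_k)}}\,H^{\beta_k}_{2\mu_k}\!\left(\frac{\ell-\alpha_k n}{n^{1/(2\mu_k)}}\right)-\sum_{k=1}^K\sum_{m=1}^M\frac{\underline{\kappa}_k^{-\ell}F_{\boldsymbol{a}}(\underline{\kappa}_k)^n}{n^{(m+1)/(2\mu_k)}}\Big(P_{k,m}(-\mathrm{d}/\mathrm{d}x)H^{\beta_k}_{2\mu_k}\Big)\!\left(\frac{\ell-\alpha_k n}{n^{1/(2\mu_k)}}\right)\right|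 $$ $$ \le C_M\sum_{k=1}^K\frac{1}{n^{(M+2)/(2\mu_k)}}\exp\left(-c_M\left(\frac{|\ell-\alpha_k n|}{n^{1/(2\mu_k)}}\right)^{\frac{2\mu_k}{2\mu_k-1}}\right). $$
   Context: Notation: $\mathbb{N}=\{0,1,2,\dots\}$, $\mathbb{N}^*=\{1,2,\dots\}$, $\mathbf{i}$ is the imaginary unit, $\mathbb{S}^1$ is the unit circle in $\mathbb{C}$. Convolution: for complex sequences $\boldsymbol{a},\boldsymbol{b}$ indexed by $\mathbb{Z}$ (when the sums make sense), $(\boldsymbol{a}\star\boldsymbol{b})_\ell=\sum_{\ell'\in\mathbb{Z}}a_{\ell-\ell'}b_{\ell'}$. Set $\boldsymbol{a}^{\star 1}:=\boldsymbol{a}$ and $\boldsymbol{a}^{\star(n+1)}:=\boldsymbol{a}^{\star n}\star\boldsymbol{a}$ for $n\in\mathbb{N}^*$; $\boldsymbol{a}^{\star n}_\ell$ is the entry of index $\ell$ of $\boldsymbol{a}^{\star n}$. Assumption (A1): $\boldsymbol{a}\in\ell^1(\mathbb{Z};\mathbb{C})$, the series $F_{\boldsymbol{a}}(\zeta)=\sum_{\ell\in\mathbb{Z}}a_\ell\zeta^\ell$ defines a holomorphic function on an annulus $\{\zeta\in\mathbb{C}\,|\,1-\varepsilon<|\zeta|<1+\varepsilon\}$ for some $\varepsilon>0$, and $\sup_{\kappa\in\mathbb{S}^1}|F_{\boldsymbol{a}}(\kappa)|=1$. Assumption (A2): there is a finite set of pairwise distinct points $\{\underline{\kappa}_1,\dots,\underline{\kappa}_K\}\subset\mathbb{S}^1$,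 $K\ge1$, such that $|F_{\boldsymbol{a}}(\underline{\kappa}_k)|=1$ for all $k$ and $|F_{\boldsymbol{a}}(\kappa)|<1$ for all $\kappa\in\mathbb{S}^1\setminus\{\underline{\kappa}_1,\dots,\underline{\kappa}_K\}$. Moreover, for each $k\in\{1,\dots,K\}$ there exist a real number $\alpha_k$, a complex number $\beta_k$ with positive real part and an integer $\mu_k\in\mathbb{N}^*$ such that, as the complex number $\xi$ tends to $0$, $$F_{\boldsymbol{a}}(\underline{\kappa}_k\mathrm{e}^{\mathbf{i}\xi})=F_{\boldsymbol{a}}(\underline{\kappa}_k)\exp\big(\mathbf{i}\alpha_k\xi-\beta_k\xi^{2\mu_k}+O(\xi^{2\mu_k+1})\big).$$ Cumulants: the complex numbers $\gamma_{k,\nu}$, $\nu\ge2\mu_k+1$, are the coefficients of the convergent power series such that, for all sufficiently small $\xi\in\mathbb{C}$, $$F_{\boldsymbol{a}}(\underline{\kappa}_k\mathrm{e}^{\mathbf{i}\xi})=F_{\boldsymbol{a}}(\underline{\kappa}_k)\exp\Big(\mathbf{i}\alpha_k\xi-\beta_k\xi^{2\mu_k}+\sum_{\nu\ge2\mu_k+1}\frac{\gamma_{k,\nu}}{\nu!}(\mathbf{i}\xi)^\nu\Big).$$ Polynomials $P_{k,m}$, $m\ge1$: defined by the expansion, as a power series in the two variables $(Y,Z)$, $$\exp\Big(\sum_{\nu\ge1}\frac{\gamma_{k,2\mu_k+\nu}}{(2\mu_k+\nu)!}Y^{2\mu_k+\nu}Z^\nu\Big)=1+\sum_{m\ge1}P_{k,m}(Y)Z^m.$$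 For a polynomial $P(Y)=\sum_j p_jY^j$, $P(-\mathrm{d}/\mathrm{d}x)$ denotes the differential operator $f\mapsto\sum_j p_j(-1)^jf^{(j)}$. Functions $H^\beta_{2\mu}$: for $\mu\in\mathbb{N}^*$ and $\beta\in\mathbb{C}$ with positive real part, $$H^\beta_{2\mu}(x)=\frac{1}{2\pi}\int_{\mathbb{R}}\mathrm{e}^{-\mathbf{i}x\theta}\,\mathrm{e}^{-\beta\theta^{2\mu}}\,\mathrm{d}\theta,\qquad x\in\mathbb{R}.$$ *)

theory Defs
  imports "HOL-Complex_Analysis.Complex_Analysis" "HOL-Library.Landau_Symbols"
begin

definition conv :: "(int \<Rightarrow> complex) \<Rightarrow> (int \<Rightarrow> complex) \<Rightarrow> int \<Rightarrow> complex" where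
  "conv a b l = (\<Sum>\<^sub>\<infinity>l'\<in>UNIV. a (l - l') * b l')"

text \<open>Only exponents \<open>n \<ge> 1\<close> matter below; the value at \<open>0\<close> is the neutral element of
  convolution.\<close>

fun conv_power :: "(int \<Rightarrow> complex) \<Rightarrow> nat \<Rightarrow> int \<Rightarrow> complex" where
  "conv_power a 0 = (\<lambda>l. if l = 0 then 1 else 0)"
| "conv_power a (Suc 0) = a"
| "conv_power a (Suc (Suc n)) = conv (conv_power a (Suc n)) a"

definition symbol :: "(int \<Rightarrow> complex) \<Rightarrow> complex \<Rightarrow> complex" where
  "symbol a z = (\<Sum>\<^sub>\<infinity>l\<in>UNIV. a l * z powi l)"

definition assumption_A1 :: "(int \<Rightarrow> complex) \<Rightarrow> bool" where
  "assumption_A1 a \<longleftrightarrow>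
     (\<lambda>l. norm (a l)) summable_on UNIV \<and>
     (\<exists>\<epsilon>>0.
        (\<forall>z. 1 - \<epsilon> < norm z \<and> norm z < 1 + \<epsilon> \<longrightarrow> (\<lambda>l. a l * z powi l) summable_on UNIV) \<and>
        symbol a holomorphic_on {z. 1 - \<epsilon> < norm z \<and> norm z < 1 + \<epsilon>}) \<and>
     (SUP z\<in>sphere 0 1. norm (symbol a z)) = 1"

text \<open>The points are indexed by \<open>{1..K}\<close>; values of \<open>\<kappa>\<close>, \<open>\<alpha>\<close>, \<open>\<beta>\<close>, \<open>\<mu>\<close> elsewhere are irrelevant.
  The function \<open>r\<close> is the \<open>O(\<xi>\<^bsup>2\<mu>+1\<^esup>)\<close> term inside the exponential.\<close>

definition assumption_A2 ::
  "(int \<Rightarrow> complex) \<Rightarrow> nat \<Rightarrow> (nat \<Rightarrow> complex) \<Rightarrow> (nat \<Rightarrow> real) \<Rightarrow> (nat \<Rightarrow> complex) \<Rightarrow> (nat \<Rightarrow> nat) \<Rightarrow> bool"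
where
  "assumption_A2 a K \<kappa> \<alpha> \<beta> \<mu> \<longleftrightarrow>
     K \<ge> 1 \<and> inj_on \<kappa> {1..K} \<and> \<kappa> ` {1..K} \<subseteq> sphere 0 1 \<and>
     (\<forall>k\<in>{1..K}. norm (symbol a (\<kappa> k)) = 1) \<and>
     (\<forall>z\<in>sphere 0 1 - \<kappa> ` {1..K}. norm (symbol a z) < 1) \<and>
     (\<forall>k\<in>{1..K}. Re (\<beta> k) > 0 \<and> \<mu> k \<ge> 1 \<and>
        (\<exists>r :: complex \<Rightarrow> complex.
           r \<in> O[at 0](\<lambda>\<xi>. \<xi> ^ (2 * \<mu> k + 1)) \<and>
           (\<forall>\<^sub>F \<xi> in at 0.
              symbol a (\<kappa> k * exp (\<i> * \<xi>)) =
              symbol a (\<kappa> k) *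
                exp (\<i> * of_real (\<alpha> k) * \<xi> - \<beta> k * \<xi> ^ (2 * \<mu> k) + r \<xi>))))"

text \<open>The cumulants of index at least \<open>2\<mu>+1\<close>. They are extended by \<open>0\<close> to smaller indices, which
  makes the sequence unique and lets the series run over all of \<open>nat\<close>.\<close>

definition cumulant ::
  "(int \<Rightarrow> complex) \<Rightarrow> complex \<Rightarrow> real \<Rightarrow> complex \<Rightarrow> nat \<Rightarrow> nat \<Rightarrow> complex"
where
  "cumulant a \<kappa> \<alpha> \<beta> \<mu> = (THE \<gamma>.
     (\<forall>\<nu> < 2 * \<mu> + 1. \<gamma> \<nu> = 0) \<and>
     (\<forall>\<^sub>F \<xi> in nhds 0.
        summable (\<lambda>\<nu>. \<gamma> \<nu> / fact \<nu> * (\<i> * \<xi>) ^ \<nu>) \<and>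
        symbol a (\<kappa> * exp (\<i> * \<xi>)) =
        symbol a \<kappa> *
          exp (\<i> * of_real \<alpha> * \<xi> - \<beta> * \<xi> ^ (2 * \<mu>)
               + (\<Sum>\<nu>. \<gamma> \<nu> / fact \<nu> * (\<i> * \<xi>) ^ \<nu>))))"

text \<open>Power series in \<open>(Y, Z)\<close> are viewed as formal power series in \<open>Z\<close> whose coefficients are
  polynomials in \<open>Y\<close>; the outer series in the composition is that of the exponential.\<close>

definition expansion_poly :: "(nat \<Rightarrow> complex) \<Rightarrow> nat \<Rightarrow> nat \<Rightarrow> complex poly" where
  "expansion_poly \<gamma> \<mu> m =
     fps_nth
       (fps_compose
          (Abs_fps (\<lambda>j. [:1 / fact j:]))
          (Abs_fps (\<lambda>\<nu>. if \<nu> = 0 then 0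
                        else monom (\<gamma> (2 * \<mu> + \<nu>) / fact (2 * \<mu> + \<nu>)) (2 * \<mu> + \<nu>))))
       m"

definition nth_vector_derivative :: "nat \<Rightarrow> (real \<Rightarrow> complex) \<Rightarrow> real \<Rightarrow> complex" where
  "nth_vector_derivative j = (\<lambda>f x. vector_derivative f (at x)) ^^ j"

text \<open>The operator \<open>P(-d/dx)\<close>.\<close>

definition poly_neg_deriv :: "complex poly \<Rightarrow> (real \<Rightarrow> complex) \<Rightarrow> real \<Rightarrow> complex" where
  "poly_neg_deriv P f x =
     (\<Sum>j\<le>degree P. coeff P j * (-1) ^ j * nth_vector_derivative j f x)"

text \<open>\<open>H_fun \<beta> \<mu>\<close> is the function with exponent \<open>2\<mu>\<close>, usually written with subscript \<open>2\<mu>\<close>.\<close>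

definition H_fun :: "complex \<Rightarrow> nat \<Rightarrow> real \<Rightarrow> complex" where
  "H_fun \<beta> \<mu> x =
     1 / (2 * of_real pi) *
       (LINT \<theta>|lborel. exp (- \<i> * of_real x * of_real \<theta>) * exp (- \<beta> * of_real \<theta> ^ (2 * \<mu>)))"

end

theory Submission
  imports Defs "HOL-Probability.Characteristic_Functions"
begin

text \<open>
  The coefficient of index \<open>l\<close> is the Fourier integral of the \<open>n\<close>-th power of the symbol. Off small
  arcs around the points \<open>\<kappa>\<^sub>k\<close> the symbol is bounded by some \<open>q < 1\<close>, which contributes \<open>O(q ^ n)\<close>.
  On the \<open>k\<close>-th arc one rescales by \<open>N = n powr (1 / (2\<mu>))\<close>. The integrand becomes
  \<open>exp (- \<i>x\<theta> - \<beta>\<theta>\<^sup>2\<^sup>\<mu>)\<close> times a function of \<open>Y = \<i>\<theta>\<close> and \<open>Z = 1 / N\<close>, whose Taylor polynomial in \<open>Z\<close>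
  has the coefficients \<open>P\<^sub>m(Y)\<close> and produces the main terms. Cauchy's estimates on the disc
  \<open>\<bar>Z\<bar> \<le> \<rho> / \<bar>Y\<bar>\<close> bound the remainder by \<open>N\<close> to the power \<open>-(M+1)\<close>, up to a factor
  \<open>exp (2\<epsilon> \<bar>\<theta>\<bar>\<^sup>2\<^sup>\<mu>)\<close> that the kernel absorbs. The decay in \<open>x\<close> comes from moving the contour by
  an amount proportional to \<open>\<bar>x\<bar> powr (1 / (2\<mu> - 1))\<close> into the complex plane.
\<close>

text \<open>The restriction \<open>\<bar>l\<bar> \<le> L n\<close> is what makes the contour shift
  possible. It gives \<open>\<bar>x\<bar> \<le> B N ^ (2\<mu> - 1)\<close>, so a shift proportional
  to \<open>\<bar>x\<bar> powr (1 / (2\<mu> - 1))\<close> is at most a multiple of \<open>N\<close>;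
  in the unscaled variable it stays in a fixed disc where the logarithm of the symbol is
  holomorphic. With p = 2\<mu> / (2\<mu> - 1) the same inequality yields
  \<open>\<bar>x\<bar> powr p \<le> B powr p * n\<close>. Hence an error exponentially small in n is
  also bounded by any power of 1 / N times exp (- c \<bar>x\<bar> powr p). The integral off the
  arcs, the vertical edges of the contour and the tails of the main terms beyond the arcs are all
  disposed of in this way. The shift is applied to the difference between the integrand and its
  Taylor polynomial, so the power of N and the decay in x come out of one estimate. For
  \<open>\<bar>l\<bar> > L n\<close> the argument is different: analyticity in the annulus supplies
  an exponential weight under which each convolution costs a bounded factor, and \<open>L\<close> is
  taken so large that the weight wins.\<close>

section \<open>Convolution powers\<close>

text \<open>Since exp (- s \<bar>l - l'\<bar>) \<le> exp (- s \<bar>l\<bar>) exp (s \<bar>l'\<bar>),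
  the weight passes through a convolution: a weighted sup bound on one factor and a weighted sum of
  the other give a sup bound with the same weight. Every further factor \<open>a\<close> costs one
  factor \<open>A\<close>.\<close>

lemma conv_power_weighted_bound:
  fixes a :: "int \<Rightarrow> complex"
  assumes summ: "(\<lambda>l. norm (a l) * exp (s * \<bar>real_of_int l\<bar>)) summable_on UNIV" and s: "s \<ge> 0"
    and A: "(\<Sum>\<^sub>\<infinity>l. norm (a l) * exp (s * \<bar>real_of_int l\<bar>)) \<le> A"
  shows "norm (conv_power a (Suc n) l) \<le> A ^ Suc n * exp (- s * \<bar>real_of_int l\<bar>)"
proof (induction n arbitrary: l)
  let ?w = "\<lambda>l. norm (a l) * exp (s * \<bar>real_of_int l\<bar>)"
  case 0
  have "?w l = (\<Sum>\<^sub>\<infinity>l\<in>{l}. ?w l)" by simp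
  also have "\<dots> \<le> (\<Sum>\<^sub>\<infinity>l. ?w l)"
    by (rule infsum_mono_neutral) (use summ in auto)
  finally show ?case using A by (simp add: exp_minus field_simps)
next
  let ?w = "\<lambda>l. norm (a l) * exp (s * \<bar>real_of_int l\<bar>)"
  case (Suc n)
  have A0: "A \<ge> 0" using A infsum_nonneg[of UNIV ?w] by simp
  let ?b = "\<lambda>l'. A ^ Suc n * exp (- s * \<bar>real_of_int l\<bar>) * ?w l'"
  have le: "norm (conv_power a (Suc n) (l - l') * a l') \<le> ?b l'" for l'
  proof -
    have "norm (conv_power a (Suc n) (l - l') * a l')
        \<le> A ^ Suc n * exp (- s * \<bar>real_of_int (l - l')\<bar>) * norm (a l')"
      unfolding norm_mult by (intro mult_right_mono Suc.IH) auto
    also have "exp (- s * \<bar>real_of_int (l - l')\<bar>)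
        \<le> exp (- s * \<bar>real_of_int l\<bar>) * exp (s * \<bar>real_of_int l'\<bar>)"
    proof -
      have "s * \<bar>real_of_int l\<bar> \<le> s * (\<bar>real_of_int (l - l')\<bar> + \<bar>real_of_int l'\<bar>)"
        using s by (intro mult_left_mono) auto
      then show ?thesis by (simp add: exp_add[symmetric] algebra_simps)
    qed
    finally show ?thesis using A0 by (simp add: mult_left_mono mult_right_mono mult.assoc mult.left_commute mult.commute)
  qed
  have sb: "?b summable_on UNIV" using summ by (rule summable_on_cmult_right)
  have "norm (conv_power a (Suc (Suc n)) l) \<le> (\<Sum>\<^sub>\<infinity>l'. ?b l')"
    unfolding conv_power.simps conv_def
  proof (rule norm_infsum_le[OF has_sum_infsum has_sum_infsum[OF sb]])
    show "(\<lambda>l'. conv_power a (Suc n) (l - l') * a l') summable_on UNIV"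
      by (rule abs_summable_summable, rule summable_on_comparison_test[OF sb]) (use le in auto)
  qed (rule le)
  also have "\<dots> = A ^ Suc n * exp (- s * \<bar>real_of_int l\<bar>) * (\<Sum>\<^sub>\<infinity>l. ?w l)"
    using summ by (intro infsum_cmult_right) auto
  also have "\<dots> \<le> A ^ Suc n * exp (- s * \<bar>real_of_int l\<bar>) * A"
    using A A0 by (intro mult_left_mono) auto
  finally show ?case by (simp add: mult_ac)
qed

text \<open>Summability over \<open>UNIV\<close> is unconditional, hence absolute, so the Laurent
  series can be used at the two radii exp s and exp (- s) inside the annulus; the sum of the two
  powers dominates exp (s \<bar>l\<bar>).\<close>

lemma A1_weighted_summable:
  assumes "assumption_A1 a"
  obtains s where "s > 0" "(\<lambda>l. norm (a l) * exp (s * \<bar>real_of_int l\<bar>)) summable_on UNIV"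
proof -
  obtain \<epsilon> where e: "\<epsilon> > 0"
    and sm: "\<And>z. 1 - \<epsilon> < norm z \<Longrightarrow> norm z < 1 + \<epsilon> \<Longrightarrow> (\<lambda>l. a l * z powi l) summable_on UNIV"
    using assms unfolding assumption_A1_def by blast
  define d where "d = min (\<epsilon>/2) (1/2)"
  have d: "0 < d" "d < \<epsilon>" "d < 1" using e by (auto simp: d_def)
  \<comment> \<open>The minimum gives both exp s \<le> 1 + d and exp (- s) \<ge> 1 - d; the cap 1/2
    in \<open>d\<close> keeps 1 - d positive.\<close>
  define s where "s = min (ln (1 + d)) (- ln (1 - d))"
  have s0: "s > 0" using d by (auto simp: s_def)
  have r1: "exp s \<le> 1 + d" "exp (-s) \<ge> 1 - d"
  proof -
    have "exp s \<le> exp (ln (1 + d))" unfolding exp_le_cancel_iff s_def by auto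
    then show "exp s \<le> 1 + d" using d by simp
    have "exp (-s) \<ge> exp (ln (1 - d))" unfolding exp_le_cancel_iff s_def by auto
    then show "exp (-s) \<ge> 1 - d" using d by simp
  qed
  have "exp (-s) < 1" "exp s > 1" using s0 by auto
  have ab: "(\<lambda>l. norm (a l) * (exp t) powi l) summable_on UNIV" if t: "t = s \<or> t = -s" for t
  proof -
    have "(\<lambda>l. a l * (of_real (exp t)) powi l) summable_on UNIV"
      using t r1 d \<open>exp (-s) < 1\<close> \<open>exp s > 1\<close> by (intro sm) (auto simp del: exp_less_one_iff one_less_exp_iff)
    then have "(\<lambda>l. norm (a l * (of_real (exp t)) powi l)) summable_on UNIV"
      by (rule summable_on_iff_abs_summable_on_complex[THEN iffD1])
    then show ?thesis by (simp add: norm_mult norm_power_int)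
  qed
  have "(\<lambda>l. norm (a l) * (exp s) powi l + norm (a l) * (exp (-s)) powi l) summable_on UNIV"
    using ab by (intro summable_on_add) auto
  then have "(\<lambda>l. norm (a l) * exp (s * \<bar>real_of_int l\<bar>)) summable_on UNIV"
  proof (rule summable_on_comparison_test)
    fix l :: int
    have p: "exp u powi l = exp (u * real_of_int l)" for u :: real
      by (simp add: exp_power_int mult.commute)
    have "exp (s * \<bar>real_of_int l\<bar>) \<le> exp s powi l + exp (-s) powi l"
      unfolding p by (cases "l \<ge> 0") (auto simp: add_increasing add_increasing2)
    then show "norm (a l) * exp (s * \<bar>real_of_int l\<bar>)
       \<le> norm (a l) * (exp s) powi l + norm (a l) * (exp (-s)) powi l"
      unfolding distrib_left[symmetric] by (intro mult_left_mono) auto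
  qed auto
  then show ?thesis using that s0 by blast
qed

text \<open>The rate \<open>s\<close> is halved. One half is the claimed decay in \<bar>l\<bar>; the
  other is worth at least c0 L n and has to pay for the growth A ^ n and for the claimed factor exp
  (- c0 n). This fixes \<open>L\<close>.\<close>

lemma conv_power_far_bound:
  assumes "assumption_A1 a"
  shows "\<exists>(L::nat) (c0::real). L \<ge> 1 \<and> c0 > 0 \<and>
    (\<forall>(n::nat) (l::int). n \<ge> 1 \<and> \<bar>l\<bar> > int L * int n \<longrightarrow>
       norm (conv_power a n l) \<le> exp (- c0 * real n - c0 * real_of_int \<bar>l\<bar>))"
proof -
  obtain s where s: "s > 0" and summ: "(\<lambda>l. norm (a l) * exp (s * \<bar>real_of_int l\<bar>)) summable_on UNIV"
    using A1_weighted_summable[OF assms] .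
  define A where "A = max 1 (\<Sum>\<^sub>\<infinity>l. norm (a l) * exp (s * \<bar>real_of_int l\<bar>))"
  have A1: "A \<ge> 1" by (simp add: A_def)
  define c0 where "c0 = s / 2"
  define L where "L = Suc (nat \<lceil>(ln A + c0) / c0\<rceil>)"
  have c0: "c0 > 0" using s by (simp add: c0_def)
  have "real L \<ge> (ln A + c0) / c0" unfolding L_def by linarith
  then have Lb: "c0 * real L \<ge> ln A + c0" using c0 by (simp add: field_simps)
  have "norm (conv_power a n l) \<le> exp (- c0 * real n - c0 * real_of_int \<bar>l\<bar>)"
    if n: "n \<ge> 1" and l: "\<bar>l\<bar> > int L * int n" for n l
  proof -
    obtain m where m: "n = Suc m" using n by (cases n) auto
    have "norm (conv_power a n l) \<le> A ^ n * exp (- s * \<bar>real_of_int l\<bar>)"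
      unfolding m using summ s by (intro conv_power_weighted_bound) (auto simp: A_def)
    also have "A ^ n = exp (real n * ln A)" using A1 by (simp add: exp_of_nat_mult)
    also have "exp (real n * ln A) * exp (- s * \<bar>real_of_int l\<bar>) = exp (real n * ln A - s * \<bar>real_of_int l\<bar>)"
      by (simp add: exp_diff exp_minus field_simps)
    also have "\<dots> \<le> exp (- c0 * real n - c0 * real_of_int \<bar>l\<bar>)"
    proof -
      have "real L * real n \<le> \<bar>real_of_int l\<bar>" proof -
        have "real_of_int (int L * int n) \<le> real_of_int \<bar>l\<bar>" using l by (subst of_int_le_iff) simp
        then show ?thesis by simp
      qed
      then have "c0 * (real L * real n) \<le> c0 * \<bar>real_of_int l\<bar>" using c0 by (intro mult_left_mono) auto
      moreover have "(ln A + c0) * real n \<le> (c0 * real L) * real n" using Lb by (intro mult_right_mono) auto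
      moreover have "s = c0 + c0" by (simp add: c0_def)
      ultimately show ?thesis by (simp add: algebra_simps)
    qed
    finally show ?thesis .
  qed
  moreover have "L \<ge> 1" by (simp add: L_def)
  ultimately show ?thesis using c0 by blast
qed

section \<open>Fourier representation of the convolution powers\<close>

lemma exp_i_int_integral:
  "integral {b..b + 2 * pi} (\<lambda>t. exp (- \<i> * of_int l * of_real t)) = (if l = 0 then 2 * of_real pi else (0::complex))"
proof (cases "l = 0")
  case False
  let ?G = "\<lambda>z. exp (- \<i> * of_int l * z) / (- \<i> * of_int l)"
  have "((\<lambda>t. exp (- \<i> * of_int l * of_real t)) has_integral ?G (of_real (b + 2 * pi)) - ?G (of_real b)) {b..b+2*pi}"
  proof (rule fundamental_theorem_of_calculus)
    fix t assume "t \<in> {b..b + 2 * pi}"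
    have "(?G has_field_derivative exp (- \<i> * of_int l * of_real t)) (at (of_real t))"
      by (rule derivative_eq_intros refl | use False in force)+
    then show "((\<lambda>t. ?G (of_real t)) has_vector_derivative exp (- \<i> * of_int l * of_real t)) (at t within {b..b + 2 * pi})"
      by (intro has_vector_derivative_real_field) (rule DERIV_subset, auto)
  qed auto
  moreover have "exp (- \<i> * of_int l * of_real (b + 2 * pi)) = exp (- \<i> * of_int l * of_real b)"
    unfolding exp_eq by (rule exI[of _ "-l"]) (simp add: algebra_simps)
  ultimately show ?thesis using False by (simp add: integral_unique)
qed (simp add: scaleR_conv_of_real)

text \<open>The M-test applies with majorant \<bar>a l\<bar>, as the powers have modulus 1 on the
  circle. The limit is along finite index sets, which matches \<open>infsum\<close>; it yields the
  continuity of the symbol and the exchange of sum and integral.\<close>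

lemma symbol_circle_uniform_limit:
  assumes "(\<lambda>l. norm (a l)) summable_on UNIV"
  shows "uniform_limit A (\<lambda>X t. \<Sum>l\<in>X. a l * exp (\<i> * of_real t) powi l)
           (\<lambda>t. symbol a (exp (\<i> * of_real t))) (finite_subsets_at_top UNIV)"
  unfolding symbol_def
  by (rule Weierstrass_m_test_general[where M = "\<lambda>l. norm (a l)"])
     (use assms in \<open>auto simp: norm_mult norm_power_int\<close>)

lemma continuous_on_symbol_circle:
  assumes "(\<lambda>l. norm (a l)) summable_on UNIV"
  shows "continuous_on A (\<lambda>t. symbol a (exp (\<i> * of_real t)))"
  by (rule uniform_limit_theorem[OF _ symbol_circle_uniform_limit[OF assms]])
     (auto intro!: always_eventually continuous_intros)

text \<open>Uniform convergence on a compact interval allows termwise integration. The factor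
  \<open>g\<close> is kept general so that it can hold the previous power of the symbol in an
  induction on the exponent.\<close>

lemma infsum_coeff_integral:
  assumes a: "(\<lambda>l. norm (a l)) summable_on UNIV" and g: "continuous_on {b..c} g"
  shows "(\<Sum>\<^sub>\<infinity>l. a l * integral {b..c} (\<lambda>t. g t * exp (\<i> * of_real t) powi l))
       = integral {b..c} (\<lambda>t. g t * symbol a (exp (\<i> * of_real t)))"
proof -
  let ?f = "\<lambda>X t. g t * (\<Sum>l\<in>X. a l * exp (\<i> * of_real t) powi l)"
  have bg: "bounded (g ` {b..c})"
    by (intro compact_imp_bounded compact_continuous_image g) auto
  have bs: "bounded ((\<lambda>t. symbol a (exp (\<i> * of_real t))) ` {b..c})"
    by (intro compact_imp_bounded compact_continuous_image continuous_on_symbol_circle a) auto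
  have "uniform_limit {b..c} ?f (\<lambda>t. g t * symbol a (exp (\<i> * of_real t))) (finite_subsets_at_top UNIV)"
    by (rule uniform_lim_mult[OF uniform_limit_const symbol_circle_uniform_limit[OF a] bg bs])
  moreover have "continuous_on {b..c} (?f X)" for X
    by (intro continuous_intros g) auto
  ultimately obtain I J where I: "\<And>X. (?f X has_integral I X) {b..c}"
    and J: "((\<lambda>t. g t * symbol a (exp (\<i> * of_real t))) has_integral J) {b..c}"
    and IJ: "(I \<longlongrightarrow> J) (finite_subsets_at_top UNIV)"
    by (rule uniform_limit_integral) auto
  have "I X = (\<Sum>l\<in>X. a l * integral {b..c} (\<lambda>t. g t * exp (\<i> * of_real t) powi l))" if "finite X" for X
  proof -
    have "I X = integral {b..c} (?f X)" by (rule integral_unique[OF I, symmetric])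
    also have "\<dots> = integral {b..c} (\<lambda>t. \<Sum>l\<in>X. a l * (g t * exp (\<i> * of_real t) powi l))"
      by (simp add: sum_distrib_left mult_ac)
    also have "\<dots> = (\<Sum>l\<in>X. integral {b..c} (\<lambda>t. a l * (g t * exp (\<i> * of_real t) powi l)))"
      by (intro integral_sum that integrable_continuous_interval continuous_intros g) auto
    finally show ?thesis by simp
  qed
  then have "((\<lambda>l. a l * integral {b..c} (\<lambda>t. g t * exp (\<i> * of_real t) powi l)) has_sum J) UNIV"
    unfolding has_sum_def
    by (intro Lim_transform_eventually[OF IJ] eventually_finite_subsets_at_top_weakI) auto
  then show ?thesis using J by (simp add: infsumI integral_unique)
qed

text \<open>The recursive equation of \<open>conv_power\<close> starts at exponent 1; here it is
  extended down to the neutral element, so that inductions can start at 0.\<close>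

lemma conv_power_Suc: "conv_power a (Suc n) = conv (conv_power a n) a"
proof (cases n)
  case 0
  have "conv (\<lambda>l. if l = 0 then 1 else 0) a l = a l" for l
  proof -
    have "conv (\<lambda>l. if l = 0 then 1 else 0) a l = (\<Sum>\<^sub>\<infinity>l'\<in>{l}. a l')"
      unfolding conv_def by (rule infsum_cong_neutral) auto
    then show ?thesis by simp
  qed
  then show ?thesis using 0 by auto
qed simp

text \<open>Convolving with \<open>a\<close> multiplies the integrand by the symbol. The left end
  \<open>b\<close> is arbitrary because orthogonality holds on every interval of length 2 pi; later
  this freedom moves the cut of the circle away from the points \<open>\<kappa> k\<close>.\<close>

lemma conv_power_Fourier:
  assumes a: "(\<lambda>l. norm (a l)) summable_on UNIV"
  shows "conv_power a n l = 1 / (2 * of_real pi) *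
     integral {b..b + 2 * pi} (\<lambda>t. symbol a (exp (\<i> * of_real t)) ^ n * exp (- \<i> * of_int l * of_real t))"
proof (induction n arbitrary: l)
  case 0
  show ?case by (simp only: exp_i_int_integral power_0 mult_1) auto
next
  case (Suc n)
  let ?F = "\<lambda>t. symbol a (exp (\<i> * of_real t))"
  let ?g = "\<lambda>t::real. ?F t ^ n * exp (- \<i> * of_int l * of_real t)"
  have p: "exp (- \<i> * of_int (l - l') * of_real t) = exp (- \<i> * of_int l * of_real t) * exp (\<i> * of_real t) powi l'" for l' and t :: real
    by (simp add: exp_power_int exp_add[symmetric] algebra_simps)
  have "conv_power a (Suc n) l = (\<Sum>\<^sub>\<infinity>l'. 1 / (2 * of_real pi) * (a l' * integral {b..b + 2 * pi} (\<lambda>t. ?g t * exp (\<i> * of_real t) powi l')))"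
    unfolding conv_power_Suc conv_def Suc p by (simp add: mult_ac)
  also have "\<dots> = 1 / (2 * of_real pi) * (\<Sum>\<^sub>\<infinity>l'. a l' * integral {b..b + 2 * pi} (\<lambda>t. ?g t * exp (\<i> * of_real t) powi l'))"
    by (rule infsum_cmult_right')
  also have "(\<Sum>\<^sub>\<infinity>l'. a l' * integral {b..b + 2 * pi} (\<lambda>t. ?g t * exp (\<i> * of_real t) powi l'))
     = integral {b..b + 2 * pi} (\<lambda>t. ?g t * ?F t)"
    by (rule infsum_coeff_integral[OF a]) (intro continuous_intros continuous_on_symbol_circle a)
  finally show ?case by (simp add: mult_ac)
qed

section \<open>Cumulants\<close>

text \<open>Equal exponentials determine their exponents only up to multiples of 2 pi \<i>. For
  exponents tending to 0 the principal branch removes this ambiguity.\<close>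

lemma Ln_exp_eventually:
  assumes "(f \<longlongrightarrow> 0) F"
  shows "\<forall>\<^sub>F x in F. Ln (exp (f x)) = f x"
proof -
  have "\<forall>\<^sub>F x in F. norm (f x) < pi"
    using tendstoD[OF assms, of pi] by simp
  then show ?thesis
  proof eventually_elim
    case (elim x)
    have "\<bar>Im (f x)\<bar> < pi" using elim abs_Im_le_cmod[of "f x"] by linarith
    then show ?case by (intro Ln_exp) auto
  qed
qed

text \<open>If the order d of the series were below m, then f z / z ^ d would tend to its nonzero
  leading coefficient, while the hypothesis bounds it by C \<bar>z\<bar> ^ (m - d), which tends to
  0.\<close>

lemma fps_nth_eq_0_if_bigo:
  fixes f :: "complex \<Rightarrow> complex"
  assumes f: "f has_fps_expansion F" and O: "\<forall>\<^sub>F z in at 0. norm (f z) \<le> C * norm z ^ m" and n: "n < m"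
  shows "fps_nth F n = 0"
proof (rule ccontr)
  assume nz: "fps_nth F n \<noteq> 0"
  define d where "d = subdegree F"
  have F0: "F \<noteq> 0" using nz by auto
  have d: "d < m" using subdegree_leI[OF nz] n by (simp add: d_def)
  have G: "fps_nth (fps_shift d F) 0 = fps_nth F d" by simp
  have c: "fps_nth F d \<noteq> 0" using F0 by (simp add: d_def)
  have R: "fps_conv_radius F > 0" using f by (simp add: has_fps_expansion_def)
  have "\<forall>\<^sub>F z in at 0. norm (eval_fps (fps_shift d F) z) \<le> C * norm z ^ (m - d)"
  proof -
    have "\<forall>\<^sub>F z in at 0. eval_fps F z = f z"
      using f unfolding has_fps_expansion_def by (auto intro: eventually_nhds_conv_at[THEN iffD1, THEN conjunct1])
    moreover have "\<forall>\<^sub>F z in nhds 0. z \<in> eball 0 (fps_conv_radius F)"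
      by (rule eventually_nhds_in_open) (use R in \<open>auto simp: zero_ereal_def\<close>)
    then have "\<forall>\<^sub>F z in at 0. z \<in> eball 0 (fps_conv_radius F)"
      unfolding eventually_nhds_conv_at by blast
    moreover have "\<forall>\<^sub>F z::complex in at 0. z \<noteq> 0" by (simp add: eventually_at_filter)
    ultimately show ?thesis using O
    proof eventually_elim
      case (elim z)
      have "eval_fps (fps_shift d F) z = f z / z ^ d"
        using elim by (subst eval_fps_shift) (auto simp: d_def)
      then have "norm (eval_fps (fps_shift d F) z) = norm (f z) / norm z ^ d"
        by (simp add: norm_divide norm_power)
      also have "\<dots> \<le> C * norm z ^ m / norm z ^ d"
        using elim by (intro divide_right_mono) auto
      also have "\<dots> = C * norm z ^ (m - d)" using elim d by (simp add: power_diff)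
      finally show ?case .
    qed
  qed
  moreover have "((\<lambda>z. norm (eval_fps (fps_shift d F) z)) \<longlongrightarrow> norm (fps_nth F d)) (at 0)"
  proof -
    have "isCont (eval_fps (fps_shift d F)) 0"
      by (rule continuous_eval_fps) (use R in \<open>auto simp: zero_ereal_def\<close>)
    from tendsto_norm[OF this[unfolded isCont_def eval_fps_at_0 G]] show ?thesis .
  qed
  moreover have "((\<lambda>z::complex. C * norm z ^ (m - d)) \<longlongrightarrow> C * norm (0::complex) ^ (m - d)) (at 0)"
    by (intro tendsto_mult tendsto_const tendsto_power tendsto_norm tendsto_ident_at)
  ultimately have "norm (fps_nth F d) \<le> C * norm (0::complex) ^ (m - d)"
    by (intro tendsto_le[of "at 0"]) auto
  then show False using c d by (simp add: power_0_left)
qed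

text \<open>\<open>cumulant\<close> is a definite description and carries no information until this
  is known. Existence takes the Taylor coefficients of the logarithm of the normalised symbol after
  its two explicit terms are removed; the order of \<open>r\<close> makes those below 2\<mu> + 1
  vanish. For uniqueness, any admissible series completes these terms to a logarithm that tends to
  0, so it coincides with \<open>Q\<close> near 0.\<close>

lemma cumulant_unique_exists:
  fixes a \<kappa> \<alpha> \<beta> \<mu>
  defines "\<Psi> \<equiv> \<lambda>\<gamma>. (\<forall>\<nu> < 2 * \<mu> + 1. \<gamma> \<nu> = 0) \<and>
     (\<forall>\<^sub>F \<xi> in nhds 0.
        summable (\<lambda>\<nu>. \<gamma> \<nu> / fact \<nu> * (\<i> * \<xi>) ^ \<nu>) \<and>
        symbol a (\<kappa> * exp (\<i> * \<xi>)) =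
        symbol a \<kappa> *
          exp (\<i> * of_real \<alpha> * \<xi> - \<beta> * \<xi> ^ (2 * \<mu>)
               + (\<Sum>\<nu>. \<gamma> \<nu> / fact \<nu> * (\<i> * \<xi>) ^ \<nu>)))"
  assumes A1: "assumption_A1 a" and \<kappa>: "norm \<kappa> = 1" and Fk: "symbol a \<kappa> \<noteq> 0" and \<mu>: "\<mu> \<ge> 1"
    and r: "r \<in> O[at 0](\<lambda>\<xi>. \<xi> ^ (2 * \<mu> + 1))"
    and sym: "\<forall>\<^sub>F \<xi> in at 0. symbol a (\<kappa> * exp (\<i> * \<xi>)) =
              symbol a \<kappa> * exp (\<i> * of_real \<alpha> * \<xi> - \<beta> * \<xi> ^ (2 * \<mu>) + r \<xi>)"
  shows "\<exists>!\<gamma>. \<Psi> \<gamma>"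
proof -
  \<comment> \<open>everything is expressed in the variable \<open>w = \<i> * \<xi>\<close>; the cumulants are Taylor coefficients of \<open>Q\<close>\<close>
  define G where "G = (\<lambda>w. symbol a (\<kappa> * exp w) / symbol a \<kappa>)"
  define Q where "Q = (\<lambda>w. Ln (G w) - of_real \<alpha> * w + \<beta> * (- \<i> * w) ^ (2 * \<mu>))"
  obtain \<epsilon> where e: "\<epsilon> > 0" and hol: "symbol a holomorphic_on {z. 1 - \<epsilon> < norm z \<and> norm z < 1 + \<epsilon>}"
    using A1 unfolding assumption_A1_def by blast
  have op: "open {z::complex. 1 - \<epsilon> < norm z \<and> norm z < 1 + \<epsilon>}"
    by (intro open_Collect_conj open_Collect_less continuous_intros)
  have an: "symbol a analytic_on {\<kappa>}"
    using hol op \<kappa> e by (subst analytic_at) (auto intro!: exI[of _ "{z. 1 - \<epsilon> < norm z \<and> norm z < 1 + \<epsilon>}"])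
  have "(symbol a \<circ> (\<lambda>w. \<kappa> * exp w)) analytic_on {0}"
    by (rule analytic_on_compose) (use an in \<open>auto intro!: analytic_intros\<close>)
  then have Gan: "G analytic_on {0}"
    unfolding G_def o_def by (rule analytic_on_divide) (use Fk in \<open>auto intro!: analytic_intros\<close>)
  have G0: "G 0 = 1" using Fk by (simp add: G_def)
  have "(Ln \<circ> G) analytic_on {0}"
    by (rule analytic_on_compose[OF Gan]) (auto simp: G0 intro!: analytic_intros)
  then have Qan: "Q analytic_on {0}"
    unfolding Q_def o_def by (auto intro!: analytic_intros)
  have i0: "filterlim (\<lambda>w. c * w) (at 0) (at 0)" if "c \<noteq> 0" for c :: complex
    unfolding filterlim_at using that by (auto intro!: tendsto_eq_intros simp: eventually_at_filter)
  have i0': "filterlim (\<lambda>w. c * w) (nhds 0) (nhds 0)" for c :: complex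
    using tendsto_mult[OF tendsto_const[of c] filterlim_ident[of "nhds 0"]] by simp
  have Geq: "G (\<i> * \<xi>) = E" if "symbol a (\<kappa> * exp (\<i> * \<xi>)) = symbol a \<kappa> * E" for \<xi> E
    using that Fk by (simp add: G_def)
  have ii: "- \<i> * (\<i> * \<xi>) = \<xi>" for \<xi> by (simp add: mult.assoc[symmetric])
  have Gnz: "\<forall>\<^sub>F w in nhds 0. G w \<noteq> 0"
  proof -
    have "isCont G 0" using Gan by (simp add: analytic_at_imp_isCont)
    then have "(G \<longlongrightarrow> 1) (nhds 0)" using G0 by (simp add: isCont_def tendsto_nhds_iff)
    then show ?thesis by (rule tendsto_imp_eventually_ne) auto
  qed
  obtain C where C: "\<forall>\<^sub>F \<xi> in at 0. norm (r \<xi>) \<le> C * norm (\<xi> ^ (2 * \<mu> + 1))"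
    using r by (elim landau_o.bigE)
  \<comment> \<open>The exponent in \<open>sym\<close> tends to 0, so \<open>Ln\<close> recovers it
    and \<open>Q (\<i> * \<xi>)\<close> equals \<open>r \<xi>\<close> near 0; thus \<open>Q\<close>
    inherits the order of \<open>r\<close>.\<close>
  have QO: "\<forall>\<^sub>F w in at 0. norm (Q w) \<le> C * norm w ^ (2 * \<mu> + 1)"
  proof -
    have "((\<lambda>\<xi>::complex. C * norm (\<xi> ^ (2 * \<mu> + 1))) \<longlongrightarrow> C * norm ((0::complex) ^ (2 * \<mu> + 1))) (at 0)"
      by (intro tendsto_mult tendsto_const tendsto_power tendsto_norm tendsto_ident_at)
    then have r0: "(r \<longlongrightarrow> 0) (at 0)"
      by (intro Lim_null_comparison[OF C]) simp
    have "((\<lambda>\<xi>. \<i> * of_real \<alpha> * \<xi> - \<beta> * \<xi> ^ (2 * \<mu>) + r \<xi>) \<longlongrightarrow> \<i> * of_real \<alpha> * 0 - \<beta> * 0 ^ (2 * \<mu>) + 0) (at 0)"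
      by (intro tendsto_intros r0)
    then have "((\<lambda>\<xi>. \<i> * of_real \<alpha> * \<xi> - \<beta> * \<xi> ^ (2 * \<mu>) + r \<xi>) \<longlongrightarrow> 0) (at 0)"
      using \<mu> by (simp add: power_0_left)
    from Ln_exp_eventually[OF this] sym C
    have "\<forall>\<^sub>F \<xi> in at 0. norm (Q (\<i> * \<xi>)) \<le> C * norm \<xi> ^ (2 * \<mu> + 1)"
    proof eventually_elim
      case (elim \<xi>)
      have "Q (\<i> * \<xi>) = r \<xi>"
        unfolding Q_def ii Geq[OF elim(2)] elim(1) by (simp add: algebra_simps)
      then show ?case using elim(3) by (simp add: norm_power norm_mult)
    qed
    from eventually_compose_filterlim[OF this i0[of "-\<i>"]]
    show ?thesis by (simp add: norm_mult mult.assoc[symmetric])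
  qed
  define F where "F = fps_expansion Q 0"
  have QF: "Q has_fps_expansion F" unfolding F_def using Qan by (rule analytic_at_imp_has_fps_expansion_0)
  have F0: "fps_nth F \<nu> = 0" if "\<nu> < 2 * \<mu> + 1" for \<nu>
    by (rule fps_nth_eq_0_if_bigo[OF QF QO that])
  have "\<Psi> (\<lambda>\<nu>. fps_nth F \<nu> * fact \<nu>)"
    unfolding \<Psi>_def
  proof (intro conjI allI impI)
    have "\<forall>\<^sub>F w in nhds 0. eval_fps F w = Q w" using QF by (simp add: has_fps_expansion_def)
    moreover have "\<forall>\<^sub>F w in nhds 0. w \<in> eball 0 (fps_conv_radius F)"
      by (rule eventually_nhds_in_open) (use QF in \<open>auto simp: has_fps_expansion_def zero_ereal_def\<close>)
    ultimately have "\<forall>\<^sub>F w in nhds 0. eval_fps F w = Q w \<and> w \<in> eball 0 (fps_conv_radius F) \<and> G w \<noteq> 0"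
      using Gnz by eventually_elim auto
    from eventually_compose_filterlim[OF this i0'[of \<i>]]
    show "\<forall>\<^sub>F \<xi> in nhds 0.
        summable (\<lambda>\<nu>. fps_nth F \<nu> * fact \<nu> / fact \<nu> * (\<i> * \<xi>) ^ \<nu>) \<and>
        symbol a (\<kappa> * exp (\<i> * \<xi>)) =
        symbol a \<kappa> * exp (\<i> * of_real \<alpha> * \<xi> - \<beta> * \<xi> ^ (2 * \<mu>)
               + (\<Sum>\<nu>. fps_nth F \<nu> * fact \<nu> / fact \<nu> * (\<i> * \<xi>) ^ \<nu>))"
    proof eventually_elim
      case (elim \<xi>)
      have "symbol a (\<kappa> * exp (\<i> * \<xi>)) = symbol a \<kappa> * G (\<i> * \<xi>)" using Fk by (simp add: G_def)
      also have "G (\<i> * \<xi>) = exp (Ln (G (\<i> * \<xi>)))" using elim by (subst exp_Ln) auto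
      also have "Ln (G (\<i> * \<xi>)) = \<i> * of_real \<alpha> * \<xi> - \<beta> * \<xi> ^ (2 * \<mu>) + Q (\<i> * \<xi>)"
        unfolding Q_def ii by simp
      also have "Q (\<i> * \<xi>) = eval_fps F (\<i> * \<xi>)" using elim by simp
      finally show ?case using elim by (auto simp: eval_fps_def intro!: summable_fps)
    qed
  qed (simp add: F0)
  moreover have "\<gamma> = (\<lambda>\<nu>. fps_nth F \<nu> * fact \<nu>)" if "\<Psi> \<gamma>" for \<gamma>
  proof -
    let ?S = "Abs_fps (\<lambda>\<nu>. \<gamma> \<nu> / fact \<nu>)"
    \<comment> \<open>The vanishing of \<open>\<gamma> 0\<close> fixes the branch: a constant term 2
      pi \<i> would leave the exponential unchanged.\<close>
    have g0: "\<gamma> 0 = 0" and ev: "\<forall>\<^sub>F \<xi> in nhds 0.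
        summable (\<lambda>\<nu>. \<gamma> \<nu> / fact \<nu> * (\<i> * \<xi>) ^ \<nu>) \<and>
        symbol a (\<kappa> * exp (\<i> * \<xi>)) =
        symbol a \<kappa> * exp (\<i> * of_real \<alpha> * \<xi> - \<beta> * \<xi> ^ (2 * \<mu>) + (\<Sum>\<nu>. \<gamma> \<nu> / fact \<nu> * (\<i> * \<xi>) ^ \<nu>))"
      using that unfolding \<Psi>_def by auto
    have ev': "\<forall>\<^sub>F w in nhds 0. summable (\<lambda>\<nu>. \<gamma> \<nu> / fact \<nu> * w ^ \<nu>) \<and>
        G w = exp (of_real \<alpha> * w - \<beta> * (- \<i> * w) ^ (2 * \<mu>) + eval_fps ?S w)"
      using eventually_compose_filterlim[OF ev i0'[of "-\<i>"]]
    proof eventually_elim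
      case (elim w)
      have iw: "\<i> * (- \<i> * w) = w" by (simp add: mult.assoc[symmetric])
      have iw': "\<i> * of_real \<alpha> * (- \<i> * w) = of_real \<alpha> * w" by (simp add: algebra_simps)
      show ?case using elim Geq[of "- \<i> * w"] unfolding iw iw' by (simp add: eval_fps_def)
    qed
    have "\<forall>\<^sub>F w in nhds 0. (\<lambda>n. fps_nth ?S n * w ^ n) sums eval_fps ?S w"
      using ev' by eventually_elim (auto simp: eval_fps_def)
    then have Sx: "eval_fps ?S has_fps_expansion ?S" by (rule has_fps_expansionI)
    from has_fps_expansion_imp_tendsto_0[OF this] g0
    have S0: "(eval_fps ?S \<longlongrightarrow> 0) (nhds 0)" by simp
    have id: "((\<lambda>w. c * w) \<longlongrightarrow> 0) (nhds 0)" for c :: complex by (rule i0')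
    have "((\<lambda>w. of_real \<alpha> * w - \<beta> * (- \<i> * w) ^ (2 * \<mu>) + eval_fps ?S w) \<longlongrightarrow> 0 - \<beta> * 0 ^ (2 * \<mu>) + 0) (nhds 0)"
      by (intro tendsto_intros S0 id)
    then have "((\<lambda>w. of_real \<alpha> * w - \<beta> * (- \<i> * w) ^ (2 * \<mu>) + eval_fps ?S w) \<longlongrightarrow> 0) (nhds 0)"
      using \<mu> by (simp add: power_0_left)
    from Ln_exp_eventually[OF this] ev' have "\<forall>\<^sub>F w in nhds 0. Q w = eval_fps ?S w"
      by eventually_elim (simp add: Q_def)
    then have "Q has_fps_expansion ?S \<longleftrightarrow> eval_fps ?S has_fps_expansion ?S"
      by (intro has_fps_expansion_cong) auto
    then have "F = ?S" using fps_expansion_unique_complex[OF QF] Sx by auto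
    then show ?thesis by auto
  qed
  ultimately show ?thesis by (auto intro: ex1I)
qed

text \<open>The factor (\<i> \<xi>) ^ (2\<mu>) is split off because, multiplied by n and rescaled by
  N = n powr (1 / (2\<mu>)), it no longer depends on n. The remaining dependence on n then sits in
  the argument of \<open>g\<close>, and \<open>g\<close> vanishes at 0.\<close>

lemma symbol_cumulant_expansion:
  fixes a \<kappa> \<alpha> \<beta> \<mu>
  defines "\<gamma> \<equiv> cumulant a \<kappa> \<alpha> \<beta> \<mu>"
  assumes A1: "assumption_A1 a" and \<kappa>: "norm \<kappa> = 1" and Fk: "symbol a \<kappa> \<noteq> 0" and \<mu>: "\<mu> \<ge> 1"
    and r: "r \<in> O[at 0](\<lambda>\<xi>. \<xi> ^ (2 * \<mu> + 1))"
    and sym: "\<forall>\<^sub>F \<xi> in at 0. symbol a (\<kappa> * exp (\<i> * \<xi>)) =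
              symbol a \<kappa> * exp (\<i> * of_real \<alpha> * \<xi> - \<beta> * \<xi> ^ (2 * \<mu>) + r \<xi>)"
  obtains g \<rho> where "\<rho> > 0" "g holomorphic_on ball 0 \<rho>"
    "g has_fps_expansion Abs_fps (\<lambda>\<nu>. if \<nu> = 0 then 0 else \<gamma> (2 * \<mu> + \<nu>) / fact (2 * \<mu> + \<nu>))"
    "\<And>\<xi>. norm \<xi> < \<rho> \<Longrightarrow> symbol a (\<kappa> * exp (\<i> * \<xi>)) = symbol a \<kappa> *
       exp (\<i> * of_real \<alpha> * \<xi> - \<beta> * \<xi> ^ (2 * \<mu>) + (\<i> * \<xi>) ^ (2 * \<mu>) * g (\<i> * \<xi>))"
proof -
  have \<gamma>: "\<forall>\<nu> < 2 * \<mu> + 1. \<gamma> \<nu> = 0"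
    and ev: "\<forall>\<^sub>F \<xi> in nhds 0. summable (\<lambda>\<nu>. \<gamma> \<nu> / fact \<nu> * (\<i> * \<xi>) ^ \<nu>) \<and>
        symbol a (\<kappa> * exp (\<i> * \<xi>)) = symbol a \<kappa> *
          exp (\<i> * of_real \<alpha> * \<xi> - \<beta> * \<xi> ^ (2 * \<mu>) + (\<Sum>\<nu>. \<gamma> \<nu> / fact \<nu> * (\<i> * \<xi>) ^ \<nu>))"
    using theI'[OF cumulant_unique_exists[OF A1 \<kappa> Fk \<mu> r sym]]
    unfolding \<gamma>_def cumulant_def by blast+
  let ?S = "Abs_fps (\<lambda>\<nu>. \<gamma> \<nu> / fact \<nu>)"
  let ?G = "Abs_fps (\<lambda>\<nu>. if \<nu> = 0 then 0 else \<gamma> (2 * \<mu> + \<nu>) / fact (2 * \<mu> + \<nu>))"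
  have G: "?G = fps_shift (2 * \<mu>) ?S"
    using \<gamma> by (auto simp: fps_eq_iff add.commute)
  have S: "?S = fps_X ^ (2 * \<mu>) * ?G"
    using \<gamma> by (auto simp: fps_eq_iff fps_X_power_mult_nth)
  obtain e where e: "e > 0" and B: "\<And>\<xi>. norm \<xi> < e \<Longrightarrow> summable (\<lambda>\<nu>. \<gamma> \<nu> / fact \<nu> * (\<i> * \<xi>) ^ \<nu>) \<and>
        symbol a (\<kappa> * exp (\<i> * \<xi>)) = symbol a \<kappa> *
          exp (\<i> * of_real \<alpha> * \<xi> - \<beta> * \<xi> ^ (2 * \<mu>) + (\<Sum>\<nu>. \<gamma> \<nu> / fact \<nu> * (\<i> * \<xi>) ^ \<nu>))"
    using ev unfolding eventually_nhds_metric by (auto simp: dist_norm)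
  have R: "fps_conv_radius ?S \<ge> ereal e"
    unfolding fps_conv_radius_def
  proof (rule conv_radius_geI_ex)
    \<comment> \<open>With \<xi> = - \<i> t the series is evaluated at the real point t; convergence
      there for every t < e bounds the radius of convergence from below.\<close>
    fix t assume t: "0 < t" "ereal t < ereal e"
    have "summable (\<lambda>\<nu>. \<gamma> \<nu> / fact \<nu> * of_real t ^ \<nu>)"
      using B[of "-\<i> * of_real t"] t by (simp add: norm_mult mult.assoc[symmetric])
    then show "\<exists>z. cmod z = t \<and> summable (\<lambda>n. fps_nth ?S n * z ^ n)"
      using t by (intro exI[of _ "of_real t"]) auto
  qed
  then have RG: "fps_conv_radius ?G \<ge> ereal e" unfolding G by simp
  show ?thesis
  proof
    show "eval_fps ?G holomorphic_on ball 0 e"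
      by (rule holomorphic_on_eval_fps) (use RG ball_eball_mono in auto)
    show "eval_fps ?G has_fps_expansion ?G"
      by (rule eval_fps_has_fps_expansion, rule less_le_trans[OF _ RG]) (use e in auto)
    fix \<xi> :: complex assume \<xi>: "norm \<xi> < e"
    then have n: "ereal (norm (\<i> * \<xi>)) < ereal e" by (simp add: norm_mult)
    have "(\<Sum>\<nu>. \<gamma> \<nu> / fact \<nu> * (\<i> * \<xi>) ^ \<nu>) = eval_fps ?S (\<i> * \<xi>)" by (simp add: eval_fps_def)
    also have "\<dots> = (\<i> * \<xi>) ^ (2 * \<mu>) * eval_fps ?G (\<i> * \<xi>)"
      unfolding S by (subst eval_fps_mult) (use less_le_trans[OF n RG] in auto)
    finally show "symbol a (\<kappa> * exp (\<i> * \<xi>)) = symbol a \<kappa> *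
       exp (\<i> * of_real \<alpha> * \<xi> - \<beta> * \<xi> ^ (2 * \<mu>) + (\<i> * \<xi>) ^ (2 * \<mu>) * eval_fps ?G (\<i> * \<xi>))"
      using B[OF \<xi>] by simp
  qed fact
qed

section \<open>Expansion polynomials\<close>

text \<open>Evaluation at Y = y is a ring homomorphism on the coefficients, so it commutes with
  formal composition. This turns the formal definition into Taylor coefficients in Z of an analytic
  function, which Cauchy's estimates can handle.\<close>

lemma poly_expansion_poly:
  "poly (expansion_poly \<gamma> \<mu> m) y =
     fps_nth (fps_exp 1 oo Abs_fps (\<lambda>\<nu>. if \<nu> = 0 then 0
        else \<gamma> (2 * \<mu> + \<nu>) / fact (2 * \<mu> + \<nu>) * y ^ (2 * \<mu> + \<nu>))) m"
proof -
  define E where "E = (\<lambda>F :: complex poly fps. Abs_fps (\<lambda>n. poly (fps_nth F n) y))"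
  have mult: "E (F * F') = E F * E F'" for F F'
    by (simp add: E_def fps_eq_iff fps_mult_nth poly_sum)
  have one: "E 1 = 1" by (simp add: E_def fps_eq_iff)
  have pw: "E (F ^ i) = E F ^ i" for F i
    by (induction i) (simp_all add: mult one)
  have nth: "poly (fps_nth (F ^ i) m) y = fps_nth (E F ^ i) m" for F i
    unfolding pw[symmetric] by (simp add: E_def)
  have "E (Abs_fps (\<lambda>\<nu>. if \<nu> = 0 then 0 else monom (\<gamma> (2 * \<mu> + \<nu>) / fact (2 * \<mu> + \<nu>)) (2 * \<mu> + \<nu>)))
      = Abs_fps (\<lambda>\<nu>. if \<nu> = 0 then 0 else \<gamma> (2 * \<mu> + \<nu>) / fact (2 * \<mu> + \<nu>) * y ^ (2 * \<mu> + \<nu>))"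
    by (auto simp: E_def fps_eq_iff poly_monom)
  then show ?thesis
    unfolding expansion_poly_def fps_compose_nth by (simp add: poly_sum nth)
qed

text \<open>Cauchy's inequality bounds the m-th coefficient by B / r ^ m. The tail is then geometric
  with ratio at most 1/2, whence the factor 2.\<close>

lemma Taylor_remainder_bound:
  fixes f :: "complex \<Rightarrow> complex"
  assumes f: "f holomorphic_on ball 0 r" "continuous_on (cball 0 r) f" and r: "r > 0"
    and B: "\<And>z. norm z = r \<Longrightarrow> norm (f z) \<le> B" and z: "norm z \<le> r / 2"
  shows "norm (f z - (\<Sum>m\<le>M. (deriv ^^ m) f 0 / fact m * z ^ m)) \<le> 2 * B * (norm z / r) ^ Suc M"
proof -
  define c where "c = (\<lambda>m. (deriv ^^ m) f 0 / fact m)"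
  define q where "q = norm z / r"
  have q: "0 \<le> q" "q \<le> 1/2" using z r by (auto simp: q_def field_simps)
  have "norm (of_real r :: complex) = r" using r by simp
  then have B0: "B \<ge> 0" using B[of "of_real r"] norm_ge_zero[of "f (of_real r)"] by linarith
  have s: "(\<lambda>m. c m * z ^ m) sums f z"
    using holomorphic_power_series[OF f(1), of z] z r by (simp add: c_def)
  have c: "norm (c m) \<le> B / r ^ m" for m
  proof -
    have "norm ((deriv ^^ m) f 0) \<le> fact m * B / r ^ m"
      by (rule Cauchy_inequality[OF f r]) (use B in auto)
    then show ?thesis by (simp add: c_def norm_divide field_simps)
  qed
  have cz: "norm (c m * z ^ m) \<le> B * q ^ m" for m
    using mult_right_mono[OF c[of m], of "norm z ^ m"] by (simp add: norm_mult norm_power q_def power_divide)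
  have gs: "(\<lambda>m. B * q ^ (m + Suc M)) sums (B * (q ^ Suc M * (1 / (1 - q))))"
    using sums_mult[OF sums_mult[OF geometric_sums[of q]], of B "q ^ Suc M"] q
    by (simp add: power_add mult_ac)
  have "f z - (\<Sum>m\<le>M. c m * z ^ m) = (\<Sum>m. c (m + Suc M) * z ^ (m + Suc M))"
    using suminf_minus_initial_segment[OF sums_summable[OF s], of "Suc M"] sums_unique[OF s]
    by (simp add: lessThan_Suc_atMost)
  also have "norm \<dots> \<le> (\<Sum>m. B * q ^ (m + Suc M))"
    by (rule norm_suminf_le[OF _ sums_summable[OF gs]]) (rule cz)
  also have "\<dots> = B * (q ^ Suc M * (1 / (1 - q)))" using gs by (rule sums_unique[symmetric])
  also have "\<dots> \<le> B * (q ^ Suc M * 2)"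
    using q B0 by (intro mult_left_mono) (auto simp: field_simps)
  finally show ?thesis by (simp add: c_def q_def mult_ac)
qed

text \<open>In the application y is \<i> times the rescaled frequency and Z = 1 / N; the exponential
  is what remains of the n-th power of the symbol once the kernel is removed. While \<bar>y z\<bar>
  \<le> \<rho> it is at most exp (\<epsilon> \<bar>y\<bar> ^ (2\<mu>)), so the Taylor remainder can
  be taken with a radius of order \<rho> / (1 + \<bar>y\<bar>). The assumption \<open>yZ\<close>
  ensures that 2 \<bar>Z\<bar> is an admissible radius too.\<close>

lemma expansion_poly_remainder:
  fixes y Z :: complex
  assumes g: "g holomorphic_on ball 0 \<rho>0"
    and gF: "g has_fps_expansion Abs_fps (\<lambda>\<nu>. if \<nu> = 0 then 0 else \<gamma> (2 * \<mu> + \<nu>) / fact (2 * \<mu> + \<nu>))"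
    and \<rho>: "0 < \<rho>" "\<rho> < \<rho>0" and ge: "\<And>w. norm w \<le> \<rho> \<Longrightarrow> norm (g w) \<le> \<epsilon>"
    and yZ: "norm y * norm Z \<le> \<rho> / 2"
  shows "norm (exp (y ^ (2 * \<mu>) * g (y * Z)) - (\<Sum>m\<le>M. poly (expansion_poly \<gamma> \<mu> m) y * Z ^ m))
     \<le> 2 * exp (\<epsilon> * norm y ^ (2 * \<mu>)) * (norm Z * (1 + norm y) / \<rho>) ^ Suc M"
proof -
  define h where "h = (\<lambda>z. exp (y ^ (2 * \<mu>) * g (y * z)))"
  \<comment> \<open>the second entry replaces \<open>\<rho> / norm y\<close>, so that \<open>y = 0\<close> needs no separate treatment\<close>
  define r where "r = max (2 * norm Z) (\<rho> / (1 + norm y))"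
  have r: "r > 0" using \<rho> by (auto simp: r_def less_max_iff_disj add_pos_nonneg)
  have yr: "norm y * r \<le> \<rho>"
  proof -
    have "norm y * (\<rho> / (1 + norm y)) = \<rho> * (norm y / (1 + norm y))" by simp
    also have "\<dots> \<le> \<rho> * 1" using \<rho> by (intro mult_left_mono) (auto simp: divide_le_eq add_pos_nonneg)
    finally show ?thesis using yZ by (auto simp: r_def max_def)
  qed
  have yz: "norm (y * z) \<le> \<rho>" if "norm z \<le> r" for z
    using mult_left_mono[OF that, of "norm y"] yr by (simp add: norm_mult)
  have "(g \<circ> (\<lambda>z. y * z)) holomorphic_on cball 0 r"
    by (rule holomorphic_on_compose_gen[OF _ g]) (use yz \<rho> in \<open>fastforce intro!: holomorphic_intros\<close>)+
  then have hol: "h holomorphic_on cball 0 r"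
    unfolding h_def o_def by (intro holomorphic_intros)
  have hB: "norm (h z) \<le> exp (\<epsilon> * norm y ^ (2 * \<mu>))" if "norm z = r" for z
  proof -
    have "norm (h z) \<le> exp (norm (y ^ (2 * \<mu>) * g (y * z)))" unfolding h_def by (rule norm_exp)
    also have "norm (y ^ (2 * \<mu>) * g (y * z)) \<le> norm y ^ (2 * \<mu>) * \<epsilon>"
      unfolding norm_mult norm_power using that yz by (intro mult_left_mono ge) auto
    finally show ?thesis by (simp add: mult.commute)
  qed
  have "(\<lambda>z. y * z) has_fps_expansion fps_const y * fps_X" by (intro fps_expansion_intros)
  from has_fps_expansion_compose[OF gF this]
  have "(\<lambda>z. g (y * z)) has_fps_expansion
      (Abs_fps (\<lambda>\<nu>. if \<nu> = 0 then 0 else \<gamma> (2 * \<mu> + \<nu>) / fact (2 * \<mu> + \<nu>)) oo (fps_const y * fps_X))"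
    by (simp add: o_def)
  from has_fps_expansion_cmult_left[OF this, of "y ^ (2 * \<mu>)"]
  have "(\<lambda>z. y ^ (2 * \<mu>) * g (y * z)) has_fps_expansion Abs_fps (\<lambda>\<nu>. if \<nu> = 0 then 0
        else \<gamma> (2 * \<mu> + \<nu>) / fact (2 * \<mu> + \<nu>) * y ^ (2 * \<mu> + \<nu>))"
    by (rule back_subst[of "\<lambda>F. _ has_fps_expansion F"])
       (auto simp: fps_compose_linear fps_eq_iff power_add)
  from has_fps_expansion_compose[OF has_fps_expansion_exp this, of 1]
  have "h has_fps_expansion (fps_exp 1 oo Abs_fps (\<lambda>\<nu>. if \<nu> = 0 then 0
        else \<gamma> (2 * \<mu> + \<nu>) / fact (2 * \<mu> + \<nu>) * y ^ (2 * \<mu> + \<nu>)))"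
    by (simp add: o_def h_def)
  then have p: "poly (expansion_poly \<gamma> \<mu> m) y = (deriv ^^ m) h 0 / fact m" for m
    unfolding poly_expansion_poly by (rule fps_nth_fps_expansion)
  have "norm (h Z - (\<Sum>m\<le>M. (deriv ^^ m) h 0 / fact m * Z ^ m))
      \<le> 2 * exp (\<epsilon> * norm y ^ (2 * \<mu>)) * (norm Z / r) ^ Suc M"
    by (rule Taylor_remainder_bound)
       (use hol r hB in \<open>auto intro: holomorphic_on_subset holomorphic_on_imp_continuous_on simp: r_def\<close>)
  also have "(norm Z / r) ^ Suc M \<le> (norm Z * (1 + norm y) / \<rho>) ^ Suc M"
  proof (rule power_mono)
    have "norm Z / r \<le> norm Z / (\<rho> / (1 + norm y))"
      using \<rho> r by (intro divide_left_mono mult_pos_pos divide_pos_pos) (auto simp: r_def add_pos_nonneg)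
    then show "norm Z / r \<le> norm Z * (1 + norm y) / \<rho>" by simp
  qed (use r in auto)
  finally show ?thesis by (simp add: h_def p mult_left_mono)
qed

lemma expansion_poly_0 [simp]: "expansion_poly \<gamma> \<mu> 0 = 1"
  by (simp add: expansion_poly_def one_pCons)

section \<open>Estimates for the kernel\<close>

text \<open>Controls the modulus of exp (- \<beta> z ^ (2\<mu>)) off the real axis. The margin
  2\<epsilon> leaves room for two factors exp (\<epsilon> \<bar>z\<bar> ^ (2\<mu>)): one from the
  Taylor remainder, one absorbing the power of 1 + \<bar>z\<bar> that comes with it.\<close>

lemma elliptic_bound:
  fixes \<beta> :: complex
  assumes b: "Re \<beta> > 0"
  obtains \<epsilon> c C :: real where "\<epsilon> > 0" "c > 0" "C > 0"
    "\<And>s v :: real. - Re (\<beta> * Complex s v ^ (2 * \<mu>)) + 2 * \<epsilon> * norm (Complex s v) ^ (2 * \<mu>)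
       \<le> - c * s ^ (2 * \<mu>) + C * v ^ (2 * \<mu>)"
proof -
  define b where "b = Re \<beta>"
  have b0: "b > 0" using b by (simp add: b_def)
  \<comment> \<open>By homogeneity the bound for \<open>\<bar>v\<bar> < \<tau> * \<bar>s\<bar>\<close> reduces to \<open>s = 1\<close>; for the other \<open>v\<close> everything is
    of size \<open>v ^ (2 * \<mu>)\<close>.\<close>
  define f where "f = (\<lambda>t. Re (\<beta> * Complex 1 t ^ (2 * \<mu>)) - 2 * (b / 4) * norm (Complex 1 t) ^ (2 * \<mu>))"
  have one: "Complex 1 0 = 1" by (simp add: complex_eq_iff)
  \<comment> \<open>The choice \<epsilon> = b / 4 leaves b - b / 2 at t = 0; half of this survives
    in a neighbourhood by continuity.\<close>
  have f0: "f 0 = b / 2" unfolding f_def one by (simp add: b_def)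
  have "continuous_on UNIV f" unfolding f_def Complex_eq by (intro continuous_intros)
  then have "isCont f 0" by (simp add: continuous_on_eq_continuous_at)
  then have "(f \<longlongrightarrow> b / 2) (nhds 0)" using f0 by (simp add: isCont_def tendsto_nhds_iff)
  then have "\<forall>\<^sub>F t in nhds 0. f t > b / 4"
    using b0 by (intro order_tendstoD(1)) auto
  then obtain \<tau> where \<tau>: "\<tau> > 0" and ft: "\<And>t. \<bar>t\<bar> < \<tau> \<Longrightarrow> f t > b / 4"
    unfolding eventually_nhds_metric by (auto simp: dist_real_def)
  \<comment> \<open>For \<bar>v\<bar> \<ge> \<tau> \<bar>s\<bar>, both \<bar>s\<bar> and the modulus
    of \<open>Complex s v\<close> are at most D \<bar>v\<bar>.\<close>
  define D where "D = 1 + 1 / \<tau>"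
  define C where "C = (norm \<beta> + 2 * (b / 4) + b / 4) * D ^ (2 * \<mu>)"
  have D: "D > 0" using \<tau> by (simp add: D_def add_pos_pos)
  have "norm \<beta> + 2 * (b / 4) + b / 4 > 0" using b0 by (intro add_nonneg_pos) auto
  then have C: "C > 0" using D unfolding C_def by (intro mult_pos_pos) auto
  have ev: "x ^ (2 * \<mu>) \<ge> 0" for x :: real by simp
  have "- Re (\<beta> * Complex s v ^ (2 * \<mu>)) + 2 * (b / 4) * norm (Complex s v) ^ (2 * \<mu>)
       \<le> - (b / 4) * s ^ (2 * \<mu>) + C * v ^ (2 * \<mu>)" (is "?l \<le> ?r") for s v :: real
  proof (cases "\<bar>v\<bar> < \<tau> * \<bar>s\<bar>")
    case True
    then have s: "s \<noteq> 0" using \<tau> by auto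
    have t: "\<bar>v / s\<bar> < \<tau>" using True s by (simp add: divide_less_eq)
    have z: "Complex s v = of_real s * Complex 1 (v / s)" using s by (simp add: complex_eq_iff)
    have "Re (\<beta> * Complex s v ^ (2 * \<mu>)) = s ^ (2 * \<mu>) * Re (\<beta> * Complex 1 (v / s) ^ (2 * \<mu>))"
    proof -
      have "\<beta> * Complex s v ^ (2 * \<mu>) = of_real (s ^ (2 * \<mu>)) * (\<beta> * Complex 1 (v / s) ^ (2 * \<mu>))"
        unfolding z power_mult_distrib by simp
      moreover have "Re (of_real x * w) = x * Re w" for x w by simp
      ultimately show ?thesis by (simp only:)
    qed
    moreover have "norm (Complex s v) ^ (2 * \<mu>) = s ^ (2 * \<mu>) * norm (Complex 1 (v / s)) ^ (2 * \<mu>)"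
      unfolding z norm_mult power_mult_distrib by (simp add: power_mult)
    ultimately have "?l = - (s ^ (2 * \<mu>) * f (v / s))"
      by (simp add: f_def algebra_simps)
    also have "\<dots> \<le> - (s ^ (2 * \<mu>) * (b / 4))"
      using mult_left_mono[OF less_imp_le[OF ft[OF t]] ev[of s]] by simp
    also have "\<dots> \<le> ?r" using mult_nonneg_nonneg[OF less_imp_le[OF C] ev[of v]] by (simp add: algebra_simps)
    finally show ?thesis .
  next
    case False
    have sv: "\<bar>s\<bar> \<le> \<bar>v\<bar> / \<tau>" using False \<tau> by (simp add: field_simps)
    have D1: "\<bar>v\<bar> / \<tau> \<le> D * \<bar>v\<bar>" by (simp add: D_def algebra_simps)
    have "norm (Complex s v) \<le> D * \<bar>v\<bar>"
      using cmod_le[of "Complex s v"] sv by (simp add: D_def algebra_simps)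
    then have nz: "norm (Complex s v) ^ (2 * \<mu>) \<le> D ^ (2 * \<mu>) * v ^ (2 * \<mu>)"
      using power_mono[of "norm (Complex s v)" "D * \<bar>v\<bar>" "2 * \<mu>"] by (simp add: power_mult_distrib power_mult)
    have "\<bar>s\<bar> ^ (2 * \<mu>) \<le> (D * \<bar>v\<bar>) ^ (2 * \<mu>)" using sv D1 by (intro power_mono) auto
    then have ns: "s ^ (2 * \<mu>) \<le> D ^ (2 * \<mu>) * v ^ (2 * \<mu>)" by (simp add: power_mult_distrib power_mult)
    have "?l + (b / 4) * s ^ (2 * \<mu>) \<le> norm \<beta> * norm (Complex s v) ^ (2 * \<mu>) + 2 * (b / 4) * norm (Complex s v) ^ (2 * \<mu>) + (b / 4) * s ^ (2 * \<mu>)"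
      using complex_Re_le_cmod[of "- (\<beta> * Complex s v ^ (2 * \<mu>))"] by (simp add: norm_mult norm_power)
    also have "\<dots> \<le> norm \<beta> * (D ^ (2 * \<mu>) * v ^ (2 * \<mu>)) + 2 * (b / 4) * (D ^ (2 * \<mu>) * v ^ (2 * \<mu>)) + (b / 4) * (D ^ (2 * \<mu>) * v ^ (2 * \<mu>))"
      using nz ns b0 by (intro add_mono mult_left_mono) auto
    also have "\<dots> = C * v ^ (2 * \<mu>)" by (simp add: C_def algebra_simps)
    finally show ?thesis by simp
  qed
  then show ?thesis using that[of "b / 4" "b / 4" C] b0 C by simp
qed

text \<open>The j-th term of the series of exp (c x ^ m) already dominates the power. As
  \<open>c\<close> is at the user's disposal, polynomial factors cost an arbitrarily small part of
  the decay.\<close>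

lemma power_le_exp_power:
  fixes c :: real
  assumes c: "c > 0" and m: "m \<ge> 1"
  obtains C where "C > 0" "\<And>x. x \<ge> 0 \<Longrightarrow> (1 + x) ^ j \<le> C * exp (c * x ^ m)"
proof
  let ?C = "2 ^ j * (1 + fact j / c ^ j)"
  show "?C > 0" using c by (intro mult_pos_pos add_pos_pos) auto
  fix x :: real assume x: "x \<ge> 0"
  have "(1 + x) ^ j \<le> 2 ^ j * (1 + x ^ (m * j))"
  proof (cases "x \<le> 1")
    case True
    have "(1 + x) ^ j \<le> 2 ^ j * 1" using True x power_mono[of "1 + x" 2 j] by simp
    also have "\<dots> \<le> 2 ^ j * (1 + x ^ (m * j))" using x by (intro mult_left_mono) auto
    finally show ?thesis .
  next
    case False
    have "(1 + x) ^ j \<le> (2 * x) ^ j" using False by (intro power_mono) auto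
    also have "\<dots> = 2 ^ j * x ^ j" by (simp add: power_mult_distrib)
    also have "\<dots> \<le> 2 ^ j * x ^ (m * j)" using False m by (intro mult_left_mono power_increasing) auto
    also have "\<dots> \<le> 2 ^ j * (1 + x ^ (m * j))" by simp
    finally show ?thesis .
  qed
  also have "x ^ (m * j) = (c * x ^ m) ^ j / c ^ j" using c by (simp add: power_mult_distrib power_mult)
  also have "(c * x ^ m) ^ j \<le> fact j * exp (c * x ^ m)"
  proof -
    have "0 \<le> c * x ^ m" using c x by simp
    then have "(\<Sum>i\<in>{j}. (c * x ^ m) ^ i /\<^sub>R fact i) \<le> exp (c * x ^ m)"
      unfolding exp_def by (intro sum_le_suminf summable_exp_generic) auto
    then show ?thesis by (simp add: divide_simps mult.commute)
  qed
  also have "2 ^ j * (1 + fact j * exp (c * x ^ m) / c ^ j) \<le> 2 ^ j * (exp (c * x ^ m) + fact j * exp (c * x ^ m) / c ^ j)"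
    using c x by (intro mult_left_mono add_right_mono) auto
  finally show "(1 + x) ^ j \<le> ?C * exp (c * x ^ m)"
    using c by (simp add: divide_right_mono algebra_simps)
qed

lemma poly_le_exp_power:
  fixes p :: "complex poly" and c :: real
  assumes c: "c > 0" and m: "m \<ge> 1"
  obtains C where "C > 0" "\<And>y. norm (poly p y) \<le> C * exp (c * norm y ^ m)"
proof -
  obtain C where C: "C > 0" and b: "\<And>x. x \<ge> 0 \<Longrightarrow> (1 + x) ^ degree p \<le> C * exp (c * x ^ m)"
    using power_le_exp_power[OF c m] by blast
  define A where "A = (\<Sum>i\<le>degree p. norm (coeff p i))"
  have A: "A \<ge> 0" by (auto simp: A_def intro: sum_nonneg)
  \<comment> \<open>\<open>A\<close> is 0 for the zero polynomial; the summand 1 keeps the constant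
    positive.\<close>
  have "norm (poly p y) \<le> (A + 1) * C * exp (c * norm y ^ m)" for y
  proof -
    have "norm (poly p y) \<le> (\<Sum>i\<le>degree p. norm (coeff p i) * (1 + norm y) ^ degree p)"
      unfolding poly_altdef
    proof (rule order.trans[OF norm_sum sum_mono])
      fix i assume i: "i \<in> {..degree p}"
      have "norm y ^ i \<le> (1 + norm y) ^ i" by (intro power_mono) auto
      also have "\<dots> \<le> (1 + norm y) ^ degree p" using i by (intro power_increasing) auto
      finally show "norm (coeff p i * y ^ i) \<le> norm (coeff p i) * (1 + norm y) ^ degree p"
        by (simp add: norm_mult norm_power mult_left_mono)
    qed
    also have "\<dots> = A * (1 + norm y) ^ degree p" by (simp add: A_def sum_distrib_right)
    also have "\<dots> \<le> (A + 1) * (C * exp (c * norm y ^ m))" using A b[of "norm y"] by (intro mult_mono) auto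
    finally show ?thesis by (simp add: mult_ac)
  qed
  then show ?thesis using that[of "(A + 1) * C"] A C by auto
qed

text \<open>The inequality x ^ 2 \<le> 1 + x ^ (2\<mu>) reduces this to a Gaussian, whose
  integrability is taken from \<open>normal_density\<close>; \<open>\<sigma>\<close> is the
  deviation with 1 / (2 \<sigma> ^ 2) = c.\<close>

lemma integrable_exp_neg_even_power:
  fixes c :: real
  assumes c: "c > 0" and m: "\<mu> \<ge> 1"
  shows "integrable lborel (\<lambda>x. exp (- c * x ^ (2 * \<mu>)))"
proof -
  define \<sigma> where "\<sigma> = sqrt (1 / (2 * c))"
  have \<sigma>: "\<sigma> > 0" "2 * \<sigma>\<^sup>2 = 1 / c" using c by (auto simp: \<sigma>_def)
  have "integrable lborel (\<lambda>x. exp c * sqrt (2 * pi * \<sigma>\<^sup>2) * normal_density 0 \<sigma> x)"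
    using \<sigma> by (intro integrable_mult_right integrable_normal_density)
  also have "(\<lambda>x. exp c * sqrt (2 * pi * \<sigma>\<^sup>2) * normal_density 0 \<sigma> x) = (\<lambda>x. exp c * exp (- c * x\<^sup>2))"
  proof
    fix x
    have "- x\<^sup>2 / (2 * \<sigma>\<^sup>2) = - c * x\<^sup>2" unfolding \<sigma>(2) by simp
    then show "exp c * sqrt (2 * pi * \<sigma>\<^sup>2) * normal_density 0 \<sigma> x = exp c * exp (- c * x\<^sup>2)"
      using \<sigma>(1) by (simp add: normal_density_def)
  qed
  finally show ?thesis
  proof (rule Bochner_Integration.integrable_bound)
    show "AE x in lborel. norm (exp (- c * x ^ (2 * \<mu>))) \<le> norm (exp c * exp (- c * x\<^sup>2))"
    proof (rule AE_I2)
      fix x :: real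
      have "x\<^sup>2 \<le> 1 + (x\<^sup>2) ^ \<mu>"
      proof (cases "x\<^sup>2 \<le> 1")
        case False
        then show ?thesis using m power_increasing[of 1 \<mu> "x\<^sup>2"] by simp
      qed (simp add: add_increasing2)
      then have "c * x\<^sup>2 \<le> c * (1 + (x\<^sup>2) ^ \<mu>)" using c by (intro mult_left_mono) auto
      then show "norm (exp (- c * x ^ (2 * \<mu>))) \<le> norm (exp c * exp (- c * x\<^sup>2))"
        by (simp add: exp_add[symmetric] power_mult[of x 2 \<mu>] distrib_left)
    qed
  qed auto
qed

text \<open>Cauchy's theorem on a rectangle, obtained from a primitive on the convex set
  \<open>S\<close>: each vertical edge has length \<bar>h\<bar> and contributes at most V
  \<bar>h\<bar>. As \<open>h\<close> may be negative, intermediate heights are written u h with u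
  between 0 and 1.\<close>

lemma integral_shift_bound:
  fixes f :: "complex \<Rightarrow> complex" and A h V :: real
  assumes S: "convex S" "open S" "f holomorphic_on S" and A: "A \<ge> 0"
    and sub: "\<And>t u. \<bar>t\<bar> \<le> A \<Longrightarrow> 0 \<le> u \<Longrightarrow> u \<le> 1 \<Longrightarrow> Complex t (u * h) \<in> S"
    and V: "\<And>t u. \<bar>t\<bar> = A \<Longrightarrow> 0 \<le> u \<Longrightarrow> u \<le> 1 \<Longrightarrow> norm (f (Complex t (u * h))) \<le> V"
  shows "norm (integral {-A..A} (\<lambda>t. f (of_real t)))
      \<le> norm (integral {-A..A} (\<lambda>t. f (Complex t h))) + 2 * V * \<bar>h\<bar>"
proof -
  have "\<exists>G. \<forall>z\<in>S. (G has_field_derivative f z) (at z within S)"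
  proof (rule holomorphic_convex_primitive'[OF S])
    fix G assume "\<And>z. z \<in> S \<Longrightarrow> (G has_field_derivative f z) (at z within S)"
    then show ?thesis by blast
  qed
  then obtain G where G': "\<And>z. z \<in> S \<Longrightarrow> (G has_field_derivative f z) (at z within S)" by blast
  have G: "(G has_field_derivative f z) (at z)" if "z \<in> S" for z
    using G'[OF that] by (simp only: at_within_open[OF that S(2)])
  have hor: "integral {-A..A} (\<lambda>t. f (Complex t (u * h))) = G (Complex A (u * h)) - G (Complex (-A) (u * h))"
    if u: "0 \<le> u" "u \<le> 1" for u
  proof (rule integral_unique, rule fundamental_theorem_of_calculus)
    fix t assume t: "t \<in> {-A..A}"
    have "\<bar>t\<bar> \<le> A" using t by auto
    from G[OF sub[OF this u]]
    have "(G has_field_derivative f (Complex t (u * h))) (at (of_real t + \<i> * of_real (u * h)))"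
      by (simp only: Complex_eq)
    then have "((\<lambda>z. G (z + \<i> * of_real (u * h))) has_field_derivative f (Complex t (u * h))) (at (of_real t))"
      by (simp only: DERIV_shift)
    then have "((\<lambda>t. G (of_real t + \<i> * of_real (u * h))) has_vector_derivative f (Complex t (u * h))) (at t within {-A..A})"
      by (intro has_vector_derivative_real_field) (rule DERIV_subset, auto)
    then show "((\<lambda>t. G (Complex t (u * h))) has_vector_derivative f (Complex t (u * h))) (at t within {-A..A})"
      by (simp add: Complex_eq)
  qed (use A in auto)
  have vert: "norm (G (Complex t h) - G (Complex t 0)) \<le> V * \<bar>h\<bar>" if t: "\<bar>t\<bar> = A" for t
  proof -
    have seg: "\<exists>u. 0 \<le> u \<and> u \<le> 1 \<and> z = Complex t (u * h)" if "z \<in> closed_segment (Complex t 0) (Complex t h)" for z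
      using that by (auto simp: closed_segment_def complex_eq_iff algebra_simps)
    have "norm (G (Complex t h) - G (Complex t 0)) \<le> V * norm (Complex t h - Complex t 0)"
    proof (rule field_differentiable_bound[where S = "closed_segment (Complex t 0) (Complex t h)" and f' = f])
      fix z assume "z \<in> closed_segment (Complex t 0) (Complex t h)"
      then obtain u where u: "0 \<le> u" "u \<le> 1" "z = Complex t (u * h)" using seg by blast
      show "(G has_field_derivative f z) (at z within closed_segment (Complex t 0) (Complex t h))"
        unfolding u(3) by (rule DERIV_subset[OF G[OF sub]]) (use t u in auto)
      show "norm (f z) \<le> V" unfolding u(3) using t u by (intro V) auto
    qed auto
    also have "norm (Complex t h - Complex t 0) = \<bar>h\<bar>" by (simp add: cmod_def)
    finally show ?thesis .
  qed
  have "integral {-A..A} (\<lambda>t. f (of_real t)) = G (Complex A 0) - G (Complex (-A) 0)"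
    using hor[of 0] by (simp add: complex_of_real_def)
  also have "\<dots> = integral {-A..A} (\<lambda>t. f (Complex t h))
      - (G (Complex A h) - G (Complex A 0)) + (G (Complex (-A) h) - G (Complex (-A) 0))"
    using hor[of 1] by simp
  also have "norm \<dots> \<le> norm (integral {-A..A} (\<lambda>t. f (Complex t h))) + V * \<bar>h\<bar> + V * \<bar>h\<bar>"
    using A by (intro norm_triangle_le order.trans[OF norm_triangle_ineq4] add_mono vert order.refl) auto
  finally show ?thesis by simp
qed

section \<open>Moments of the kernel and derivatives of \<open>H_fun\<close>\<close>

definition osc_kernel :: "complex \<Rightarrow> nat \<Rightarrow> real \<Rightarrow> real \<Rightarrow> complex" where
  "osc_kernel \<beta> \<mu> x \<theta> = exp (- \<i> * of_real x * of_real \<theta>) * exp (- \<beta> * of_real \<theta> ^ (2 * \<mu>))"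

text \<open>The argument is \<i> \<theta> because - d/dx multiplies exp (- \<i> x \<theta>) by \<i>
  \<theta>. Up to the factor 1 / (2 pi) the moment is therefore the operator p(- d/dx) applied to
  \<open>H_fun \<beta> \<mu>\<close>.\<close>

definition kernel_moment :: "complex \<Rightarrow> nat \<Rightarrow> complex poly \<Rightarrow> real \<Rightarrow> complex" where
  "kernel_moment \<beta> \<mu> p x = (LINT \<theta>|lborel. poly p (\<i> * of_real \<theta>) * osc_kernel \<beta> \<mu> x \<theta>)"

lemma norm_osc_kernel: "norm (osc_kernel \<beta> \<mu> x \<theta>) = exp (- Re \<beta> * \<theta> ^ (2 * \<mu>))"
proof -
  have "Re (- \<beta> * of_real \<theta> ^ (2 * \<mu>)) = - Re \<beta> * \<theta> ^ (2 * \<mu>)"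
    by (simp flip: of_real_power)
  then show ?thesis by (simp add: osc_kernel_def norm_mult)
qed

lemma continuous_on_osc_kernel [continuous_intros]: "continuous_on A (osc_kernel \<beta> \<mu> x)"
  unfolding osc_kernel_def by (intro continuous_intros)

lemma osc_kernel_measurable [measurable]: "osc_kernel \<beta> \<mu> x \<in> borel_measurable borel"
  by (intro borel_measurable_continuous_onI continuous_intros)

lemma poly_i_measurable [measurable]:
  "(\<lambda>\<theta>::real. poly p (\<i> * of_real \<theta>)) \<in> borel_measurable borel"
  by (intro borel_measurable_continuous_onI continuous_intros)

text \<open>Half of the rate Re \<beta> absorbs the polynomial. The modulus of the kernel does not
  depend on x, which makes the constant uniform in x.\<close>

lemma poly_kernel_bound:
  assumes b: "Re \<beta> > 0" and m: "\<mu> \<ge> 1"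
  obtains C where "C > 0" "\<And>x \<theta>. norm (poly p (\<i> * of_real \<theta>) * osc_kernel \<beta> \<mu> x \<theta>)
    \<le> C * exp (- (Re \<beta> / 2) * \<theta> ^ (2 * \<mu>))"
proof -
  have "Re \<beta> / 2 > 0" "2 * \<mu> \<ge> 1" using b m by auto
  then obtain C where C: "C > 0" and p: "\<And>y. norm (poly p y) \<le> C * exp (Re \<beta> / 2 * norm y ^ (2 * \<mu>))"
    using poly_le_exp_power by blast
  have "norm (poly p (\<i> * of_real \<theta>) * osc_kernel \<beta> \<mu> x \<theta>) \<le> C * exp (- (Re \<beta> / 2) * \<theta> ^ (2 * \<mu>))" for x \<theta>
  proof -
    have "norm (poly p (\<i> * of_real \<theta>) * osc_kernel \<beta> \<mu> x \<theta>)
        \<le> C * exp (Re \<beta> / 2 * norm (\<i> * complex_of_real \<theta>) ^ (2 * \<mu>)) * exp (- Re \<beta> * \<theta> ^ (2 * \<mu>))"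
      unfolding norm_mult[of "poly _ _"] norm_osc_kernel by (intro mult_right_mono p) auto
    also have "norm (\<i> * complex_of_real \<theta>) ^ (2 * \<mu>) = \<theta> ^ (2 * \<mu>)" by (simp add: norm_mult power_mult)
    finally show ?thesis by (simp add: mult.assoc exp_add[symmetric])
  qed
  then show ?thesis using C that by blast
qed

lemma integrable_poly_kernel:
  assumes b: "Re \<beta> > 0" and m: "\<mu> \<ge> 1"
  shows "integrable lborel (\<lambda>\<theta>. poly p (\<i> * of_real \<theta>) * osc_kernel \<beta> \<mu> x \<theta>)"
proof -
  obtain C where "C > 0" and C: "\<And>x \<theta>. norm (poly p (\<i> * of_real \<theta>) * osc_kernel \<beta> \<mu> x \<theta>)
    \<le> C * exp (- (Re \<beta> / 2) * \<theta> ^ (2 * \<mu>))"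
    using poly_kernel_bound[OF b m] by blast
  have "integrable lborel (\<lambda>\<theta>. C * exp (- (Re \<beta> / 2) * \<theta> ^ (2 * \<mu>)))"
    using b m by (intro integrable_mult_right integrable_exp_neg_even_power) auto
  then show ?thesis
    by (rule Bochner_Integration.integrable_bound) (use C \<open>C > 0\<close> in auto)
qed

text \<open>Differentiation under the integral by a quantitative second-order estimate: \<bar>exp
  (\<i> u) - 1 - \<i> u\<bar> \<le> u ^ 2 with u = - (y - x) \<theta> bounds the remainder by (y -
  x) ^ 2 times an absolute second moment \<open>B\<close>. Here \<open>pCons 0 p\<close> is Y times
  p.\<close>

lemma kernel_moment_has_vector_derivative:
  assumes b: "Re \<beta> > 0" and m: "\<mu> \<ge> 1"
  shows "(kernel_moment \<beta> \<mu> p has_vector_derivative - kernel_moment \<beta> \<mu> (pCons 0 p) x) (at x)"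
proof -
  let ?f = "\<lambda>p x \<theta>. poly p (\<i> * of_real \<theta>) * osc_kernel \<beta> \<mu> x \<theta>"
  define B where "B = (LINT \<theta>|lborel. norm (?f (pCons 0 (pCons 0 p)) x \<theta>))"
  have int: "integrable lborel (?f p y)" for p y by (rule integrable_poly_kernel[OF b m])
  have bound: "norm (kernel_moment \<beta> \<mu> p y - kernel_moment \<beta> \<mu> p x
      - (y - x) *\<^sub>R (- kernel_moment \<beta> \<mu> (pCons 0 p) x)) \<le> B * (y - x)\<^sup>2" for y
  proof -
    have "kernel_moment \<beta> \<mu> p y - kernel_moment \<beta> \<mu> p x - (y - x) *\<^sub>R (- kernel_moment \<beta> \<mu> (pCons 0 p) x)
       = (LINT \<theta>|lborel. ?f p y \<theta> - ?f p x \<theta> + (y - x) *\<^sub>R ?f (pCons 0 p) x \<theta>)"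
      by (simp only: kernel_moment_def integral_scaleR_right scaleR_minus_right diff_minus_eq_add
          Bochner_Integration.integral_diff[OF int int] Bochner_Integration.integral_add[OF
            Bochner_Integration.integrable_diff[OF int int] integrable_scaleR_right[OF int]])
    also have "norm \<dots> \<le> (LINT \<theta>|lborel. (y - x)\<^sup>2 * norm (?f (pCons 0 (pCons 0 p)) x \<theta>))"
    proof (rule Bochner_Integration.integral_norm_bound_integral)
      show "integrable lborel (\<lambda>\<theta>. ?f p y \<theta> - ?f p x \<theta> + (y - x) *\<^sub>R ?f (pCons 0 p) x \<theta>)"
        by (rule Bochner_Integration.integrable_add[OF
            Bochner_Integration.integrable_diff[OF int int] integrable_scaleR_right[OF int]])
      show "integrable lborel (\<lambda>\<theta>. (y - x)\<^sup>2 * norm (?f (pCons 0 (pCons 0 p)) x \<theta>))"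
        by (rule integrable_mult_right[OF integrable_norm[OF int]])
    next
      fix \<theta> :: real
      define u where "u = - (y - x) * \<theta>"
      have k: "osc_kernel \<beta> \<mu> y \<theta> = osc_kernel \<beta> \<mu> x \<theta> * exp (\<i> * of_real u)"
        unfolding osc_kernel_def u_def by (simp add: exp_add[symmetric] algebra_simps)
      have "?f p y \<theta> - ?f p x \<theta> + (y - x) *\<^sub>R ?f (pCons 0 p) x \<theta>
          = ?f p x \<theta> * (exp (\<i> * of_real u) - (\<Sum>k\<le>1. (\<i> * of_real u) ^ k / fact k))"
        unfolding k u_def by (simp add: algebra_simps scaleR_conv_of_real)
      also have "norm \<dots> \<le> norm (?f p x \<theta>) * (\<bar>u\<bar> ^ Suc 1 / fact (Suc 1))"
        unfolding norm_mult[of "?f p x \<theta>"] by (intro mult_left_mono iexp_approx1) auto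
      also have "\<dots> \<le> norm (?f p x \<theta>) * u\<^sup>2"
        by (intro mult_left_mono) (auto simp: power2_eq_square abs_mult[symmetric])
      also have "\<dots> = (y - x)\<^sup>2 * norm (?f (pCons 0 (pCons 0 p)) x \<theta>)"
        by (simp add: u_def norm_mult power_mult_distrib power2_commute[of x y] power2_eq_square[of \<theta>, symmetric])
      finally show "norm (?f p y \<theta> - ?f p x \<theta> + (y - x) *\<^sub>R ?f (pCons 0 p) x \<theta>)
          \<le> (y - x)\<^sup>2 * norm (?f (pCons 0 (pCons 0 p)) x \<theta>)" .
    qed
    also have "\<dots> = B * (y - x)\<^sup>2" by (simp add: B_def)
    finally show ?thesis .
  qed
  show ?thesis
    unfolding has_vector_derivative_def
  proof (rule has_derivativeI_sandwich[where e = 1 and H = "\<lambda>y. B * \<bar>y - x\<bar>"])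
    fix y :: real assume y: "y \<noteq> x"
    have "norm (kernel_moment \<beta> \<mu> p y - kernel_moment \<beta> \<mu> p x
      - (y - x) *\<^sub>R (- kernel_moment \<beta> \<mu> (pCons 0 p) x)) / norm (y - x) \<le> B * (y - x)\<^sup>2 / norm (y - x)"
      by (intro divide_right_mono bound norm_ge_zero)
    also have "\<dots> = B * \<bar>y - x\<bar>"
      using y by (simp add: divide_eq_eq power2_eq_square mult.assoc)
    finally show "norm (kernel_moment \<beta> \<mu> p y - kernel_moment \<beta> \<mu> p x
      - (y - x) *\<^sub>R (- kernel_moment \<beta> \<mu> (pCons 0 p) x)) / norm (y - x) \<le> B * \<bar>y - x\<bar>" .
  next
    have "((\<lambda>y. B * \<bar>y - x\<bar>) \<longlongrightarrow> B * \<bar>x - x\<bar>) (at x)"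
      by (intro tendsto_mult tendsto_const tendsto_rabs tendsto_diff tendsto_ident_at)
    then show "((\<lambda>y. B * \<bar>y - x\<bar>) \<longlongrightarrow> 0) (at x)" by simp
    show "bounded_linear (\<lambda>h. h *\<^sub>R (- kernel_moment \<beta> \<mu> (pCons 0 p) x))"
      by (rule bounded_linear_scaleR_left)
  qed auto
qed

lemma nth_vector_derivative_kernel_moment:
  assumes b: "Re \<beta> > 0" and m: "\<mu> \<ge> 1"
  shows "nth_vector_derivative j (\<lambda>x. c * kernel_moment \<beta> \<mu> p x)
     = (\<lambda>x. c * (-1) ^ j * kernel_moment \<beta> \<mu> (monom 1 j * p) x)"
proof (induction j)
  case (Suc j)
  show ?case
  proof
    fix x
    have "((\<lambda>x. c * (-1) ^ j * kernel_moment \<beta> \<mu> (monom 1 j * p) x) has_vector_derivative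
        c * (-1) ^ j * (- kernel_moment \<beta> \<mu> (pCons 0 (monom 1 j * p)) x)) (at x)"
      by (intro has_vector_derivative_mult_right kernel_moment_has_vector_derivative assms)
    moreover have "pCons 0 (monom 1 j * p) = monom 1 (Suc j) * p" by (simp add: monom_Suc)
    ultimately show "nth_vector_derivative (Suc j) (\<lambda>x. c * kernel_moment \<beta> \<mu> p x) x
       = c * (-1) ^ Suc j * kernel_moment \<beta> \<mu> (monom 1 (Suc j) * p) x"
      using Suc by (simp add: nth_vector_derivative_def vector_derivative_at)
  qed
qed (simp add: nth_vector_derivative_def monom_0 one_pCons[symmetric])

lemma H_fun_eq_kernel_moment: "H_fun \<beta> \<mu> = (\<lambda>x. 1 / (2 * of_real pi) * kernel_moment \<beta> \<mu> 1 x)"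
  by (simp add: H_fun_def kernel_moment_def osc_kernel_def fun_eq_iff)

lemma poly_neg_deriv_H_fun:
  assumes b: "Re \<beta> > 0" and m: "\<mu> \<ge> 1"
  shows "poly_neg_deriv P (H_fun \<beta> \<mu>) x = 1 / (2 * of_real pi) * kernel_moment \<beta> \<mu> P x"
proof -
  have "kernel_moment \<beta> \<mu> P x = (LINT \<theta>|lborel. (\<Sum>j\<le>degree P. coeff P j * (poly (monom 1 j) (\<i> * of_real \<theta>) * osc_kernel \<beta> \<mu> x \<theta>)))"
    unfolding kernel_moment_def by (simp add: poly_altdef[of P] poly_monom sum_distrib_right mult.assoc)
  also have "\<dots> = (\<Sum>j\<le>degree P. coeff P j * kernel_moment \<beta> \<mu> (monom 1 j) x)"
    unfolding kernel_moment_def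
    by (subst Bochner_Integration.integral_sum) (auto intro!: integrable_mult_right integrable_poly_kernel assms)
  \<comment> \<open>The sign in \<open>poly_neg_deriv\<close> meets the sign produced by j
    differentiations, and the two cancel.\<close>
  finally have K: "kernel_moment \<beta> \<mu> P x = (\<Sum>j\<le>degree P. coeff P j * kernel_moment \<beta> \<mu> (monom 1 j) x)" .
  have "coeff P j * (-1) ^ j * (d * (-1) ^ j * k) = d * (coeff P j * k)" for j and d k :: complex
  proof -
    have "coeff P j * (-1) ^ j * (d * (-1) ^ j * k) = ((-1) ^ j * (-1) ^ j) * (d * (coeff P j * k))"
      by (simp only: mult_ac)
    then show ?thesis by (simp flip: power_mult_distrib)
  qed
  then show ?thesis
    unfolding poly_neg_deriv_def H_fun_eq_kernel_moment nth_vector_derivative_kernel_moment[OF b m] K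
    by (simp only: sum_distrib_left mult_1_right)
qed

section \<open>The integral over an arc\<close>

text \<open>With p = 2\<mu> / (2\<mu> - 1) the bound on x gives \<bar>x\<bar> powr p \<le> B powr p
  * N ^ (2\<mu>). Half of the rate \<kappa> then produces the decay in x, and the other half beats
  every power of N. Errors exponentially small in N ^ (2\<mu>) thus take the form of the claimed
  error term.\<close>

lemma exp_neg_absorb:
  fixes \<kappa> B :: real
  assumes k: "\<kappa> > 0" and B: "B \<ge> 0" and m: "\<mu> \<ge> 1"
  obtains C c where "C > 0" "c > 0"
    "\<And>N x. N \<ge> 1 \<Longrightarrow> \<bar>x\<bar> \<le> B * N ^ (2 * \<mu> - 1) \<Longrightarrow>
       N * exp (- \<kappa> * N ^ (2 * \<mu>)) \<le> C / N ^ j * exp (- c * \<bar>x\<bar> powr (2 * real \<mu> / (2 * real \<mu> - 1)))"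
proof -
  define p where "p = 2 * real \<mu> / (2 * real \<mu> - 1)"
  have "\<kappa> / 2 > 0" "2 * \<mu> \<ge> 1" using k m by auto
  then obtain C where C: "C > 0" and CN: "\<And>x. x \<ge> 0 \<Longrightarrow> (1 + x) ^ Suc j \<le> C * exp (\<kappa> / 2 * x ^ (2 * \<mu>))"
    using power_le_exp_power by blast
  \<comment> \<open>The summand 1 keeps the divisor in \<open>c\<close> positive when B = 0.\<close>
  define D where "D = B powr p + 1"
  have D: "D > 0" by (simp add: D_def add_nonneg_pos)
  define c where "c = \<kappa> / 2 / D"
  have c: "c > 0" using k D by (simp add: c_def)
  have "N * exp (- \<kappa> * N ^ (2 * \<mu>)) \<le> C / N ^ j * exp (- c * \<bar>x\<bar> powr p)"
    if N: "N \<ge> 1" and x: "\<bar>x\<bar> \<le> B * N ^ (2 * \<mu> - 1)" for N x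
  proof -
    have p0: "p \<ge> 0" using m by (simp add: p_def)
    have "(N ^ (2 * \<mu> - 1)) powr p = N powr (real (2 * \<mu> - 1) * p)"
      using N by (simp add: powr_realpow[symmetric] powr_powr)
    also have "real (2 * \<mu> - 1) * p = real (2 * \<mu>)" using m by (simp add: p_def of_nat_diff)
    also have "N powr real (2 * \<mu>) = N ^ (2 * \<mu>)" using N by (simp only: powr_realpow)
    finally have Np: "(N ^ (2 * \<mu> - 1)) powr p = N ^ (2 * \<mu>)" .
    have "\<bar>x\<bar> powr p \<le> (B * N ^ (2 * \<mu> - 1)) powr p" using x p0 by (intro powr_mono2) auto
    also have "\<dots> = B powr p * N ^ (2 * \<mu>)" using B N Np by (simp add: powr_mult)
    also have "\<dots> \<le> D * N ^ (2 * \<mu>)" using N by (intro mult_right_mono) (auto simp: D_def)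
    finally have "c * \<bar>x\<bar> powr p \<le> c * (D * N ^ (2 * \<mu>))" using c by (intro mult_left_mono) auto
    also have "\<dots> = \<kappa> / 2 * N ^ (2 * \<mu>)" using D by (simp add: c_def)
    finally have om: "exp (- (\<kappa> / 2) * N ^ (2 * \<mu>)) \<le> exp (- c * \<bar>x\<bar> powr p)" by simp
    have "N ^ Suc j \<le> (1 + N) ^ Suc j" using N by (intro power_mono) auto
    also have "\<dots> \<le> C * exp (\<kappa> / 2 * N ^ (2 * \<mu>))" using N by (intro CN) auto
    finally have "N ^ Suc j * exp (- \<kappa> * N ^ (2 * \<mu>)) \<le> C * exp (\<kappa> / 2 * N ^ (2 * \<mu>)) * exp (- \<kappa> * N ^ (2 * \<mu>))"
      by (intro mult_right_mono) auto
    also have "\<dots> = C * exp (- (\<kappa> / 2) * N ^ (2 * \<mu>))" by (simp add: mult.assoc exp_add[symmetric])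
    also have "\<dots> \<le> C * exp (- c * \<bar>x\<bar> powr p)" using om C by (intro mult_left_mono) auto
    finally show ?thesis using N by (simp add: field_simps)
  qed
  then show ?thesis using that C c unfolding p_def by blast
qed

text \<open>Beyond A the rate k is halved: one half is frozen at A and gives the small factor, the
  other keeps the integral finite.\<close>

lemma integral_tail_bound:
  fixes f :: "real \<Rightarrow> complex" and k K A :: real
  assumes f: "integrable lborel f" and k: "k > 0" and m: "\<mu> \<ge> 1" and A: "A \<ge> 0"
    and b: "\<And>t. norm (f t) \<le> K * exp (- k * t ^ (2 * \<mu>))"
  shows "norm (integral {-A..A} f - (LINT t|lborel. f t))
     \<le> K * exp (- (k / 2) * A ^ (2 * \<mu>)) * (LINT t|lborel. exp (- (k / 2) * t ^ (2 * \<mu>)))"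
proof -
  have K0: "K \<ge> 0" using order.trans[OF norm_ge_zero b[of 0]] by (simp add: zero_le_mult_iff)
  have si: "set_integrable lborel {-A..A} f"
    unfolding set_integrable_def using f by (intro integrable_mult_indicator) auto
  have ic: "integrable lborel (\<lambda>t. indicator (- {-A..A}) t *\<^sub>R f t)"
    using f by (intro integrable_mult_indicator) auto
  have "(LINT t|lborel. f t) - integral {-A..A} f = (LINT t|lborel. f t) - (LINT t|lborel. indicator {-A..A} t *\<^sub>R f t)"
    using set_borel_integral_eq_integral(2)[OF si] by (simp add: set_lebesgue_integral_def)
  also have "\<dots> = (LINT t|lborel. f t - indicator {-A..A} t *\<^sub>R f t)"
    using f si unfolding set_integrable_def by (intro Bochner_Integration.integral_diff[symmetric]) auto
  also have "\<dots> = (LINT t|lborel. indicator (- {-A..A}) t *\<^sub>R f t)"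
    by (intro Bochner_Integration.integral_cong) (auto simp: indicator_def)
  also have "norm \<dots> \<le> (LINT t|lborel. K * exp (- (k / 2) * A ^ (2 * \<mu>)) * exp (- (k / 2) * t ^ (2 * \<mu>)))"
  proof (rule Bochner_Integration.integral_norm_bound_integral[OF ic])
    show "integrable lborel (\<lambda>t. K * exp (- (k / 2) * A ^ (2 * \<mu>)) * exp (- (k / 2) * t ^ (2 * \<mu>)))"
      using k m by (intro integrable_mult_right integrable_exp_neg_even_power) auto
    fix t :: real
    show "norm (indicator (- {-A..A}) t *\<^sub>R f t) \<le> K * exp (- (k / 2) * A ^ (2 * \<mu>)) * exp (- (k / 2) * t ^ (2 * \<mu>))"
    proof (cases "t \<in> {-A..A}")
      case False
      then have "A ^ (2 * \<mu>) \<le> \<bar>t\<bar> ^ (2 * \<mu>)" using A by (intro power_mono) auto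
      then have "A ^ (2 * \<mu>) \<le> t ^ (2 * \<mu>)" by (simp add: power_mult)
      then have "k / 2 * A ^ (2 * \<mu>) \<le> k / 2 * t ^ (2 * \<mu>)" using k by (intro mult_left_mono) auto
      then have "exp (- k * t ^ (2 * \<mu>)) \<le> exp (- (k / 2) * A ^ (2 * \<mu>)) * exp (- (k / 2) * t ^ (2 * \<mu>))"
        by (simp add: exp_add[symmetric] algebra_simps)
      then have "K * exp (- k * t ^ (2 * \<mu>)) \<le> K * (exp (- (k / 2) * A ^ (2 * \<mu>)) * exp (- (k / 2) * t ^ (2 * \<mu>)))"
        using K0 by (intro mult_left_mono) auto
      then show ?thesis using False b[of t] by (simp add: mult.assoc)
    qed (use K0 in simp)
  qed
  finally show ?thesis by (simp add: norm_minus_commute)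
qed

text \<open>The integrand minus its Taylor polynomial in 1 / N is moved to height \<open>h\<close>,
  where the exponent gains \<bar>x h\<bar> and loses at most C h ^ (2\<mu>). The Taylor polynomial
  stays on the real axis, and extending it from the arc to the whole line produces the moments at an
  exponentially small cost. \<open>\<delta>0\<close> depends neither on \<open>M\<close> nor on N
  and x.\<close>

lemma saddle_point_estimate:
  fixes g :: "complex \<Rightarrow> complex"
  assumes b: "Re \<beta> > 0" and m: "\<mu> \<ge> 1" and \<rho>0: "\<rho>0 > 0" and g: "g holomorphic_on ball 0 \<rho>0"
    and gF: "g has_fps_expansion Abs_fps (\<lambda>\<nu>. if \<nu> = 0 then 0 else \<gamma> (2 * \<mu> + \<nu>) / fact (2 * \<mu> + \<nu>))"
    and B: "B \<ge> 0"
  obtains \<delta>0 where "\<delta>0 > 0" "\<And>\<delta> M. 0 < \<delta> \<Longrightarrow> \<delta> \<le> \<delta>0 \<Longrightarrow> \<exists>C c. C > 0 \<and> c > 0 \<and>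
    (\<forall>N x. N \<ge> 1 \<longrightarrow> \<bar>x\<bar> \<le> B * N ^ (2 * \<mu> - 1) \<longrightarrow>
      norm (integral {- (\<delta> * N)..\<delta> * N} (\<lambda>\<theta>. osc_kernel \<beta> \<mu> x \<theta> * exp ((\<i> * of_real \<theta>) ^ (2 * \<mu>) * g (\<i> * of_real \<theta> / of_real N)))
        - (\<Sum>m\<le>M. kernel_moment \<beta> \<mu> (expansion_poly \<gamma> \<mu> m) x / of_real N ^ m))
      \<le> C / N ^ Suc M * exp (- c * \<bar>x\<bar> powr (2 * real \<mu> / (2 * real \<mu> - 1))))"
proof -
  obtain \<epsilon> c C :: real where eps: "\<epsilon> > 0" and c: "c > 0" and C: "C > 0" and
    ell: "\<And>s v :: real. - Re (\<beta> * Complex s v ^ (2 * \<mu>)) + 2 * \<epsilon> * norm (Complex s v) ^ (2 * \<mu>)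
       \<le> - c * s ^ (2 * \<mu>) + C * v ^ (2 * \<mu>)"
    using elliptic_bound[OF b, of \<mu>] by metis
  have g0: "g 0 = 0" using has_fps_expansion_imp_0_eq_fps_nth_0[OF gF] by simp
  have "isCont g 0" using has_fps_expansion_imp_continuous[OF gF] by simp
  then obtain \<rho>1 where \<rho>1: "\<rho>1 > 0" and g1: "\<And>w. norm w < \<rho>1 \<Longrightarrow> norm (g w) < \<epsilon>"
    using eps g0 unfolding continuous_at_eps_delta by (auto simp: dist_norm)
  define \<rho> where "\<rho> = min \<rho>1 \<rho>0 / 2"
  have \<rho>: "0 < \<rho>" "\<rho> < \<rho>0" "\<rho> < \<rho>1" using \<rho>0 \<rho>1 by (auto simp: \<rho>_def)
  have ge: "norm (g w) \<le> \<epsilon>" if "norm w \<le> \<rho>" for w using g1[of w] that \<rho> by simp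
  \<comment> \<open>Shifts will be at most \<tau> A, so on the vertical edges the loss C v ^
    (2\<mu>) consumes at most half of the decay c A ^ (2\<mu>).\<close>
  define \<tau> where "\<tau> = min 1 (c / (2 * C))"
  have \<tau>: "0 < \<tau>" "\<tau> \<le> 1" "C * \<tau> ^ (2 * \<mu>) \<le> c / 2"
  proof -
    show t: "0 < \<tau>" "\<tau> \<le> 1" using c C by (auto simp: \<tau>_def)
    have "\<tau> ^ (2 * \<mu>) \<le> \<tau> ^ 1" using t m by (intro power_decreasing) auto
    also have "\<dots> \<le> c / (2 * C)" by (simp add: \<tau>_def)
    finally show "C * \<tau> ^ (2 * \<mu>) \<le> c / 2" using C by (simp add: field_simps)
  qed
  define p where "p = 2 * real \<mu> / (2 * real \<mu> - 1)"
  define q where "q = 1 / (2 * real \<mu> - 1)"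
  have pq: "q \<ge> 0" "p = 1 + q" "q * real (2 * \<mu>) = p" "real (2 * \<mu> - 1) * q = 1"
    using m by (auto simp: p_def q_def of_nat_diff field_simps)
  define J where "J = (\<lambda>k::real. LINT t|lborel. exp (- k * t ^ (2 * \<mu>)))"
  have J0: "J k \<ge> 0" for k by (auto simp: J_def intro!: Bochner_Integration.integral_nonneg)
  show ?thesis
  \<comment> \<open>Points of the contour have modulus at most 2 \<delta> N, so \<delta> \<le>
    \<rho> / 4 keeps them within \<rho> N / 2, as the Taylor remainder estimate requires.\<close>
  proof (rule that[of "\<rho> / 4"])
    fix \<delta> M assume \<delta>: "0 < \<delta>" "\<delta> \<le> \<rho> / 4"
    obtain K1 where K1: "K1 > 0" and K1b: "\<And>t. t \<ge> 0 \<Longrightarrow> (1 + t) ^ Suc M \<le> K1 * exp (\<epsilon> * t ^ (2 * \<mu>))"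
      using power_le_exp_power[OF eps, of "2 * \<mu>"] m by (metis le_add1 mult_2 order.trans)
    define K where "K = 2 * K1 / \<rho> ^ Suc M"
    have K: "K > 0" using K1 \<rho> by (simp add: K_def)
    have "\<exists>C'. \<forall>m. C' m > 0 \<and> (\<forall>x \<theta>. norm (poly (expansion_poly \<gamma> \<mu> m) (\<i> * of_real \<theta>) * osc_kernel \<beta> \<mu> x \<theta>)
       \<le> C' m * exp (- (Re \<beta> / 2) * \<theta> ^ (2 * \<mu>)))"
      by (rule choice, rule allI) (metis poly_kernel_bound[OF b m])
    then obtain C' where C'0: "\<And>m. C' m > (0::real)" and C': "\<And>m x \<theta>. norm (poly (expansion_poly \<gamma> \<mu> m) (\<i> * of_real \<theta>) * osc_kernel \<beta> \<mu> x \<theta>)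
       \<le> C' m * exp (- (Re \<beta> / 2) * \<theta> ^ (2 * \<mu>))"
      by blast
    define K2 where "K2 = (\<Sum>m\<le>M. C' m)"
    have K2: "K2 \<ge> 0" unfolding K2_def by (intro sum_nonneg) (use C'0 less_imp_le in blast)
    \<comment> \<open>The entries 1 and 1 / (2 C) make the loss C h ^ (2\<mu>) at most half of the
      gain from the shift; the last entry keeps \<bar>h\<bar> \<le> \<tau> \<delta> N, with 1 added
      so that the divisor is positive.\<close>
    define c' where "c' = min (min 1 (1 / (2 * C))) (\<tau> * \<delta> / (B powr q + 1))"
    have c': "0 < c'" "c' \<le> 1" "c' \<le> 1 / (2 * C)" "c' \<le> \<tau> * \<delta> / (B powr q + 1)"
      using C \<tau> \<delta> by (auto simp: c'_def add_nonneg_pos)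
    have c'C: "C * c' ^ (2 * \<mu>) \<le> c' / 2"
    proof -
      have "c' ^ (2 * \<mu>) \<le> c' ^ 2" using c' m by (intro power_decreasing) auto
      also have "\<dots> \<le> c' * (1 / (2 * C))" unfolding power2_eq_square using c' by (intro mult_left_mono) auto
      finally show ?thesis using C by (simp add: field_simps)
    qed
    \<comment> \<open>\<open>k1\<close> and \<open>k2\<close> are the decay rates in N ^ (2\<mu>) on
      the vertical edges and in the tails beyond the arc.\<close>
    define k1 where "k1 = c / 2 * \<delta> ^ (2 * \<mu>)"
    define k2 where "k2 = Re \<beta> / 2 / 2 * \<delta> ^ (2 * \<mu>)"
    have k: "k1 > 0" "k2 > 0" using c b \<delta> by (auto simp: k1_def k2_def)
    obtain A1 a1 where A1: "A1 > 0" "a1 > 0" and ab1: "\<And>N x. N \<ge> 1 \<Longrightarrow> \<bar>x\<bar> \<le> B * N ^ (2 * \<mu> - 1) \<Longrightarrow>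
       N * exp (- k1 * N ^ (2 * \<mu>)) \<le> A1 / N ^ Suc M * exp (- a1 * \<bar>x\<bar> powr p)"
      using exp_neg_absorb[OF k(1) B m, of "Suc M"] unfolding p_def by metis
    obtain A2 a2 where A2: "A2 > 0" "a2 > 0" and ab2: "\<And>N x. N \<ge> 1 \<Longrightarrow> \<bar>x\<bar> \<le> B * N ^ (2 * \<mu> - 1) \<Longrightarrow>
       N * exp (- k2 * N ^ (2 * \<mu>)) \<le> A2 / N ^ Suc M * exp (- a2 * \<bar>x\<bar> powr p)"
      using exp_neg_absorb[OF k(2) B m, of "Suc M"] unfolding p_def by metis
    define c4 where "c4 = min (c' / 2) (min a1 a2)"
    \<comment> \<open>The summands belong to the shifted horizontal line, the two vertical edges and
      the tails; the last one ensures positivity.\<close>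
    define C4 where "C4 = K * J c + 2 * K * \<tau> * \<delta> * A1 + K2 * J (Re \<beta> / 2 / 2) * A2 + 1"
    have c4: "c4 > 0" using c' A1 A2 by (auto simp: c4_def)
    have C4: "C4 > 0" unfolding C4_def using K J0[of c] \<tau> \<delta> A1 K2 J0[of "Re \<beta> / 2 / 2"] A2
      by (intro add_nonneg_pos add_nonneg_nonneg mult_nonneg_nonneg) auto
    show "\<exists>C c. C > 0 \<and> c > 0 \<and>
    (\<forall>N x. N \<ge> 1 \<longrightarrow> \<bar>x\<bar> \<le> B * N ^ (2 * \<mu> - 1) \<longrightarrow>
      norm (integral {- (\<delta> * N)..\<delta> * N} (\<lambda>\<theta>. osc_kernel \<beta> \<mu> x \<theta> * exp ((\<i> * of_real \<theta>) ^ (2 * \<mu>) * g (\<i> * of_real \<theta> / of_real N)))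
        - (\<Sum>m\<le>M. kernel_moment \<beta> \<mu> (expansion_poly \<gamma> \<mu> m) x / of_real N ^ m))
      \<le> C / N ^ Suc M * exp (- c * \<bar>x\<bar> powr (2 * real \<mu> / (2 * real \<mu> - 1))))"
      unfolding p_def[symmetric]
    proof (rule exI[of _ C4], rule exI[of _ c4], intro conjI C4 c4 allI impI)
      fix N x :: real assume N: "N \<ge> 1" and x: "\<bar>x\<bar> \<le> B * N ^ (2 * \<mu> - 1)"
      define \<omega> where "\<omega> = \<bar>x\<bar> powr p"
      define A where "A = \<delta> * N"
      have A: "A > 0" using \<delta> N by (simp add: A_def)
      let ?P = "expansion_poly \<gamma> \<mu>"
      let ?Z = "1 / of_real N :: complex"
      define E where "E = (\<lambda>z. exp ((\<i> * z) ^ (2 * \<mu>) * g (\<i> * z * ?Z)) - (\<Sum>m\<le>M. poly (?P m) (\<i> * z) * ?Z ^ m))"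
      define T where "T = (\<lambda>z. exp (- \<i> * of_real x * z) * exp (- \<beta> * z ^ (2 * \<mu>)) * E z)"
      have Zn: "norm ?Z = 1 / N" using N by (simp add: norm_divide)
      have Tb: "norm (T (Complex s v)) \<le> K / N ^ Suc M * exp (x * v - c * s ^ (2 * \<mu>) + C * v ^ (2 * \<mu>))"
        if sv: "\<bar>s\<bar> \<le> A" "\<bar>v\<bar> \<le> A" for s v
      proof -
        let ?z = "Complex s v"
        have "norm ?z \<le> 2 * A" using cmod_le[of ?z] sv by simp
        also have "\<dots> \<le> \<rho> / 2 * N" using \<delta> N by (simp add: A_def mult_right_mono)
        finally have zN: "norm (\<i> * ?z) * norm ?Z \<le> \<rho> / 2" using N by (simp add: Zn norm_mult field_simps)
        have "norm (E ?z) \<le> 2 * exp (\<epsilon> * norm (\<i> * ?z) ^ (2 * \<mu>)) * (norm ?Z * (1 + norm (\<i> * ?z)) / \<rho>) ^ Suc M"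
          unfolding E_def by (rule expansion_poly_remainder[OF g gF \<rho>(1,2) ge zN])
        also have "(norm ?Z * (1 + norm (\<i> * ?z)) / \<rho>) ^ Suc M = (1 + norm ?z) ^ Suc M / (N ^ Suc M * \<rho> ^ Suc M)"
          unfolding Zn by (simp add: norm_mult power_divide power_mult_distrib)
        also have "\<dots> \<le> K1 * exp (\<epsilon> * norm ?z ^ (2 * \<mu>)) / (N ^ Suc M * \<rho> ^ Suc M)"
          using N \<rho> by (intro divide_right_mono K1b) auto
        finally have "norm (E ?z) \<le> 2 * exp (\<epsilon> * norm ?z ^ (2 * \<mu>)) * (K1 * exp (\<epsilon> * norm ?z ^ (2 * \<mu>)) / (N ^ Suc M * \<rho> ^ Suc M))"
          by (simp add: norm_mult)
        \<comment> \<open>One exponential bounds the analytic factor on the disc, the other absorbs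
          (1 + \<bar>z\<bar>) ^ (M + 1); together they fill the margin 2\<epsilon> in
          \<open>ell\<close>.\<close>
        also have "\<dots> = K / N ^ Suc M * (exp (\<epsilon> * norm ?z ^ (2 * \<mu>)) * exp (\<epsilon> * norm ?z ^ (2 * \<mu>)))" by (simp add: K_def mult_ac del: power_Suc)
        also have "\<dots> = K / N ^ Suc M * exp (2 * \<epsilon> * norm ?z ^ (2 * \<mu>))" by (simp add: exp_add[symmetric])
        finally have Eb: "norm (E ?z) \<le> K / N ^ Suc M * exp (2 * \<epsilon> * norm ?z ^ (2 * \<mu>))" .
        have "norm (T ?z) = exp (x * v) * exp (- Re (\<beta> * ?z ^ (2 * \<mu>))) * norm (E ?z)"
          unfolding T_def norm_mult norm_exp_eq_Re by simp
        also have "\<dots> \<le> exp (x * v) * exp (- Re (\<beta> * ?z ^ (2 * \<mu>))) * (K / N ^ Suc M * exp (2 * \<epsilon> * norm ?z ^ (2 * \<mu>)))"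
          by (intro mult_left_mono Eb) auto
        also have "\<dots> = K / N ^ Suc M * exp (x * v + (- Re (\<beta> * ?z ^ (2 * \<mu>)) + 2 * \<epsilon> * norm ?z ^ (2 * \<mu>)))"
          by (simp only: exp_add mult_ac)
        also have "\<dots> \<le> K / N ^ Suc M * exp (x * v + (- c * s ^ (2 * \<mu>) + C * v ^ (2 * \<mu>)))"
          using K N by (intro mult_left_mono exp_le_cancel_iff[THEN iffD2] add_left_mono ell) auto
        finally show ?thesis by (simp add: algebra_simps)
      qed
      \<comment> \<open>\<open>h\<close> has the size that balances the gain \<open>x * h\<close> against the loss \<open>C * h ^ (2 * \<mu>)\<close>\<close>
      define h where "h = - sgn x * (c' * \<bar>x\<bar> powr q)"
      have habs: "\<bar>h\<bar> = c' * \<bar>x\<bar> powr q" using c' by (cases "x = 0") (auto simp: h_def abs_mult sgn_if)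
      \<comment> \<open>The sign of \<open>h\<close> is opposite to that of \<open>x\<close>.
        Because 1 + q = p the gain is a multiple of \<omega>, and because 2\<mu> q = p so is the
        loss in \<open>hp\<close>.\<close>
      have xh: "x * h = - c' * \<omega>"
        using pq by (cases "x = 0") (auto simp: h_def \<omega>_def powr_add sgn_if)
      have hp: "h ^ (2 * \<mu>) = c' ^ (2 * \<mu>) * \<omega>"
      proof -
        have "h ^ (2 * \<mu>) = \<bar>h\<bar> ^ (2 * \<mu>)" by (simp add: power_mult)
        also have "\<dots> = c' ^ (2 * \<mu>) * (\<bar>x\<bar> powr q) ^ (2 * \<mu>)" by (simp add: habs power_mult_distrib)
        also have "(\<bar>x\<bar> powr q) ^ (2 * \<mu>) = \<omega>"
          using m pq(3) by (cases "x = 0") (auto simp: \<omega>_def powr_realpow[symmetric] powr_powr)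
        finally show ?thesis .
      qed
      have hA: "\<bar>h\<bar> \<le> \<tau> * A"
      proof -
        have "\<bar>x\<bar> powr q \<le> (B * N ^ (2 * \<mu> - 1)) powr q" using x pq by (intro powr_mono2) auto
        also have "\<dots> = B powr q * (N ^ (2 * \<mu> - 1)) powr q" using B N by (simp add: powr_mult)
        also have "(N ^ (2 * \<mu> - 1)) powr q = N powr (real (2 * \<mu> - 1) * q)"
          using N by (simp add: powr_realpow[symmetric] powr_powr)
        also have "\<dots> = N" unfolding pq(4) using N by simp
        also have "B powr q * N \<le> (B powr q + 1) * N" using N by (intro mult_right_mono) auto
        finally have "\<bar>h\<bar> \<le> c' * ((B powr q + 1) * N)" unfolding habs using c' by (intro mult_left_mono) auto
        also have "\<dots> \<le> \<tau> * \<delta> / (B powr q + 1) * ((B powr q + 1) * N)"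
          using c' N by (intro mult_right_mono mult_nonneg_nonneg) (auto intro: add_nonneg_nonneg)
        also have "\<dots> = \<tau> * A"
        proof -
          have "B powr q + 1 \<noteq> 0" using powr_ge_zero[of B q] by linarith
          then show ?thesis by (simp add: A_def)
        qed
        finally show ?thesis .
      qed
      have hA': "\<bar>u * h\<bar> \<le> \<tau> * A" if "0 \<le> u" "u \<le> 1" for u
        using that hA mult_left_le_one_le[of "\<bar>h\<bar>" u] by (simp add: abs_mult)
      have tA: "\<tau> * A \<le> A" using \<tau> A by simp
      \<comment> \<open>On this ball \<i> z / N lies in the domain of \<open>g\<close>; the whole
        rectangle swept by the shift has to fit inside.\<close>
      let ?S = "ball 0 (\<rho>0 * N) :: complex set"
      have inS: "Complex t (u * h) \<in> ?S" if "\<bar>t\<bar> \<le> A" "0 \<le> u" "u \<le> 1" for t u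
      proof -
        have "norm (Complex t (u * h)) \<le> 2 * A" using cmod_le[of "Complex t (u * h)"] that hA'[of u] tA by simp
        also have "\<dots> < \<rho>0 * N" using \<delta> \<rho> N by (simp add: A_def)
        finally show ?thesis by simp
      qed
      have Zin: "\<i> * z * ?Z \<in> ball 0 \<rho>0" if "z \<in> ?S" for z
        using that N by (simp add: norm_mult norm_divide field_simps)
      have gh: "(\<lambda>z. g (\<i> * z * ?Z)) holomorphic_on ?S"
        using holomorphic_on_compose_gen[of "\<lambda>z. \<i> * z * ?Z" ?S g "ball 0 \<rho>0"] g Zin
        by (force simp: o_def intro!: holomorphic_intros)
      have Th: "T holomorphic_on ?S"
        unfolding T_def E_def by (intro holomorphic_intros gh)
      have Tc: "continuous_on {-A..A} (\<lambda>t. T (Complex t (u * h)))" if u: "0 \<le> u" "u \<le> 1" for u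
        by (rule continuous_on_compose2[OF holomorphic_on_imp_continuous_on[OF Th]])
           (use inS u in \<open>auto simp: Complex_eq intro!: continuous_intros\<close>)
      have vert: "norm (T (Complex t (u * h))) \<le> K / N ^ Suc M * exp (- k1 * N ^ (2 * \<mu>))"
        if t: "\<bar>t\<bar> = A" and u: "0 \<le> u" "u \<le> 1" for t u
      proof -
        have "x * (u * h) = u * (- c' * \<omega>)" unfolding xh[symmetric] by simp
        also have "\<dots> \<le> 0" using u c' by (auto simp: \<omega>_def mult_le_0_iff)
        finally have 1: "x * (u * h) \<le> 0" .
        have "\<bar>u * h\<bar> ^ (2 * \<mu>) \<le> (\<tau> * A) ^ (2 * \<mu>)" using hA'[OF u] by (intro power_mono) auto
        then have "C * (u * h) ^ (2 * \<mu>) \<le> C * ((\<tau> * A) ^ (2 * \<mu>))" using C by (intro mult_left_mono) (auto simp: power_mult)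
        also have "\<dots> = (C * \<tau> ^ (2 * \<mu>)) * A ^ (2 * \<mu>)" by (simp add: power_mult_distrib)
        also have "\<dots> \<le> c / 2 * A ^ (2 * \<mu>)" using \<tau> A by (intro mult_right_mono) auto
        finally have 2: "C * (u * h) ^ (2 * \<mu>) \<le> c / 2 * A ^ (2 * \<mu>)" .
        have 3: "t ^ (2 * \<mu>) = A ^ (2 * \<mu>)" unfolding t[symmetric] by (simp add: power_mult)
        have "norm (T (Complex t (u * h))) \<le> K / N ^ Suc M * exp (x * (u * h) - c * t ^ (2 * \<mu>) + C * (u * h) ^ (2 * \<mu>))"
          using t hA'[OF u] tA by (intro Tb) auto
        also have "\<dots> \<le> K / N ^ Suc M * exp (- k1 * N ^ (2 * \<mu>))"
        proof (intro mult_left_mono exp_le_cancel_iff[THEN iffD2])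
          have "k1 * N ^ (2 * \<mu>) = c / 2 * A ^ (2 * \<mu>)" by (simp add: k1_def A_def power_mult_distrib)
          then show "x * (u * h) - c * t ^ (2 * \<mu>) + C * (u * h) ^ (2 * \<mu>) \<le> - k1 * N ^ (2 * \<mu>)"
            using 1 2 unfolding 3 by simp
        qed (use K N in auto)
        finally show ?thesis .
      qed
      have hor: "norm (integral {-A..A} (\<lambda>t. T (Complex t h))) \<le> K / N ^ Suc M * exp (- (c' / 2) * \<omega>) * J c"
      proof -
        let ?b = "\<lambda>t. K / N ^ Suc M * exp (- (c' / 2) * \<omega>) * exp (- c * t ^ (2 * \<mu>))"
        have ib: "integrable lborel ?b" using c m by (intro integrable_mult_right integrable_exp_neg_even_power) auto
        have "norm (integral {-A..A} (\<lambda>t. T (Complex t h))) \<le> integral {-A..A} ?b"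
        proof (rule integral_norm_bound_integral)
          show "(\<lambda>t. T (Complex t h)) integrable_on {-A..A}"
            using Tc[of 1] by (intro integrable_continuous_interval) auto
          show "?b integrable_on {-A..A}"
            by (intro integrable_continuous_interval continuous_intros)
          fix t assume t: "t \<in> {-A..A}"
          have "norm (T (Complex t h)) \<le> K / N ^ Suc M * exp (x * h - c * t ^ (2 * \<mu>) + C * h ^ (2 * \<mu>))"
            using t hA tA by (intro Tb) auto
          also have "\<dots> \<le> K / N ^ Suc M * exp (- (c' / 2) * \<omega> + - c * t ^ (2 * \<mu>))"
          proof (intro mult_left_mono exp_le_cancel_iff[THEN iffD2])
            have "(C * c' ^ (2 * \<mu>)) * \<omega> \<le> c' / 2 * \<omega>" using c'C by (intro mult_right_mono) (auto simp: \<omega>_def)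
            then show "x * h - c * t ^ (2 * \<mu>) + C * h ^ (2 * \<mu>) \<le> - (c' / 2) * \<omega> + - c * t ^ (2 * \<mu>)"
              unfolding xh hp by (simp add: mult.assoc)
          qed (use K N in auto)
          finally show "norm (T (Complex t h)) \<le> ?b t" unfolding exp_add by (simp add: mult.assoc)
        qed
        also have "\<dots> \<le> integral UNIV ?b"
        proof (rule integral_subset_le)
          show "?b integrable_on {-A..A}"
            by (intro integrable_continuous_interval continuous_intros)
          show "?b integrable_on UNIV" by (rule integrable_on_lborel[OF ib])
          show "\<forall>t\<in>UNIV. 0 \<le> ?b t" using K N by simp
        qed simp
        also have "\<dots> = K / N ^ Suc M * exp (- (c' / 2) * \<omega>) * J c"
          unfolding integral_lborel[OF ib] J_def by simp
        finally show ?thesis .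
      qed
      have T1: "norm (integral {-A..A} (\<lambda>t. T (of_real t)))
          \<le> K / N ^ Suc M * exp (- (c' / 2) * \<omega>) * J c + 2 * (K / N ^ Suc M * exp (- k1 * N ^ (2 * \<mu>))) * (\<tau> * A)"
      proof -
        have "norm (integral {-A..A} (\<lambda>t. T (of_real t))) \<le> norm (integral {-A..A} (\<lambda>t. T (Complex t h)))
             + 2 * (K / N ^ Suc M * exp (- k1 * N ^ (2 * \<mu>))) * \<bar>h\<bar>"
          by (rule integral_shift_bound[OF _ _ Th]) (use A inS vert in auto)
        then show ?thesis using hor hA K N
          by (smt (verit) mult_left_mono divide_nonneg_nonneg exp_ge_zero mult_nonneg_nonneg zero_le_power)
      qed
      \<comment> \<open>The Taylor part is integrable on the whole line, which is what turns its
        integral into moments.\<close>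
      define f where "f = (\<lambda>t. \<Sum>m\<le>M. poly (?P m) (\<i> * of_real t) * osc_kernel \<beta> \<mu> x t / of_real N ^ m)"
      have fi: "integrable lborel f"
        unfolding f_def by (intro Bochner_Integration.integrable_sum integrable_divide_zero integrable_poly_kernel[OF b m])
      have fL: "(LINT t|lborel. f t) = (\<Sum>m\<le>M. kernel_moment \<beta> \<mu> (?P m) x / of_real N ^ m)"
        unfolding f_def kernel_moment_def
        by (subst Bochner_Integration.integral_sum) (auto intro!: integrable_divide_zero integrable_poly_kernel[OF b m])
      have fb: "norm (f t) \<le> K2 * exp (- (Re \<beta> / 2) * t ^ (2 * \<mu>))" for t
        unfolding f_def K2_def sum_distrib_right
      proof (rule order.trans[OF norm_sum sum_mono])
        fix m
        have "norm (poly (?P m) (\<i> * of_real t) * osc_kernel \<beta> \<mu> x t / of_real N ^ m)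
           \<le> norm (poly (?P m) (\<i> * of_real t) * osc_kernel \<beta> \<mu> x t) / 1"
          unfolding norm_divide norm_power using N by (intro divide_left_mono) auto
        then show "norm (poly (?P m) (\<i> * of_real t) * osc_kernel \<beta> \<mu> x t / of_real N ^ m) \<le> C' m * exp (- (Re \<beta> / 2) * t ^ (2 * \<mu>))"
          using C'[of m t x] by simp
      qed
      have T2: "norm (integral {-A..A} f - (LINT t|lborel. f t)) \<le> K2 * exp (- k2 * N ^ (2 * \<mu>)) * J (Re \<beta> / 2 / 2)"
        using integral_tail_bound[OF fi _ m _ fb, of A] b A
        by (simp add: J_def k2_def A_def power_mult_distrib mult_ac)
      let ?F = "\<lambda>\<theta>. osc_kernel \<beta> \<mu> x \<theta> * exp ((\<i> * of_real \<theta>) ^ (2 * \<mu>) * g (\<i> * of_real \<theta> / of_real N))"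
      have TF: "T (of_real t) = ?F t - f t" for t
        by (simp add: T_def E_def f_def osc_kernel_def algebra_simps sum_distrib_left power_divide)
      have ci: "continuous_on {-A..A} f" unfolding f_def using N by (intro continuous_intros) auto
      have cT: "continuous_on {-A..A} (\<lambda>t. T (of_real t))" using Tc[of 0] by (simp add: complex_of_real_def)
      have "integral {-A..A} ?F = integral {-A..A} (\<lambda>t. T (of_real t) + f t)" by (simp add: TF)
      also have "\<dots> = integral {-A..A} (\<lambda>t. T (of_real t)) + integral {-A..A} f"
        by (intro Henstock_Kurzweil_Integration.integral_add integrable_continuous_interval ci cT)
      finally have "norm (integral {-A..A} ?F - (LINT t|lborel. f t))
         \<le> norm (integral {-A..A} (\<lambda>t. T (of_real t))) + norm (integral {-A..A} f - (LINT t|lborel. f t))"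
        using norm_triangle_ineq[of "integral {-A..A} (\<lambda>t. T (of_real t))" "integral {-A..A} f - (LINT t|lborel. f t)"]
        by (simp add: algebra_simps)
      also have "\<dots> \<le> K / N ^ Suc M * exp (- (c' / 2) * \<omega>) * J c + 2 * (K / N ^ Suc M * exp (- k1 * N ^ (2 * \<mu>))) * (\<tau> * A)
          + K2 * exp (- k2 * N ^ (2 * \<mu>)) * J (Re \<beta> / 2 / 2)"
        using T1 T2 by linarith
      also have "\<dots> \<le> (K * J c) * (1 / N ^ Suc M * exp (- c4 * \<omega>)) + (2 * K * \<tau> * \<delta> * A1) * (1 / N ^ Suc M * exp (- c4 * \<omega>))
          + (K2 * J (Re \<beta> / 2 / 2) * A2) * (1 / N ^ Suc M * exp (- c4 * \<omega>))"
      proof (intro add_mono)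
        have om: "exp (- t * \<omega>) \<le> exp (- c4 * \<omega>)" if "c4 \<le> t" for t
          using that by (auto simp: \<omega>_def intro!: mult_right_mono)
        have NM: "N ^ Suc M \<ge> 1" using N by (intro one_le_power)
        have "K * J c / N ^ Suc M * exp (- (c' / 2) * \<omega>) \<le> K * J c / N ^ Suc M * exp (- c4 * \<omega>)"
          using K J0 N by (intro mult_left_mono om) (auto simp: c4_def)
        then show "K / N ^ Suc M * exp (- (c' / 2) * \<omega>) * J c \<le> (K * J c) * (1 / N ^ Suc M * exp (- c4 * \<omega>))"
          by (simp add: mult_ac)
        have e1: "N * exp (- k1 * N ^ (2 * \<mu>)) \<le> A1 / N ^ Suc M * exp (- c4 * \<omega>)"
        proof -
          have "A1 / N ^ Suc M * exp (- a1 * \<omega>) \<le> A1 / N ^ Suc M * exp (- c4 * \<omega>)"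
            using A1 N by (intro mult_left_mono om) (auto simp: c4_def)
          then show ?thesis using ab1[OF N x] by (simp add: \<omega>_def)
        qed
        have "2 * (K / N ^ Suc M * exp (- k1 * N ^ (2 * \<mu>))) * (\<tau> * A) = (2 * K * \<tau> * \<delta>) * (N * exp (- k1 * N ^ (2 * \<mu>))) / N ^ Suc M"
          by (simp add: A_def)
        also have "\<dots> \<le> (2 * K * \<tau> * \<delta>) * (N * exp (- k1 * N ^ (2 * \<mu>))) / 1"
          using NM K \<tau> \<delta> N by (intro divide_left_mono mult_nonneg_nonneg) auto
        also have "\<dots> \<le> (2 * K * \<tau> * \<delta>) * (A1 / N ^ Suc M * exp (- c4 * \<omega>))"
          unfolding div_by_1 using K \<tau> \<delta> by (intro mult_left_mono e1 mult_nonneg_nonneg) auto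
        finally show "2 * (K / N ^ Suc M * exp (- k1 * N ^ (2 * \<mu>))) * (\<tau> * A) \<le> (2 * K * \<tau> * \<delta> * A1) * (1 / N ^ Suc M * exp (- c4 * \<omega>))"
          by (simp add: mult_ac)
        have e2: "N * exp (- k2 * N ^ (2 * \<mu>)) \<le> A2 / N ^ Suc M * exp (- c4 * \<omega>)"
        proof -
          have "A2 / N ^ Suc M * exp (- a2 * \<omega>) \<le> A2 / N ^ Suc M * exp (- c4 * \<omega>)"
            using A2 N by (intro mult_left_mono om) (auto simp: c4_def)
          then show ?thesis using ab2[OF N x] by (simp add: \<omega>_def)
        qed
        \<comment> \<open>The tail bound comes without the factor N of the absorbed form; N \<ge> 1
          allows it to be inserted.\<close>
        have "1 * exp (- k2 * N ^ (2 * \<mu>)) \<le> N * exp (- k2 * N ^ (2 * \<mu>))" using N by (intro mult_right_mono) auto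
        then have "exp (- k2 * N ^ (2 * \<mu>)) \<le> A2 / N ^ Suc M * exp (- c4 * \<omega>)" using e2 by linarith
        then have "(K2 * J (Re \<beta> / 2 / 2)) * exp (- k2 * N ^ (2 * \<mu>)) \<le> (K2 * J (Re \<beta> / 2 / 2)) * (A2 / N ^ Suc M * exp (- c4 * \<omega>))"
          using K2 J0 by (intro mult_left_mono) auto
        then show "K2 * exp (- k2 * N ^ (2 * \<mu>)) * J (Re \<beta> / 2 / 2) \<le> (K2 * J (Re \<beta> / 2 / 2) * A2) * (1 / N ^ Suc M * exp (- c4 * \<omega>))"
          by (simp add: mult_ac)
      qed
      also have "\<dots> \<le> C4 * (1 / N ^ Suc M * exp (- c4 * \<omega>))"
        unfolding C4_def distrib_right[of _ 1] mult_1 le_add_same_cancel1 distrib_right using N by simp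
      finally show "norm (integral {- (\<delta> * N)..\<delta> * N} ?F - (\<Sum>m\<le>M. kernel_moment \<beta> \<mu> (?P m) x / of_real N ^ m))
         \<le> C4 / N ^ Suc M * exp (- c4 * \<bar>x\<bar> powr p)"
        unfolding fL A_def \<omega>_def by simp
    qed
  qed (use \<rho> in auto)
qed

text \<open>Here \<bar>l\<bar> \<le> L n enters: it bounds \<bar>l - \<alpha> n\<bar> by a multiple
  of n = N ^ (2\<mu>), and division by N leaves the exponent 2\<mu> - 1 that the contour shift
  needs.\<close>

lemma scaled_distance_bound:
  fixes n :: nat and l :: int
  assumes m: "\<mu> \<ge> 1" and n: "n \<ge> 1" and l: "\<bar>l\<bar> \<le> int L * int n"
  defines "N \<equiv> real n powr (1 / (2 * real \<mu>))"
  shows "N \<ge> 1" "N ^ (2 * \<mu>) = real n"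
    "\<bar>(real_of_int l - \<alpha> * real n) / N\<bar> \<le> (real L + \<bar>\<alpha>\<bar>) * N ^ (2 * \<mu> - 1)"
    "\<And>i. real n powr ((real i + 1) / (2 * real \<mu>)) = N ^ Suc i"
    "\<And>i. real n powr ((real i + 2) / (2 * real \<mu>)) = N ^ Suc (Suc i)"
proof -
  show N: "N \<ge> 1" unfolding N_def using n by (intro ge_one_powr_ge_zero) auto
  have Np: "N ^ i = real n powr (real i / (2 * real \<mu>))" for i
    using n N by (simp add: N_def powr_powr flip: powr_realpow)
  show Nn: "N ^ (2 * \<mu>) = real n" unfolding Np using m n by simp
  show "real n powr ((real i + 1) / (2 * real \<mu>)) = N ^ Suc i" for i unfolding Np by (simp add: add.commute)
  show "real n powr ((real i + 2) / (2 * real \<mu>)) = N ^ Suc (Suc i)" for i unfolding Np by (simp add: add.commute)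
  have "real_of_int \<bar>l\<bar> \<le> real_of_int (int L * int n)" using l by (subst of_int_le_iff)
  then have "\<bar>real_of_int l\<bar> \<le> real L * real n" by simp
  moreover have "\<bar>\<alpha> * real n\<bar> = \<bar>\<alpha>\<bar> * real n" by (simp add: abs_mult)
  ultimately have "\<bar>real_of_int l - \<alpha> * real n\<bar> \<le> (real L + \<bar>\<alpha>\<bar>) * real n"
    using abs_triangle_ineq4[of "real_of_int l" "\<alpha> * real n"] by (simp add: distrib_right)
  also have "(real L + \<bar>\<alpha>\<bar>) * real n = (real L + \<bar>\<alpha>\<bar>) * N ^ (2 * \<mu> - 1) * N"
    unfolding Nn[symmetric] using m by (simp add: power_eq_if)
  finally show "\<bar>(real_of_int l - \<alpha> * real n) / N\<bar> \<le> (real L + \<bar>\<alpha>\<bar>) * N ^ (2 * \<mu> - 1)"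
    using N by (simp add: abs_divide divide_le_eq)
qed

lemma integral_rescale_arc:
  fixes f :: "real \<Rightarrow> complex"
  assumes f: "continuous_on {\<theta> - \<delta>..\<theta> + \<delta>} f" and N: "N > 0" and d: "\<delta> > 0"
  shows "integral {\<theta> - \<delta>..\<theta> + \<delta>} f = integral {- (\<delta> * N)..\<delta> * N} (\<lambda>t. f (\<theta> + t / N)) / of_real N"
proof -
  have "(f has_integral integral {\<theta> - \<delta>..\<theta> + \<delta>} f) (cbox (\<theta> - \<delta>) (\<theta> + \<delta>))"
    using f by (simp add: integrable_continuous_interval integrable_integral)
  from has_integral_affinity[OF this, of "1 / N" \<theta>] N
  have "((\<lambda>t. f (t / N + \<theta>)) has_integral of_real N * integral {\<theta> - \<delta>..\<theta> + \<delta>} f)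
      ((\<lambda>x. N * x - N * \<theta>) ` {\<theta> - \<delta>..\<theta> + \<delta>})"
    by (simp add: scaleR_conv_of_real)
  also have "(\<lambda>x. N * x - N * \<theta>) ` {\<theta> - \<delta>..\<theta> + \<delta>} = {- (\<delta> * N)..\<delta> * N}"
    using N d image_affinity_atLeastAtMost_diff[of N "N * \<theta>" "\<theta> - \<delta>" "\<theta> + \<delta>"] by (simp add: algebra_simps)
  finally show ?thesis using N by (simp add: integral_unique add.commute)
qed

text \<open>Substituting t = \<theta> + s / N turns the arc integral into the rescaled one of
  \<open>saddle_point_estimate\<close>, up to a factor of modulus 1 and the Jacobian 1 / N; the
  latter raises the error from N ^ -(M+1) to N ^ -(M+2). The claim covers every \<delta> up to
  \<delta>0 because one common half-width must later be chosen for all arcs.\<close>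

lemma arc_estimate:
  fixes a :: "int \<Rightarrow> complex" and L :: nat and \<theta> :: real
  defines "\<kappa> \<equiv> exp (\<i> * of_real \<theta>)"
  assumes A1: "assumption_A1 a" and Fk: "norm (symbol a \<kappa>) = 1" and b: "Re \<beta> > 0" and m: "\<mu> \<ge> 1"
    and r: "r \<in> O[at 0](\<lambda>\<xi>. \<xi> ^ (2 * \<mu> + 1))"
    and sym: "\<forall>\<^sub>F \<xi> in at 0. symbol a (\<kappa> * exp (\<i> * \<xi>)) =
              symbol a \<kappa> * exp (\<i> * of_real \<alpha> * \<xi> - \<beta> * \<xi> ^ (2 * \<mu>) + r \<xi>)"
  shows "\<exists>\<delta>0>0. \<forall>\<delta> M. 0 < \<delta> \<and> \<delta> \<le> \<delta>0 \<longrightarrow> (\<exists>C c. C > 0 \<and> c > 0 \<and>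
    (\<forall>(n::nat) (l::int). n \<ge> 1 \<and> \<bar>l\<bar> \<le> int L * int n \<longrightarrow>
      norm (1 / (2 * of_real pi) * integral {\<theta> - \<delta>..\<theta> + \<delta>}
              (\<lambda>t. symbol a (exp (\<i> * of_real t)) ^ n * exp (- \<i> * of_int l * of_real t))
        - (\<Sum>i\<le>M. \<kappa> powi (- l) * symbol a \<kappa> ^ n / of_real (real n powr ((real i + 1) / (2 * real \<mu>))) *
            poly_neg_deriv (expansion_poly (cumulant a \<kappa> \<alpha> \<beta> \<mu>) \<mu> i) (H_fun \<beta> \<mu>)
              ((real_of_int l - \<alpha> * real n) / real n powr (1 / (2 * real \<mu>)))))
      \<le> C * (1 / real n powr ((real M + 2) / (2 * real \<mu>)) *
             exp (- c * (\<bar>real_of_int l - \<alpha> * real n\<bar> / real n powr (1 / (2 * real \<mu>)))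
                          powr (2 * real \<mu> / (2 * real \<mu> - 1))))))"
proof -
  let ?P = "expansion_poly (cumulant a \<kappa> \<alpha> \<beta> \<mu>) \<mu>"
  have nk: "norm \<kappa> = 1" by (simp add: \<kappa>_def)
  have Fk0: "symbol a \<kappa> \<noteq> 0" using Fk by auto
  obtain g \<rho> where \<rho>: "\<rho> > 0" and g: "g holomorphic_on ball 0 \<rho>"
    and gF: "g has_fps_expansion Abs_fps (\<lambda>\<nu>. if \<nu> = 0 then 0
       else cumulant a \<kappa> \<alpha> \<beta> \<mu> (2 * \<mu> + \<nu>) / fact (2 * \<mu> + \<nu>))"
    and ge: "\<And>\<xi>. norm \<xi> < \<rho> \<Longrightarrow> symbol a (\<kappa> * exp (\<i> * \<xi>)) = symbol a \<kappa> *
       exp (\<i> * of_real \<alpha> * \<xi> - \<beta> * \<xi> ^ (2 * \<mu>) + (\<i> * \<xi>) ^ (2 * \<mu>) * g (\<i> * \<xi>))"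
    using symbol_cumulant_expansion[OF A1 nk Fk0 m r sym] by blast
  define B where "B = real L + \<bar>\<alpha>\<bar>"
  have B: "B \<ge> 0" by (simp add: B_def)
  obtain \<delta>1 where \<delta>1: "\<delta>1 > 0" and est: "\<And>\<delta> M. 0 < \<delta> \<Longrightarrow> \<delta> \<le> \<delta>1 \<Longrightarrow> \<exists>C c. C > 0 \<and> c > 0 \<and>
    (\<forall>N x. N \<ge> 1 \<longrightarrow> \<bar>x\<bar> \<le> B * N ^ (2 * \<mu> - 1) \<longrightarrow>
      norm (integral {- (\<delta> * N)..\<delta> * N} (\<lambda>\<theta>. osc_kernel \<beta> \<mu> x \<theta> * exp ((\<i> * of_real \<theta>) ^ (2 * \<mu>) * g (\<i> * of_real \<theta> / of_real N)))
        - (\<Sum>m\<le>M. kernel_moment \<beta> \<mu> (?P m) x / of_real N ^ m))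
      \<le> C / N ^ Suc M * exp (- c * \<bar>x\<bar> powr (2 * real \<mu> / (2 * real \<mu> - 1))))"
    using saddle_point_estimate[OF b m \<rho> g gF B] by blast
  have an: "(\<lambda>l. norm (a l)) summable_on UNIV" using A1 by (simp add: assumption_A1_def)
  show ?thesis
  proof (rule exI[of _ "min \<delta>1 (\<rho> / 2)"], intro conjI allI impI)
    fix \<delta> M assume "0 < \<delta> \<and> \<delta> \<le> min \<delta>1 (\<rho> / 2)"
    then have \<delta>: "0 < \<delta>" "\<delta> \<le> min \<delta>1 (\<rho> / 2)" by auto
    then obtain C c where C: "C > 0" and c: "c > 0" and Cc: "\<And>N x. N \<ge> 1 \<Longrightarrow> \<bar>x\<bar> \<le> B * N ^ (2 * \<mu> - 1) \<Longrightarrow>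
      norm (integral {- (\<delta> * N)..\<delta> * N} (\<lambda>\<theta>. osc_kernel \<beta> \<mu> x \<theta> * exp ((\<i> * of_real \<theta>) ^ (2 * \<mu>) * g (\<i> * of_real \<theta> / of_real N)))
        - (\<Sum>m\<le>M. kernel_moment \<beta> \<mu> (?P m) x / of_real N ^ m))
      \<le> C / N ^ Suc M * exp (- c * \<bar>x\<bar> powr (2 * real \<mu> / (2 * real \<mu> - 1)))"
      using est[of \<delta> M] by auto
    show "\<exists>C c. C > 0 \<and> c > 0 \<and>
    (\<forall>(n::nat) (l::int). n \<ge> 1 \<and> \<bar>l\<bar> \<le> int L * int n \<longrightarrow>
      norm (1 / (2 * of_real pi) * integral {\<theta> - \<delta>..\<theta> + \<delta>}
              (\<lambda>t. symbol a (exp (\<i> * of_real t)) ^ n * exp (- \<i> * of_int l * of_real t))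
        - (\<Sum>i\<le>M. \<kappa> powi (- l) * symbol a \<kappa> ^ n / of_real (real n powr ((real i + 1) / (2 * real \<mu>))) *
            poly_neg_deriv (?P i) (H_fun \<beta> \<mu>)
              ((real_of_int l - \<alpha> * real n) / real n powr (1 / (2 * real \<mu>)))))
      \<le> C * (1 / real n powr ((real M + 2) / (2 * real \<mu>)) *
             exp (- c * (\<bar>real_of_int l - \<alpha> * real n\<bar> / real n powr (1 / (2 * real \<mu>)))
                          powr (2 * real \<mu> / (2 * real \<mu> - 1)))))"
    proof (rule exI[of _ C], rule exI[of _ c], intro conjI C c allI impI)
      fix n :: nat and l :: int assume nl: "n \<ge> 1 \<and> \<bar>l\<bar> \<le> int L * int n"
      define N where "N = real n powr (1 / (2 * real \<mu>))"
      define x where "x = (real_of_int l - \<alpha> * real n) / N"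
      note sc = scaled_distance_bound[OF m nl[THEN conjunct1] nl[THEN conjunct2], folded N_def]
      have N: "N \<ge> 1" and Nn: "N ^ (2 * \<mu>) = real n" and xB: "\<bar>x\<bar> \<le> B * N ^ (2 * \<mu> - 1)"
        using sc(1,2) sc(3)[of \<alpha>] by (auto simp: x_def B_def)
      have xa: "\<bar>real_of_int l - \<alpha> * real n\<bar> / N = \<bar>x\<bar>" using N by (simp add: x_def abs_divide)
      define w where "w = \<kappa> powi (- l) * symbol a \<kappa> ^ n"
      have w: "norm w = 1" by (simp add: w_def norm_mult norm_power_int norm_power nk Fk)
      let ?G = "\<lambda>t::real. symbol a (exp (\<i> * of_real t)) ^ n * exp (- \<i> * of_int l * of_real t)"
      let ?K = "\<lambda>t. osc_kernel \<beta> \<mu> x t * exp ((\<i> * of_real t) ^ (2 * \<mu>) * g (\<i> * of_real t / of_real N))"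
      \<comment> \<open>The drift term n \<i> \<alpha> \<xi> and the Fourier factor - \<i> l \<xi>
        combine to - \<i> x t, which is why x is centred at \<alpha> n; N ^ (2\<mu>) = n removes n
        from the leading term.\<close>
      have pt: "?G (\<theta> + t / N) = w * ?K t" if t: "t \<in> {- (\<delta> * N)..\<delta> * N}" for t
      proof -
        define \<xi> where "\<xi> = (of_real t / of_real N :: complex)"
        have "\<bar>t\<bar> \<le> \<delta> * N" using t by auto
        also have "\<delta> * N < \<rho> * N" using \<delta> \<rho> N by (intro mult_strict_right_mono) auto
        finally have \<xi>: "norm \<xi> < \<rho>" using N by (simp add: \<xi>_def norm_divide divide_less_eq)
        have tN: "of_real t = \<xi> * of_real N" using N by (simp add: \<xi>_def)
        have Nn': "of_real N ^ (2 * \<mu>) = (of_nat n :: complex)"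
          using arg_cong[OF Nn, of complex_of_real] by simp
        have xN: "of_real x * of_real N = (of_int l - of_real \<alpha> * of_nat n :: complex)"
          using N by (simp add: x_def)
        have "exp (\<i> * of_real (\<theta> + t / N)) = \<kappa> * exp (\<i> * \<xi>)"
          by (simp add: \<kappa>_def \<xi>_def exp_add[symmetric] distrib_left)
        then have E1: "symbol a (exp (\<i> * of_real (\<theta> + t / N))) ^ n = symbol a \<kappa> ^ n *
            exp (of_nat n * (\<i> * of_real \<alpha> * \<xi> - \<beta> * \<xi> ^ (2 * \<mu>) + (\<i> * \<xi>) ^ (2 * \<mu>) * g (\<i> * \<xi>)))"
          by (simp add: ge[OF \<xi>] power_mult_distrib exp_of_nat_mult)
        have E2: "exp (- \<i> * of_int l * of_real (\<theta> + t / N)) = \<kappa> powi (- l) * exp (- \<i> * of_int l * \<xi>)"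
          by (simp add: \<kappa>_def \<xi>_def exp_power_int exp_add[symmetric] exp_minus[symmetric] algebra_simps)
        have E3: "of_nat n * (\<i> * of_real \<alpha> * \<xi> - \<beta> * \<xi> ^ (2 * \<mu>) + (\<i> * \<xi>) ^ (2 * \<mu>) * g (\<i> * \<xi>)) + - \<i> * of_int l * \<xi>
           = - \<i> * of_real x * of_real t + - \<beta> * of_real t ^ (2 * \<mu>) + (\<i> * of_real t) ^ (2 * \<mu>) * g (\<i> * of_real t / of_real N)"
        proof -
          have "- \<i> * of_real x * of_real t = - \<i> * (of_real x * of_real N) * \<xi>" by (simp add: tN)
          also have "\<dots> = of_nat n * (\<i> * of_real \<alpha> * \<xi>) + - \<i> * of_int l * \<xi>" unfolding xN by (simp add: algebra_simps)
          finally have 1: "- \<i> * of_real x * of_real t = of_nat n * (\<i> * of_real \<alpha> * \<xi>) + - \<i> * of_int l * \<xi>" .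
          have 2: "of_real t ^ (2 * \<mu>) = of_nat n * \<xi> ^ (2 * \<mu>)"
            unfolding tN power_mult_distrib Nn' by simp
          have 3: "(\<i> * of_real t) ^ (2 * \<mu>) = of_nat n * (\<i> * \<xi>) ^ (2 * \<mu>)"
            unfolding power_mult_distrib[of \<i>] 2 by (simp only: mult_ac)
          have 4: "\<i> * of_real t / of_real N = \<i> * \<xi>" by (simp add: \<xi>_def)
          show ?thesis unfolding 1 2 3 4 by (simp add: algebra_simps)
        qed
        have "A * u * (B * v) = B * A * (u * v)" for A B u v :: complex by (simp only: mult_ac)
        then show ?thesis
          unfolding E1 E2 w_def osc_kernel_def by (simp only: exp_add[symmetric] E3)
      qed
      have "integral {\<theta> - \<delta>..\<theta> + \<delta>} ?G = integral {- (\<delta> * N)..\<delta> * N} (\<lambda>t. ?G (\<theta> + t / N)) / of_real N"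
        using \<delta> N by (intro integral_rescale_arc continuous_intros continuous_on_symbol_circle[OF an]) auto
      also have "integral {- (\<delta> * N)..\<delta> * N} (\<lambda>t. ?G (\<theta> + t / N)) = integral {- (\<delta> * N)..\<delta> * N} (\<lambda>t. w * ?K t)"
        by (intro Henstock_Kurzweil_Integration.integral_cong pt)
      also have "\<dots> = w * integral {- (\<delta> * N)..\<delta> * N} ?K" by simp
      finally have I: "1 / (2 * of_real pi) * integral {\<theta> - \<delta>..\<theta> + \<delta>} ?G
          = w / (2 * of_real pi * of_real N) * integral {- (\<delta> * N)..\<delta> * N} ?K" by simp
      have S: "(\<Sum>i\<le>M. \<kappa> powi (- l) * symbol a \<kappa> ^ n / of_real (real n powr ((real i + 1) / (2 * real \<mu>))) *
            poly_neg_deriv (?P i) (H_fun \<beta> \<mu>) ((real_of_int l - \<alpha> * real n) / N))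
         = w / (2 * of_real pi * of_real N) * (\<Sum>i\<le>M. kernel_moment \<beta> \<mu> (?P i) x / of_real N ^ i)"
        unfolding sum_distrib_left
        by (intro sum.cong refl) (simp add: sc(4) poly_neg_deriv_H_fun[OF b m] x_def w_def)
      have "norm (w / (2 * of_real pi * of_real N) * integral {- (\<delta> * N)..\<delta> * N} ?K
          - w / (2 * of_real pi * of_real N) * (\<Sum>i\<le>M. kernel_moment \<beta> \<mu> (?P i) x / of_real N ^ i))
        = 1 / (2 * pi * N) * norm (integral {- (\<delta> * N)..\<delta> * N} ?K - (\<Sum>i\<le>M. kernel_moment \<beta> \<mu> (?P i) x / of_real N ^ i))"
        unfolding right_diff_distrib[symmetric] norm_mult using N by (simp add: norm_divide norm_mult w)
      also have "\<dots> \<le> 1 / (2 * pi * N) * (C / N ^ Suc M * exp (- c * \<bar>x\<bar> powr (2 * real \<mu> / (2 * real \<mu> - 1))))"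
        using N by (intro mult_left_mono Cc xB) auto
      also have "\<dots> \<le> 1 / N * (C / N ^ Suc M * exp (- c * \<bar>x\<bar> powr (2 * real \<mu> / (2 * real \<mu> - 1))))"
      proof (rule mult_right_mono)
        have "1 * N \<le> 2 * pi * N" using N pi_gt3 by (intro mult_right_mono) auto
        then show "1 / (2 * pi * N) \<le> 1 / N" using N by (intro divide_left_mono) auto
      qed (use C N in auto)
      also have "\<dots> = C * (1 / N ^ Suc (Suc M) * exp (- c * \<bar>x\<bar> powr (2 * real \<mu> / (2 * real \<mu> - 1))))"
        by simp
      finally show "norm (1 / (2 * of_real pi) * integral {\<theta> - \<delta>..\<theta> + \<delta>} ?G
        - (\<Sum>i\<le>M. \<kappa> powi (- l) * symbol a \<kappa> ^ n / of_real (real n powr ((real i + 1) / (2 * real \<mu>))) *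
            poly_neg_deriv (?P i) (H_fun \<beta> \<mu>)
              ((real_of_int l - \<alpha> * real n) / real n powr (1 / (2 * real \<mu>)))))
      \<le> C * (1 / real n powr ((real M + 2) / (2 * real \<mu>)) *
             exp (- c * (\<bar>real_of_int l - \<alpha> * real n\<bar> / real n powr (1 / (2 * real \<mu>)))
                          powr (2 * real \<mu> / (2 * real \<mu> - 1))))"
        unfolding N_def[symmetric] I S sc(5) xa .
    qed
  qed (use \<delta>1 \<rho> in auto)
qed

section \<open>Assembling the arcs\<close>

lemma eventually_at_right_le_pos:
  assumes "(d::real) > 0" shows "\<forall>\<^sub>F x in at_right 0. 0 < x \<and> x \<le> d"
  using eventually_at_right_real[OF assms] by eventually_elim auto

text \<open>Open arcs are removed instead of closed ones, so that the rest is compact and the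
  modulus attains its maximum there; this set contains the one in the conclusion.\<close>

lemma uniform_bound_off_arcs:
  fixes F :: "real \<Rightarrow> complex"
  assumes F: "continuous_on {b..b + 2 * pi} F" and d: "\<delta> > 0"
    and lt: "\<And>t. t \<in> {b..b + 2 * pi} \<Longrightarrow> t \<notin> \<theta> ` I \<Longrightarrow> norm (F t) < 1"
  obtains q where "0 < q" "q < 1"
    "\<And>t. t \<in> {b..b + 2 * pi} - (\<Union>k\<in>I. {\<theta> k - \<delta>..\<theta> k + \<delta>}) \<Longrightarrow> norm (F t) \<le> q"
proof -
  define S where "S = {b..b + 2 * pi} - (\<Union>k\<in>I. {\<theta> k - \<delta><..<\<theta> k + \<delta>})"
  have S: "compact S" unfolding S_def by (intro compact_diff open_UN) auto
  have cS: "continuous_on S (\<lambda>t. norm (F t))"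
    by (intro continuous_on_norm continuous_on_subset[OF F]) (auto simp: S_def)
  have ltS: "norm (F t) < 1" if "t \<in> S" for t
  proof (rule lt)
    show "t \<in> {b..b + 2 * pi}" using that by (auto simp: S_def)
    show "t \<notin> \<theta> ` I"
    proof
      assume "t \<in> \<theta> ` I"
      then obtain k where "k \<in> I" "t = \<theta> k" by blast
      then have "t \<in> {\<theta> k - \<delta><..<\<theta> k + \<delta>}" using d by auto
      then show False using that \<open>k \<in> I\<close> by (auto simp: S_def)
    qed
  qed
  obtain q where q: "q < 1" "\<And>t. t \<in> S \<Longrightarrow> norm (F t) \<le> q"
  proof (cases "S = {}")
    case False
    obtain t0 where "t0 \<in> S" "\<forall>t\<in>S. norm (F t) \<le> norm (F t0)"
      using continuous_attains_sup[OF S False cS] by blast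
    then show ?thesis using that[of "norm (F t0)"] ltS by auto
  qed (use that[of 0] in auto)
  show ?thesis
  \<comment> \<open>The value 1/2 makes \<open>q\<close> positive, so that q ^ n can be written with
    the rate - ln q.\<close>
  proof (rule that[of "max q (1 / 2)"])
    fix t assume "t \<in> {b..b + 2 * pi} - (\<Union>k\<in>I. {\<theta> k - \<delta>..\<theta> k + \<delta>})"
    moreover have "(\<Union>k\<in>I. {\<theta> k - \<delta><..<\<theta> k + \<delta>}) \<subseteq> (\<Union>k\<in>I. {\<theta> k - \<delta>..\<theta> k + \<delta>})"
      by (intro UN_mono greaterThanLessThan_subseteq_atLeastAtMost_iff[THEN iffD2]) auto
    ultimately have "t \<in> S" unfolding S_def by blast
    then show "norm (F t) \<le> max q (1 / 2)" using q by (auto intro: max.coboundedI1)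
  qed (use q in auto)
qed

lemma integral_minus_arcs_bound:
  fixes G :: "real \<Rightarrow> complex"
  assumes G: "continuous_on {b..c} G" and bc: "b \<le> c" and fin: "finite I"
    and sub: "\<And>k. k \<in> I \<Longrightarrow> {\<theta> k - \<delta>..\<theta> k + \<delta>} \<subseteq> {b..c}"
    and disj: "\<And>j k. j \<in> I \<Longrightarrow> k \<in> I \<Longrightarrow> j \<noteq> k \<Longrightarrow> {\<theta> j - \<delta>..\<theta> j + \<delta>} \<inter> {\<theta> k - \<delta>..\<theta> k + \<delta>} = {}"
    and bd: "\<And>t. t \<in> {b..c} - (\<Union>k\<in>I. {\<theta> k - \<delta>..\<theta> k + \<delta>}) \<Longrightarrow> norm (G t) \<le> B" and B: "B \<ge> 0"
  shows "norm (integral {b..c} G - (\<Sum>k\<in>I. integral {\<theta> k - \<delta>..\<theta> k + \<delta>} G)) \<le> B * (c - b)"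
proof -
  let ?A = "\<lambda>k. {\<theta> k - \<delta>..\<theta> k + \<delta>}"
  \<comment> \<open>Stated for any continuous integrand because it serves both for \<open>G\<close>
    and for the constant bound, whose integrability on the remaining set is needed as well.\<close>
  have split: "(f has_integral (integral {b..c} f - (\<Sum>k\<in>I. integral (?A k) f))) ({b..c} - (\<Union>k\<in>I. ?A k))"
    if f: "continuous_on {b..c} f" for f :: "real \<Rightarrow> 'b::euclidean_space"
  proof (rule has_integral_setdiff)
    show "(f has_integral integral {b..c} f) {b..c}"
      using f by (intro integrable_integral integrable_continuous_interval)
    show "(f has_integral (\<Sum>k\<in>I. integral (?A k) f)) (\<Union>k\<in>I. ?A k)"
    proof (rule has_integral_UN[OF fin])
      fix k assume "k \<in> I"
      then show "(f has_integral integral (?A k) f) (?A k)"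
        using sub by (intro integrable_integral integrable_continuous_interval continuous_on_subset[OF f])
    next
      show "pairwise (\<lambda>j k. negligible (?A j \<inter> ?A k)) I"
        using disj by (auto simp: pairwise_def)
    qed
    have "(\<Union>k\<in>I. ?A k) - {b..c} = {}" using sub by blast
    then show "negligible ((\<Union>k\<in>I. ?A k) - {b..c})" by (simp only: negligible_empty)
  qed
  let ?R = "{b..c} - (\<Union>k\<in>I. ?A k)"
  have "norm (integral {b..c} G - (\<Sum>k\<in>I. integral (?A k) G)) = norm (integral ?R G)"
    using split[OF G] by (simp add: integral_unique)
  also have "\<dots> \<le> integral ?R (\<lambda>t. B)"
  proof (rule integral_norm_bound_integral)
    show "G integrable_on ?R" using split[OF G] by blast
    show "(\<lambda>t. B) integrable_on ?R" using split[OF continuous_on_const] by blast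
  qed (rule bd)
  also have "\<dots> \<le> integral {b..c} (\<lambda>t. B)"
  proof (rule integral_subset_le)
    show "(\<lambda>t. B) integrable_on ?R" using split[OF continuous_on_const] by blast
  qed (use B in auto)
  also have "\<dots> = B * (c - b)" using bc by simp
  finally show ?thesis .
qed

lemma poly_neg_deriv_1: "poly_neg_deriv 1 f = f"
  by (simp add: fun_eq_iff poly_neg_deriv_def nth_vector_derivative_def)

text \<open>The error of each arc goes into its own summand on the right. The contribution off the
  arcs belongs to no particular point and is charged to the summand k = 1, which exists since K
  \<ge> 1.\<close>

lemma local_limit_expansion:
  fixes a :: "int \<Rightarrow> complex" and K :: nat and \<kappa> :: "nat \<Rightarrow> complex"
    and \<alpha> :: "nat \<Rightarrow> real" and \<beta> :: "nat \<Rightarrow> complex" and \<mu> :: "nat \<Rightarrow> nat" and L M :: nat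
  defines "P \<equiv> \<lambda>k. expansion_poly (cumulant a (\<kappa> k) (\<alpha> k) (\<beta> k) (\<mu> k)) (\<mu> k)"
  assumes A1: "assumption_A1 a" and A2: "assumption_A2 a K \<kappa> \<alpha> \<beta> \<mu>"
  shows "\<exists>C c. C > 0 \<and> c > 0 \<and>
    (\<forall>(n::nat) (l::int). n \<ge> 1 \<and> \<bar>l\<bar> \<le> int L * int n \<longrightarrow>
      norm (conv_power a n l - (\<Sum>k=1..K. \<Sum>i\<le>M.
          \<kappa> k powi (- l) * symbol a (\<kappa> k) ^ n / of_real (real n powr ((real i + 1) / (2 * real (\<mu> k)))) *
          poly_neg_deriv (P k i) (H_fun (\<beta> k) (\<mu> k))
            ((real_of_int l - \<alpha> k * real n) / real n powr (1 / (2 * real (\<mu> k))))))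
      \<le> C * (\<Sum>k=1..K. 1 / real n powr ((real M + 2) / (2 * real (\<mu> k))) *
               exp (- c * (\<bar>real_of_int l - \<alpha> k * real n\<bar> / real n powr (1 / (2 * real (\<mu> k))))
                            powr (2 * real (\<mu> k) / (2 * real (\<mu> k) - 1)))))"
proof -
  let ?I = "{1..K}"
  have K: "K \<ge> 1" and inj: "inj_on \<kappa> ?I" and sub: "\<kappa> ` ?I \<subseteq> sphere 0 1"
    and F1: "\<And>k. k \<in> ?I \<Longrightarrow> norm (symbol a (\<kappa> k)) = 1"
    and F2: "\<And>z. z \<in> sphere 0 1 - \<kappa> ` ?I \<Longrightarrow> norm (symbol a z) < 1"
    and loc: "\<And>k. k \<in> ?I \<Longrightarrow> Re (\<beta> k) > 0 \<and> \<mu> k \<ge> 1 \<and>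
        (\<exists>r :: complex \<Rightarrow> complex. r \<in> O[at 0](\<lambda>\<xi>. \<xi> ^ (2 * \<mu> k + 1)) \<and>
           (\<forall>\<^sub>F \<xi> in at 0. symbol a (\<kappa> k * exp (\<i> * \<xi>)) =
              symbol a (\<kappa> k) * exp (\<i> * of_real (\<alpha> k) * \<xi> - \<beta> k * \<xi> ^ (2 * \<mu> k) + r \<xi>)))"
    using A2 unfolding assumption_A2_def by blast+
  have \<kappa>: "norm (\<kappa> k) = 1" if "k \<in> ?I" for k
    using subsetD[OF sub imageI[OF that]] by simp
  have Flt: "norm (symbol a z) < 1" if "norm z = 1" "z \<notin> \<kappa> ` ?I" for z
    using that by (intro F2) simp
  have an: "(\<lambda>l. norm (a l)) summable_on UNIV" using A1 by (simp add: assumption_A1_def)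
  define \<theta> where "\<theta> = (\<lambda>k. Arg2pi (\<kappa> k))"
  have th: "0 \<le> \<theta> k" "\<theta> k < 2 * pi" for k by (auto simp: \<theta>_def Arg2pi_ge_0 Arg2pi_lt_2pi)
  have \<kappa>\<theta>: "\<kappa> k = exp (\<i> * of_real (\<theta> k))" if "k \<in> ?I" for k
    using Arg2pi_eq[of "\<kappa> k"] \<kappa>[OF that] by (simp add: \<theta>_def)
  define \<Theta> where "\<Theta> = Max (\<theta> ` ?I)"
  have Th: "\<Theta> < 2 * pi" "\<And>k. k \<in> ?I \<Longrightarrow> \<theta> k \<le> \<Theta>"
    using K th by (auto simp: \<Theta>_def)
  \<comment> \<open>cutting the circle at \<open>b\<close> keeps every \<open>\<theta> k\<close> in the interior of the interval of integration\<close>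
  define b where "b = (\<Theta> - 2 * pi) / 2"
  have bth: "b < \<theta> k" "\<theta> k < b + 2 * pi" if "k \<in> ?I" for k
    using Th(1) Th(2)[OF that] th[of k] by (auto simp: b_def field_simps)
  let ?E = "\<lambda>k M (n::nat) (l::int) c. 1 / real n powr ((real M + 2) / (2 * real (\<mu> k))) *
               exp (- c * (\<bar>real_of_int l - \<alpha> k * real n\<bar> / real n powr (1 / (2 * real (\<mu> k))))
                            powr (2 * real (\<mu> k) / (2 * real (\<mu> k) - 1)))"
  let ?G = "\<lambda>(n::nat) (l::int) (t::real). symbol a (exp (\<i> * of_real t)) ^ n * exp (- \<i> * of_int l * of_real t)"
  let ?T = "\<lambda>k (n::nat) (l::int) i. \<kappa> k powi (- l) * symbol a (\<kappa> k) ^ n / of_real (real n powr ((real i + 1) / (2 * real (\<mu> k)))) *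
          poly_neg_deriv (P k i) (H_fun (\<beta> k) (\<mu> k))
            ((real_of_int l - \<alpha> k * real n) / real n powr (1 / (2 * real (\<mu> k))))"
  define Q where "Q = (\<lambda>k \<delta> C c. \<forall>(n::nat) (l::int). n \<ge> 1 \<and> \<bar>l\<bar> \<le> int L * int n \<longrightarrow>
      norm (1 / (2 * of_real pi) * integral {\<theta> k - \<delta>..\<theta> k + \<delta>} (?G n l) - (\<Sum>i\<le>M. ?T k n l i)) \<le> C * ?E k M n l c)"
  have "\<exists>\<delta>0>0. \<forall>\<delta>. 0 < \<delta> \<and> \<delta> \<le> \<delta>0 \<longrightarrow> (\<exists>C c. C > 0 \<and> c > 0 \<and> Q k \<delta> C c)" if k: "k \<in> ?I" for k
  proof -
    obtain r where r: "r \<in> O[at 0](\<lambda>\<xi>. \<xi> ^ (2 * \<mu> k + 1))"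
      and sym: "\<forall>\<^sub>F \<xi> in at 0. symbol a (\<kappa> k * exp (\<i> * \<xi>)) =
              symbol a (\<kappa> k) * exp (\<i> * of_real (\<alpha> k) * \<xi> - \<beta> k * \<xi> ^ (2 * \<mu> k) + r \<xi>)"
      using loc[OF k] by blast
    have "Re (\<beta> k) > 0" "\<mu> k \<ge> 1" using loc[OF k] by blast+
    from arc_estimate[OF A1, of "\<theta> k", folded \<kappa>\<theta>[OF k], OF F1[OF k] this r sym, of L]
    show ?thesis unfolding Q_def P_def by blast
  qed
  then obtain \<delta>0 where \<delta>0: "\<And>k. k \<in> ?I \<Longrightarrow> \<delta>0 k > 0" and arc: "\<And>k \<delta>. k \<in> ?I \<Longrightarrow> 0 < \<delta> \<Longrightarrow> \<delta> \<le> \<delta>0 k \<Longrightarrow>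
      \<exists>C c. C > 0 \<and> c > 0 \<and> Q k \<delta> C c"
    by metis
  have \<theta>inj: "\<theta> j \<noteq> \<theta> k" if "j \<in> ?I" "k \<in> ?I" "j \<noteq> k" for j k
    using \<kappa>\<theta>[OF that(1)] \<kappa>\<theta>[OF that(2)] inj_onD[OF inj _ that(1,2)] that(3) by auto
  have "\<forall>\<^sub>F \<delta> in at_right 0. \<forall>k\<in>?I. 0 < \<delta> \<and> \<delta> \<le> min (\<delta>0 k) (min (\<theta> k - b) (b + 2 * pi - \<theta> k))"
    using \<delta>0 bth by (intro eventually_ball_finite ballI eventually_at_right_le_pos) auto
  \<comment> \<open>A third of every distance suffices for disjoint closed arcs: two that meet have
    centres at distance at most 2 \<delta>.\<close>
  moreover have "\<forall>\<^sub>F \<delta> in at_right 0. \<forall>p\<in>{p \<in> ?I \<times> ?I. fst p \<noteq> snd p}. 0 < \<delta> \<and> \<delta> \<le> \<bar>\<theta> (fst p) - \<theta> (snd p)\<bar> / 3"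
  proof (rule eventually_ball_finite)
    show "finite {p \<in> ?I \<times> ?I. fst p \<noteq> snd p}" by (rule finite_subset[of _ "?I \<times> ?I"]) auto
    show "\<forall>p\<in>{p \<in> ?I \<times> ?I. fst p \<noteq> snd p}. \<forall>\<^sub>F \<delta> in at_right 0. 0 < \<delta> \<and> \<delta> \<le> \<bar>\<theta> (fst p) - \<theta> (snd p)\<bar> / 3"
      using \<theta>inj by (intro ballI eventually_at_right_le_pos) (auto simp: mem_Times_iff)
  qed
  ultimately obtain \<delta> where \<delta>1: "\<forall>k\<in>?I. 0 < \<delta> \<and> \<delta> \<le> min (\<delta>0 k) (min (\<theta> k - b) (b + 2 * pi - \<theta> k))"
      and \<delta>2: "\<forall>p\<in>{p \<in> ?I \<times> ?I. fst p \<noteq> snd p}. 0 < \<delta> \<and> \<delta> \<le> \<bar>\<theta> (fst p) - \<theta> (snd p)\<bar> / 3"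
    using eventually_happens'[OF trivial_limit_at_right_real eventually_conj] by blast
  have one: "1 \<in> ?I" using K by simp
  have \<delta>pos: "\<delta> > 0" using \<delta>1 one by blast
  have \<delta>a: "\<delta> \<le> \<delta>0 k" "\<delta> \<le> \<theta> k - b" "\<delta> \<le> b + 2 * pi - \<theta> k" if "k \<in> ?I" for k
    using bspec[OF \<delta>1 that] by simp_all
  have \<delta>b: "\<delta> \<le> \<bar>\<theta> j - \<theta> k\<bar> / 3" if "j \<in> ?I" "k \<in> ?I" "j \<noteq> k" for j k
    using bspec[OF \<delta>2, of "(j, k)"] that by simp
  have "\<exists>C c. C > 0 \<and> c > 0 \<and> Q k \<delta> C c" if "k \<in> ?I" for k
    using arc[OF that \<delta>pos \<delta>a(1)[OF that]] .
  then obtain CC cc where Cc: "\<And>k. k \<in> ?I \<Longrightarrow> CC k > 0" "\<And>k. k \<in> ?I \<Longrightarrow> cc k > 0"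
    and Q: "\<And>k. k \<in> ?I \<Longrightarrow> Q k \<delta> (CC k) (cc k)"
    by metis
  have Cce: "norm (1 / (2 * of_real pi) * integral {\<theta> k - \<delta>..\<theta> k + \<delta>} (?G n l) - (\<Sum>i\<le>M. ?T k n l i))
        \<le> CC k * ?E k M n l (cc k)" if "k \<in> ?I" "n \<ge> 1" "\<bar>l\<bar> \<le> int L * int n" for k n l
    using Q[OF that(1), unfolded Q_def, rule_format, OF conjI[OF that(2,3)]] .
  have lt: "norm (symbol a (exp (\<i> * of_real t))) < 1" if t: "t \<in> {b..b + 2 * pi}" "t \<notin> \<theta> ` ?I" for t
  proof (rule Flt)
    show "exp (\<i> * of_real t) \<notin> \<kappa> ` ?I"
    proof
      assume "exp (\<i> * of_real t) \<in> \<kappa> ` ?I"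
      then obtain k where k: "k \<in> ?I" "exp (\<i> * of_real t) = exp (\<i> * of_real (\<theta> k))" using \<kappa>\<theta> by auto
      then obtain j :: int where "\<i> * of_real t = \<i> * of_real (\<theta> k) + of_int (2 * j) * pi * \<i>"
        unfolding exp_eq by blast
      then have "t = \<theta> k + 2 * of_int j * pi" by (auto simp: complex_eq_iff)
      \<comment> \<open>\<open>\<theta> k\<close> is interior to the interval of length 2 pi, so
        even the two end points are less than a full turn away from it.\<close>
      moreover have "\<bar>t - \<theta> k\<bar> < 2 * pi" using t(1) bth[OF k(1)] by auto
      ultimately have "\<bar>of_int j * (2 * pi)\<bar> < 1 * (2 * pi)" by (simp add: mult_ac)
      then have "\<bar>real_of_int j\<bar> < 1" unfolding abs_mult by simp
      then have "j = 0" by linarith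
      then show False using \<open>t = _\<close> t(2) k(1) by auto
    qed
  qed simp
  obtain q where q: "0 < q" "q < 1" and qb: "\<And>t. t \<in> {b..b + 2 * pi} - (\<Union>k\<in>?I. {\<theta> k - \<delta>..\<theta> k + \<delta>}) \<Longrightarrow>
      norm (symbol a (exp (\<i> * of_real t))) \<le> q"
    using uniform_bound_off_arcs[OF continuous_on_symbol_circle[OF an] \<delta>pos lt] by blast
  define \<sigma> where "\<sigma> = - ln q"
  have \<sigma>: "\<sigma> > 0" using q by (simp add: \<sigma>_def)
  have m1: "\<mu> 1 \<ge> 1" using loc[OF one] by blast
  \<comment> \<open>Here q ^ n = exp (- \<sigma> n) with n = N ^ (2 \<mu> 1). The exponent M + 2 is
    requested at once, since no Jacobian 1 / N is left to contribute, in contrast to the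
    arcs.\<close>
  obtain C' c' where C': "C' > 0" and c': "c' > 0" and ab: "\<And>N x. N \<ge> 1 \<Longrightarrow> \<bar>x\<bar> \<le> (real L + \<bar>\<alpha> 1\<bar>) * N ^ (2 * \<mu> 1 - 1) \<Longrightarrow>
       N * exp (- \<sigma> * N ^ (2 * \<mu> 1)) \<le> C' / N ^ Suc (Suc M) * exp (- c' * \<bar>x\<bar> powr (2 * real (\<mu> 1) / (2 * real (\<mu> 1) - 1)))"
    using exp_neg_absorb[OF \<sigma> _ m1, of "real L + \<bar>\<alpha> 1\<bar>" "Suc (Suc M)"] by (metis abs_ge_zero add_nonneg_nonneg of_nat_0_le_iff)
  \<comment> \<open>Lowering the rate only enlarges the error terms, so the smallest of the finitely
    many rates serves for all of them.\<close>
  define c where "c = Min (insert c' (cc ` ?I))"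
  define C where "C = C' + (\<Sum>k\<in>?I. CC k)"
  have c: "c > 0" unfolding c_def using c' Cc(2) by (subst Min_gr_iff) auto
  have cc': "c \<le> c'" unfolding c_def by (intro Min_le) auto
  have cck: "c \<le> cc k" if "k \<in> ?I" for k unfolding c_def using that by (intro Min_le) auto
  have sC: "(\<Sum>k\<in>?I. CC k) \<ge> 0" using Cc(1) by (intro sum_nonneg less_imp_le)
  have C: "C > 0" using C' sC by (simp add: C_def)
  have E0: "?E k M n l d \<ge> 0" for k n l d by simp
  have Emono: "?E k M n l d \<le> ?E k M n l c" if "c \<le> d" for k n l d
    using that by (intro mult_left_mono) (auto intro!: mult_right_mono)
  have main: "norm (conv_power a n l - (\<Sum>k\<in>?I. \<Sum>i\<le>M. ?T k n l i)) \<le> C * (\<Sum>k\<in>?I. ?E k M n l c)"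
    if n: "n \<ge> 1" and l: "\<bar>l\<bar> \<le> int L * int n" for n l
  proof -
    let ?A = "\<lambda>k. {\<theta> k - \<delta>..\<theta> k + \<delta>}"
    let ?c = "1 / (2 * of_real pi) :: complex"
    define S where "S = (\<Sum>k\<in>?I. ?E k M n l c)"
    have ES: "?E k M n l c \<le> S" if "k \<in> ?I" for k
      unfolding S_def by (rule member_le_sum[OF that]) (use E0 in auto)
    have "norm (integral {b..b + 2 * pi} (?G n l) - (\<Sum>k\<in>?I. integral (?A k) (?G n l))) \<le> q ^ n * (b + 2 * pi - b)"
    proof (rule integral_minus_arcs_bound)
      show "continuous_on {b..b + 2 * pi} (?G n l)"
        by (intro continuous_intros continuous_on_symbol_circle[OF an])
      show "?A k \<subseteq> {b..b + 2 * pi}" if "k \<in> ?I" for k using \<delta>a[OF that] by auto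
      show "?A j \<inter> ?A k = {}" if "j \<in> ?I" "k \<in> ?I" "j \<noteq> k" for j k
      proof (rule ccontr)
        assume "?A j \<inter> ?A k \<noteq> {}"
        then obtain t where "t \<in> ?A j" "t \<in> ?A k" by blast
        then have "\<bar>\<theta> j - \<theta> k\<bar> \<le> 2 * \<delta>" unfolding abs_le_iff atLeastAtMost_iff by linarith
        moreover have "\<not> y \<le> 2 * \<delta>" if "\<delta> \<le> y / 3" for y using that \<delta>pos by linarith
        ultimately show False using \<delta>b[OF that] by blast
      qed
      fix t assume "t \<in> {b..b + 2 * pi} - (\<Union>k\<in>?I. ?A k)"
      from power_mono[OF qb[OF this], of n]
      show "norm (?G n l t) \<le> q ^ n" by (simp add: norm_mult norm_power)
    qed (use q in auto)
    from mult_left_mono[OF this norm_ge_zero[of ?c]]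
    have "norm ?c * norm (integral {b..b + 2 * pi} (?G n l) - (\<Sum>k\<in>?I. integral (?A k) (?G n l))) \<le> q ^ n"
      by (simp add: norm_divide norm_mult)
    then have far: "norm (conv_power a n l - (\<Sum>k\<in>?I. ?c * integral (?A k) (?G n l))) \<le> q ^ n"
      unfolding conv_power_Fourier[OF an, of n l b] norm_mult[symmetric] right_diff_distrib sum_distrib_left .
    have "q ^ n \<le> C' * S"
    proof -
      define N where "N = real n powr (1 / (2 * real (\<mu> 1)))"
      note sc = scaled_distance_bound[OF m1 n l, folded N_def]
      have "q ^ n = exp (real n * ln q)" using q by (simp add: exp_of_nat_mult)
      also have "\<dots> = exp (- \<sigma> * N ^ (2 * \<mu> 1))" unfolding sc(2) by (simp add: \<sigma>_def mult.commute)
      also have "\<dots> \<le> N * exp (- \<sigma> * N ^ (2 * \<mu> 1))" using sc(1) by (simp add: mult_le_cancel_right1)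
      also have "\<dots> \<le> C' / N ^ Suc (Suc M) * exp (- c' * \<bar>(real_of_int l - \<alpha> 1 * real n) / N\<bar> powr (2 * real (\<mu> 1) / (2 * real (\<mu> 1) - 1)))"
        by (rule ab[OF sc(1) sc(3)])
      also have "\<dots> = C' * ?E 1 M n l c'"
        unfolding sc(5) N_def[symmetric] using sc(1) by (simp add: abs_divide)
      also have "\<dots> \<le> C' * S" using C' Emono[OF cc'] ES[OF one] by (intro mult_left_mono order.trans[OF Emono[OF cc'] ES[OF one]]) auto
      finally show ?thesis .
    qed
    moreover have "norm ((\<Sum>k\<in>?I. ?c * integral (?A k) (?G n l)) - (\<Sum>k\<in>?I. \<Sum>i\<le>M. ?T k n l i)) \<le> (\<Sum>k\<in>?I. CC k) * S"
      unfolding sum_subtractf[symmetric] sum_distrib_right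
    proof (rule order.trans[OF norm_sum sum_mono])
      fix k assume k: "k \<in> ?I"
      have "norm (?c * integral (?A k) (?G n l) - (\<Sum>i\<le>M. ?T k n l i)) \<le> CC k * ?E k M n l (cc k)"
        by (rule Cce[OF k n l])
      also have "\<dots> \<le> CC k * S"
        using Cc(1)[OF k] by (intro mult_left_mono order.trans[OF Emono[OF cck[OF k]] ES[OF k]]) auto
      finally show "norm (?c * integral (?A k) (?G n l) - (\<Sum>i\<le>M. ?T k n l i)) \<le> CC k * S" .
    qed
    ultimately have "norm ((conv_power a n l - (\<Sum>k\<in>?I. ?c * integral (?A k) (?G n l)))
        + ((\<Sum>k\<in>?I. ?c * integral (?A k) (?G n l)) - (\<Sum>k\<in>?I. \<Sum>i\<le>M. ?T k n l i))) \<le> C' * S + (\<Sum>k\<in>?I. CC k) * S"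
      using far by (intro norm_triangle_le add_mono) auto
    then show ?thesis by (simp add: C_def S_def distrib_right)
  qed
  show ?thesis by (rule exI[of _ C], rule exI[of _ c]) (use C c main in blast)
qed

theorem theorem1:
  fixes a :: "int \<Rightarrow> complex" and K :: nat and \<kappa> :: "nat \<Rightarrow> complex"
    and \<alpha> :: "nat \<Rightarrow> real" and \<beta> :: "nat \<Rightarrow> complex" and \<mu> :: "nat \<Rightarrow> nat"
    and P :: "nat \<Rightarrow> nat \<Rightarrow> complex poly"
  defines "P \<equiv> \<lambda>k. expansion_poly (cumulant a (\<kappa> k) (\<alpha> k) (\<beta> k) (\<mu> k)) (\<mu> k)"
  assumes "assumption_A1 a" and "assumption_A2 a K \<kappa> \<alpha> \<beta> \<mu>"
  shows "\<exists>(L::nat) (c0::real). L \<ge> 1 \<and> c0 > 0 \<and>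
    (\<forall>(n::nat) (l::int). n \<ge> 1 \<and> \<bar>l\<bar> > int L * int n \<longrightarrow>
       norm (conv_power a n l) \<le> exp (- c0 * real n - c0 * real_of_int \<bar>l\<bar>)) \<and>
    (\<forall>M::nat. \<exists>(C::real) (c::real). C > 0 \<and> c > 0 \<and>
      (\<forall>(n::nat) (l::int). n \<ge> 1 \<and> \<bar>l\<bar> \<le> int L * int n \<longrightarrow>
        norm (conv_power a n l
          - (\<Sum>k=1..K.
               \<kappa> k powi (- l) * symbol a (\<kappa> k) ^ n / of_real (real n powr (1 / (2 * real (\<mu> k)))) *
               H_fun (\<beta> k) (\<mu> k) ((real_of_int l - \<alpha> k * real n) / real n powr (1 / (2 * real (\<mu> k)))))
          - (\<Sum>k=1..K. \<Sum>m=1..M.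
               \<kappa> k powi (- l) * symbol a (\<kappa> k) ^ n / of_real (real n powr ((real m + 1) / (2 * real (\<mu> k)))) *
               poly_neg_deriv (P k m) (H_fun (\<beta> k) (\<mu> k))
                 ((real_of_int l - \<alpha> k * real n) / real n powr (1 / (2 * real (\<mu> k))))))
        \<le> C * (\<Sum>k=1..K.
               1 / real n powr ((real M + 2) / (2 * real (\<mu> k))) *
               exp (- c * (\<bar>real_of_int l - \<alpha> k * real n\<bar> / real n powr (1 / (2 * real (\<mu> k))))
                            powr (2 * real (\<mu> k) / (2 * real (\<mu> k) - 1))))))"
proof -
  \<comment> \<open>The far bound dictates \<open>L\<close>; the expansion in the near range is
    available for every \<open>L\<close>.\<close>
  obtain L c0 where L: "L \<ge> 1" "c0 > 0"
    and far: "\<forall>(n::nat) (l::int). n \<ge> 1 \<and> \<bar>l\<bar> > int L * int n \<longrightarrow>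
       norm (conv_power a n l) \<le> exp (- c0 * real n - c0 * real_of_int \<bar>l\<bar>)"
    using conv_power_far_bound[OF assms(2)] by blast
  \<comment> \<open>As \<open>expansion_poly\<close> at index 0 is 1, the leading term is the m = 0
    term of the general sum, and the two sums merge.\<close>
  have eq: "X - (\<Sum>k=1..K. f k 0) - (\<Sum>k=1..K. \<Sum>m=1..M. f k m) = X - (\<Sum>k=1..K. \<Sum>m\<le>M. f k m)"
    for X :: complex and f :: "nat \<Rightarrow> nat \<Rightarrow> complex" and M :: nat
  proof -
    have "{..M} = insert 0 {1..M}" by auto
    then show ?thesis by (simp add: sum.distrib)
  qed
  let ?T = "\<lambda>n l k i. \<kappa> k powi (- l) * symbol a (\<kappa> k) ^ n / of_real (real n powr ((real i + 1) / (2 * real (\<mu> k)))) *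
          poly_neg_deriv (P k i) (H_fun (\<beta> k) (\<mu> k))
            ((real_of_int l - \<alpha> k * real n) / real n powr (1 / (2 * real (\<mu> k))))"
  have T0: "?T n l k 0 = \<kappa> k powi (- l) * symbol a (\<kappa> k) ^ n / of_real (real n powr (1 / (2 * real (\<mu> k)))) *
      H_fun (\<beta> k) (\<mu> k) ((real_of_int l - \<alpha> k * real n) / real n powr (1 / (2 * real (\<mu> k))))" for n l k
    by (simp add: P_def poly_neg_deriv_1)
  have split: "X - (\<Sum>k=1..K. \<kappa> k powi (- l) * symbol a (\<kappa> k) ^ n / of_real (real n powr (1 / (2 * real (\<mu> k)))) *
      H_fun (\<beta> k) (\<mu> k) ((real_of_int l - \<alpha> k * real n) / real n powr (1 / (2 * real (\<mu> k)))))
      - (\<Sum>k=1..K. \<Sum>m=1..M. ?T n l k m) = X - (\<Sum>k=1..K. \<Sum>i\<le>M. ?T n l k i)" for X n l M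
    using eq[of X "?T n l" M] by (simp only: T0)
  show ?thesis
    unfolding split unfolding P_def
    by (rule exI[of _ L], rule exI[of _ c0], intro conjI far L allI local_limit_expansion[OF assms(2,3)])
qed

end
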